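(* Let $(X,\mathcal R)$ and $(Y,\mathcal S)$ be exactly triply regular symmetric $d$-class association schemes having the same Delta–Wye parameters with respect to orderings $A_0,\dots,A_d$, $A'_0,\dots,A'_d$ of their adjacency matrices and $E_0,\dots,E_d$, $E'_0,\dots,E'_d$ of their primitive idempotents, and let $\kappa:\mathbb A\to\mathbb A'$ be the linear map with $\kappa(A_i)=A'_i$ for $0\le i\le d$. Let $F$ be a connected planar graph, possibly with loops and multiple edges, and let $w:E(F)\to\mathbb A$ be any function. Then $$\mathsf S(F,\emptyset;w)=\mathsf S(F,\emptyset;\kappa\circ w).$$
   Context: A symmetric $d$-class association scheme $(X,\mathcal R)$ consists of a finite nonempty set $X$ and a partition $\mathcal R=\{R_0,\dots,R_d\}$ of $X\times X$ into nonempty symmetric relations, with $R_0=\{(x,x):x\in X\}$, such that for all $i,j,k$ the number $p_{ij}^k=|\{z\in X:(x,z)\in R_i,(z,y)\in R_j\}|$ (the intersection numbers) does not depend on the choice of $(x,y)\in R_k$. The adjacency matrix $A_i\in\mathrm{Mat}_X(\mathbb C)$ is the $0/1$ matrix of $R_i$. The Bose–Mesner algebra $\mathbb A=\mathrm{span}\{A_0,\dots,A_d\}$ is commutative and closed under ordinary matrix product and under the entrywise (Schur) product $\circ$; it has a second basis of primitive idempotents $E_0,\dots,E_d$ (symmetric, $E_iE_j=\delta_{ij}E_i$, $\sum_j E_j=I$). Eigenvalues $P_{ji}$ and dual eigenvalues $Q_{ji}$ are defined by $A_i=\sum_j P_{ji}E_j$ and $E_i=|X|^{-1}\sum_j Q_{ji}A_j$,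 and Krein parameters $q_{ij}^k$ by $E_i\circ E_j=|X|^{-1}\sum_k q_{ij}^kE_k$. For $L,M,N\in\mathrm{Mat}_X(\mathbb C)$ define tensors in $(\mathbb C^X)^{\otimes 3}$ (with standard basis vectors $\hat x$, $x\in X$): $\Delta(L,M,N)=\sum_{x,y,z\in X}L_{xz}M_{xy}N_{yz}\,\hat x\otimes\hat y\otimes\hat z$ and $\Upsilon(L,M,N)=\sum_{x,y,z,u\in X}L_{xu}M_{yu}N_{zu}\,\hat x\otimes\hat y\otimes\hat z$. Let $\Delta(\mathbb A)$ and $\Upsilon(\mathbb A)$ be the spans of all $\Delta(L,M,N)$, resp. $\Upsilon(L,M,N)$, with $L,M,N\in\mathbb A$. The scheme is triply regular if $\Upsilon(\mathbb A)\subseteq\Delta(\mathbb A)$, dually triply regular if $\Delta(\mathbb A)\subseteq\Upsilon(\mathbb A)$, and exactly triply regular if both hold. It is known that the tensors $\Upsilon(E_r,E_s,E_t)$ with $q_{rs}^t>0$ form a basis of $\Upsilon(\mathbb A)$. Delta–Wye parameters: if the scheme is exactly triply regular, then for each $i,j,k\in\{0,\dots,d\}$ there are unique scalars $\sigma^{i,j,k}_{r,s,t}$ ($r,s,t$ with $q_{rs}^t>0$; set $\sigma^{i,j,k}_{r,s,t}=0$ when $q_{rs}^t=0$) such that $\Delta(A_i,A_j,A_k)=\sum_{q_{rs}^t>0}\sigma^{i,j,k}_{r,s,t}\,\Upsilon(E_r,E_s,E_t)$. Two exactly triply regular $d$-class schemes $(X,\mathcal R)$, $(Y,\mathcal S)$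 have the same Delta–Wye parameters if there are orderings $A_0,\dots,A_d$ and $A'_0,\dots,A'_d$ of their adjacency matrices and $E_0,\dots,E_d$ and $E'_0,\dots,E'_d$ of their primitive idempotents such that $\sigma^{i,j,k}_{r,s,t}$ computed in $(X,\mathcal R)$ equals the corresponding $\sigma^{i,j,k}_{r,s,t}$ computed in $(Y,\mathcal S)$ for all $i,j,k,r,s,t\in\{0,\dots,d\}$. $\mathbb A'$ denotes the Bose–Mesner algebra of $(Y,\mathcal S)$. Scaffold of order zero: for a finite graph $F$ (loops and multiple edges allowed) and $w:E(F)\to\mathrm{Mat}_X(\mathbb C)$ with symmetric values, $\mathsf S(F,\emptyset;w)=\sum_{\varphi:V(F)\to X}\prod_{e\in E(F)}w(e)_{\varphi(a_e),\varphi(b_e)}$, where $a_e,b_e$ are the ends of $e$ ($a_e=b_e$ for a loop). *)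

theory Defs
  imports "HOL-Analysis.Analysis" "HOL-Library.FuncSet"
begin

text \<open>Matrices indexed by a finite type 'x are functions 'x \<Rightarrow> 'x \<Rightarrow> complex;
  tensors in (C^X)^{\<otimes>3} are functions 'x \<times> 'x \<times> 'x \<Rightarrow> complex.
  A d-class scheme on X = UNIV :: 'x set is given by an indexed family R 0, ..., R d
  of relations (this indexing is the ordering of the adjacency matrices).\<close>

type_synonym 'x mat = "'x \<Rightarrow> 'x \<Rightarrow> complex"

definition sym_assoc_scheme :: "nat \<Rightarrow> (nat \<Rightarrow> ('x::finite \<times> 'x) set) \<Rightarrow> bool" where
  "sym_assoc_scheme d R \<longleftrightarrow>
     (\<forall>i\<le>d. R i \<noteq> {}) \<and>
     (\<forall>x y. \<exists>!i. i \<le> d \<and> (x, y) \<in> R i) \<and>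
     R 0 = {(x, y). x = y} \<and>
     (\<forall>i\<le>d. \<forall>x y. (x, y) \<in> R i \<longrightarrow> (y, x) \<in> R i) \<and>
     (\<forall>i\<le>d. \<forall>j\<le>d. \<forall>k\<le>d. \<forall>x y x' y'. (x, y) \<in> R k \<longrightarrow> (x', y') \<in> R k \<longrightarrow>
        card {z. (x, z) \<in> R i \<and> (z, y) \<in> R j} = card {z. (x', z) \<in> R i \<and> (z, y') \<in> R j})"

definition adj_mat :: "(nat \<Rightarrow> ('x \<times> 'x) set) \<Rightarrow> nat \<Rightarrow> 'x mat" where
  "adj_mat R i = (\<lambda>x y. if (x, y) \<in> R i then 1 else 0)"

definition bose_mesner :: "nat \<Rightarrow> (nat \<Rightarrow> ('x \<times> 'x) set) \<Rightarrow> 'x mat set" where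
  "bose_mesner d R = {M. \<exists>c::nat \<Rightarrow> complex. M = (\<lambda>x y. \<Sum>i\<le>d. c i * adj_mat R i x y)}"

definition mmult :: "('x::finite) mat \<Rightarrow> 'x mat \<Rightarrow> 'x mat" where
  "mmult L M = (\<lambda>x z. \<Sum>y\<in>UNIV. L x y * M y z)"

definition schur :: "'x mat \<Rightarrow> 'x mat \<Rightarrow> 'x mat" where
  "schur L M = (\<lambda>x y. L x y * M x y)"

definition id_mat :: "'x mat" where
  "id_mat = (\<lambda>x y. if x = y then 1 else 0)"

definition zero_mat :: "'x mat" where
  "zero_mat = (\<lambda>x y. 0)"

text \<open>E 0, ..., E d is an ordering of the primitive idempotents: a basis of the
  Bose-Mesner algebra of symmetric, pairwise orthogonal idempotents summing to I.\<close>
definition prim_idempotents :: "nat \<Rightarrow> (nat \<Rightarrow> ('x::finite \<times> 'x) set) \<Rightarrow> (nat \<Rightarrow> 'x mat) \<Rightarrow> bool" where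
  "prim_idempotents d R E \<longleftrightarrow>
     (\<forall>i\<le>d. E i \<in> bose_mesner d R) \<and>
     (\<forall>i\<le>d. \<forall>x y. E i x y = E i y x) \<and>
     (\<forall>i\<le>d. \<forall>j\<le>d. mmult (E i) (E j) = (if i = j then E i else zero_mat)) \<and>
     (\<lambda>x y. \<Sum>i\<le>d. E i x y) = id_mat \<and>
     (\<forall>c::nat \<Rightarrow> complex. (\<lambda>x y. \<Sum>i\<le>d. c i * E i x y) = zero_mat \<longrightarrow> (\<forall>i\<le>d. c i = 0))"

text \<open>Krein parameter q_{rs}^t: E_r \<circ> E_s = |X|^{-1} \<Sum>_k q_{rs}^k E_k.\<close>
definition krein :: "nat \<Rightarrow> (nat \<Rightarrow> ('x::finite) mat) \<Rightarrow> nat \<Rightarrow> nat \<Rightarrow> nat \<Rightarrow> complex" where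
  "krein d E r s t = (THE q::nat \<Rightarrow> complex. (\<forall>k>d. q k = 0) \<and>
      schur (E r) (E s) = (\<lambda>x y. (1 / of_nat CARD('x)) * (\<Sum>k\<le>d. q k * E k x y))) t"

definition cpos :: "complex \<Rightarrow> bool" where
  "cpos q \<longleftrightarrow> Im q = 0 \<and> Re q > 0"

definition Delta :: "'x mat \<Rightarrow> 'x mat \<Rightarrow> 'x mat \<Rightarrow> ('x \<times> 'x \<times> 'x \<Rightarrow> complex)" where
  "Delta L M N = (\<lambda>(x, y, z). L x z * M x y * N y z)"

definition Upsilon :: "('x::finite) mat \<Rightarrow> 'x mat \<Rightarrow> 'x mat \<Rightarrow> ('x \<times> 'x \<times> 'x \<Rightarrow> complex)" where
  "Upsilon L M N = (\<lambda>(x, y, z). \<Sum>u\<in>UNIV. L x u * M y u * N z u)"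

definition cspan :: "('a \<Rightarrow> complex) set \<Rightarrow> ('a \<Rightarrow> complex) set" where
  "cspan S = {f. \<exists>T c. finite T \<and> T \<subseteq> S \<and> f = (\<lambda>a. \<Sum>g\<in>T. c g * g a)}"

definition Delta_alg :: "nat \<Rightarrow> (nat \<Rightarrow> ('x \<times> 'x) set) \<Rightarrow> ('x \<times> 'x \<times> 'x \<Rightarrow> complex) set" where
  "Delta_alg d R = cspan {Delta L M N | L M N.
      L \<in> bose_mesner d R \<and> M \<in> bose_mesner d R \<and> N \<in> bose_mesner d R}"

definition Upsilon_alg :: "nat \<Rightarrow> (nat \<Rightarrow> ('x::finite \<times> 'x) set) \<Rightarrow> ('x \<times> 'x \<times> 'x \<Rightarrow> complex) set" where
  "Upsilon_alg d R = cspan {Upsilon L M N | L M N.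
      L \<in> bose_mesner d R \<and> M \<in> bose_mesner d R \<and> N \<in> bose_mesner d R}"

definition exactly_triply_regular :: "nat \<Rightarrow> (nat \<Rightarrow> ('x::finite \<times> 'x) set) \<Rightarrow> bool" where
  "exactly_triply_regular d R \<longleftrightarrow>
     Upsilon_alg d R \<subseteq> Delta_alg d R \<and> Delta_alg d R \<subseteq> Upsilon_alg d R"

text \<open>Delta-Wye parameters sigma^{i,j,k}_{r,s,t} (as a function of r s t), zero when
  q_{rs}^t is not positive (or an index exceeds d).\<close>
definition dw_sigma :: "nat \<Rightarrow> (nat \<Rightarrow> ('x::finite \<times> 'x) set) \<Rightarrow> (nat \<Rightarrow> 'x mat)
    \<Rightarrow> nat \<Rightarrow> nat \<Rightarrow> nat \<Rightarrow> (nat \<Rightarrow> nat \<Rightarrow> nat \<Rightarrow> complex)" where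
  "dw_sigma d R E i j k = (THE \<sigma>.
     (\<forall>r s t. \<not> (r \<le> d \<and> s \<le> d \<and> t \<le> d \<and> cpos (krein d E r s t)) \<longrightarrow> \<sigma> r s t = 0) \<and>
     Delta (adj_mat R i) (adj_mat R j) (adj_mat R k) =
       (\<lambda>a. \<Sum>(r, s, t)\<in>{(r, s, t). r \<le> d \<and> s \<le> d \<and> t \<le> d \<and> cpos (krein d E r s t)}.
              \<sigma> r s t * Upsilon (E r) (E s) (E t) a))"

text \<open>Finite graphs with loops and multiple edges: vertex set V, edge set Ed,
  ends e = (a_e, b_e).\<close>
definition finite_graph :: "'v set \<Rightarrow> 'e set \<Rightarrow> ('e \<Rightarrow> 'v \<times> 'v) \<Rightarrow> bool" where
  "finite_graph V Ed ends \<longleftrightarrow> finite V \<and> finite Ed \<and> (\<forall>e\<in>Ed. fst (ends e) \<in> V \<and> snd (ends e) \<in> V)"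

definition graph_connected :: "'v set \<Rightarrow> 'e set \<Rightarrow> ('e \<Rightarrow> 'v \<times> 'v) \<Rightarrow> bool" where
  "graph_connected V Ed ends \<longleftrightarrow> V \<noteq> {} \<and>
     (\<forall>u\<in>V. \<forall>v\<in>V. (u, v) \<in> {(a, b). \<exists>e\<in>Ed. ends e = (a, b) \<or> ends e = (b, a)}\<^sup>*)"

text \<open>A planar embedding: vertices to distinct points of the plane, non-loop edges to
  arcs joining the images of their ends, loops to simple closed curves through the
  image of their vertex; an edge meets the vertex points only at its ends, and two
  distinct edges meet only in vertex points.\<close>
definition planar_embedding :: "'v set \<Rightarrow> 'e set \<Rightarrow> ('e \<Rightarrow> 'v \<times> 'v)
    \<Rightarrow> ('v \<Rightarrow> real^2) \<Rightarrow> ('e \<Rightarrow> real \<Rightarrow> real^2) \<Rightarrow> bool" where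
  "planar_embedding V Ed ends p c \<longleftrightarrow>
     inj_on p V \<and>
     (\<forall>e\<in>Ed. case ends e of (a, b) \<Rightarrow>
        pathstart (c e) = p a \<and> pathfinish (c e) = p b \<and>
        (if a = b then simple_path (c e) else arc (c e)) \<and>
        path_image (c e) \<inter> p ` V \<subseteq> {p a, p b}) \<and>
     (\<forall>e\<in>Ed. \<forall>e'\<in>Ed. e \<noteq> e' \<longrightarrow> path_image (c e) \<inter> path_image (c e') \<subseteq> p ` V)"

definition planar_graph :: "'v set \<Rightarrow> 'e set \<Rightarrow> ('e \<Rightarrow> 'v \<times> 'v) \<Rightarrow> bool" where
  "planar_graph V Ed ends \<longleftrightarrow> (\<exists>p c. planar_embedding V Ed ends p c)"

text \<open>Scaffold of order zero S(F, \<emptyset>; w).\<close>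
definition scaffold0 :: "'v set \<Rightarrow> 'e set \<Rightarrow> ('e \<Rightarrow> 'v \<times> 'v) \<Rightarrow> ('e \<Rightarrow> ('x::finite) mat) \<Rightarrow> complex" where
  "scaffold0 V Ed ends w =
     (\<Sum>\<phi>\<in>PiE V (\<lambda>_. UNIV). \<Prod>e\<in>Ed. w e (\<phi> (fst (ends e))) (\<phi> (snd (ends e))))"

end

theory Submission
  imports Defs
begin

text \<open>Call a graph good if its scaffold value is the same for \<open>w\<close> and \<open>\<kappa> \<circ> w\<close>, for all weights.
  Since \<open>I\<close> and \<open>J\<close> belong to the Bose-Mesner algebra, contracted edges can be given weight \<open>I\<close> and
  deleted edges weight \<open>J\<close>, so minors of good graphs are good. A planar graph without loops is a
  minor of a fine square grid: replace each vertex by a small square around its image and each arc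
  by the grid points close to it. Hence it suffices to treat square grids. There, removing a corner
  vertex in series creates a diagonal edge in the adjacent cell; a triangle-star exchange followed by
  a star-triangle exchange moves this edge to the next cell on the diagonal, until it is absorbed
  at the boundary. So the grid can be taken apart vertex by vertex.

  Both exchanges have the same coefficients in the two schemes. For triangle to star these are
  the Delta-Wye parameters. They also determine which stars of primitive idempotents vanish and all
  eigenvalues \<open>P\<^sub>r\<^sub>i\<close>, so \<open>\<kappa>\<close> maps \<open>E\<^sub>r\<close> to \<open>E'\<^sub>r\<close>, is multiplicative, and preserves the coefficients of
  star to triangle.\<close>

section \<open>Scaffold moves\<close>

text \<open>Planarity is given by arcs in the plane, without faces or a rotation system. The passage
  to a fine grid rests on elementary topology: positive distances between disjoint compact sets, and
  connectedness of an interval. It replaces an arbitrary planar graph by one whose reduction can be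
  written in coordinates. Minors also take care of multiple edges, since parallel edges go to
  different grid edges. Loops are split off beforehand, because the diagonal of a matrix in the
  algebra is constant. An exchange turns one graph into a linear combination of copies of another
  with new weights, so the induction ranges over all weights at once. It also runs in both schemes
  simultaneously, with the same coefficients; therefore \<open>\<kappa>\<close> is handled as a set
  of pairs of corresponding matrices. Nonvanishing stars are linearly independent, which is seen by
  contracting their three legs with idempotents. This makes the Delta-Wye parameters well defined
  and lets coefficients be compared across the schemes.\<close>

lemma scaffold0_split_vertex:
  fixes w :: "'v \<times> 'v \<Rightarrow> ('x::finite) mat"
  assumes V: "finite V" "v \<in> V" and fin: "finite Q" "finite L" and disj: "Q \<inter> L = {}"
    and avoid: "\<And>p q. (p, q) \<in> Q \<Longrightarrow> p \<noteq> v \<and> q \<noteq> v"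
    and u: "\<And>e. e \<in> Q \<Longrightarrow> w e = u e"
  shows "scaffold0 V (Q \<union> L) id w =
    (\<Sum>\<psi>\<in>PiE (V - {v}) (\<lambda>_. UNIV). (\<Prod>e\<in>Q. u e (\<psi> (fst e)) (\<psi> (snd e))) *
       (\<Sum>x\<in>UNIV. \<Prod>e\<in>L. w e ((\<psi>(v := x)) (fst e)) ((\<psi>(v := x)) (snd e))))"
proof -
  let ?B = "PiE (V - {v}) (\<lambda>_. UNIV :: 'x set)"
  let ?f = "\<lambda>\<phi>. \<Prod>e\<in>Q \<union> L. w e (\<phi> (fst e)) (\<phi> (snd e))"
  have VV: "V = insert v (V - {v})" using V by auto
  have PE: "PiE V (\<lambda>_. UNIV :: 'x set) = (\<lambda>(y, g). g(v := y)) ` (UNIV \<times> ?B)"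
    by (subst VV, subst PiE_insert_eq, rule refl)
  have inj: "inj_on (\<lambda>(y, g). g(v := y)) (UNIV \<times> ?B)"
    by (rule inj_combinator) simp
  have "scaffold0 V (Q \<union> L) id w = (\<Sum>\<phi>\<in>PiE V (\<lambda>_. UNIV). ?f \<phi>)"
    by (simp add: scaffold0_def)
  also have "\<dots> = (\<Sum>(y, g)\<in>UNIV \<times> ?B. ?f (g(v := y)))"
    by (subst PE, subst sum.reindex[OF inj]) (simp add: case_prod_unfold)
  also have "\<dots> = (\<Sum>y\<in>UNIV. \<Sum>g\<in>?B. ?f (g(v := y)))"
    by (rule sum.cartesian_product[symmetric])
  also have "\<dots> = (\<Sum>g\<in>?B. \<Sum>y\<in>UNIV. ?f (g(v := y)))"
    by (rule sum.swap)
  also have "\<dots> = (\<Sum>\<psi>\<in>?B. (\<Prod>e\<in>Q. u e (\<psi> (fst e)) (\<psi> (snd e))) *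
       (\<Sum>x\<in>UNIV. \<Prod>e\<in>L. w e ((\<psi>(v := x)) (fst e)) ((\<psi>(v := x)) (snd e))))"
  proof (rule sum.cong[OF refl])
    fix \<psi>
    have "?f (\<psi>(v := y)) = (\<Prod>e\<in>Q. u e (\<psi> (fst e)) (\<psi> (snd e))) *
       (\<Prod>e\<in>L. w e ((\<psi>(v := y)) (fst e)) ((\<psi>(v := y)) (snd e)))" for y
    proof -
      have "(\<Prod>e\<in>Q. w e ((\<psi>(v := y)) (fst e)) ((\<psi>(v := y)) (snd e)))
        = (\<Prod>e\<in>Q. u e (\<psi> (fst e)) (\<psi> (snd e)))"
        using avoid by (intro prod.cong) (fastforce simp: u)+
      then show ?thesis
        by (subst prod.union_disjoint[OF fin disj]) simp
    qed
    then show "(\<Sum>y\<in>UNIV. ?f (\<psi>(v := y))) = (\<Prod>e\<in>Q. u e (\<psi> (fst e)) (\<psi> (snd e))) *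
       (\<Sum>x\<in>UNIV. \<Prod>e\<in>L. w e ((\<psi>(v := x)) (fst e)) ((\<psi>(v := x)) (snd e)))"
      by (simp add: sum_distrib_left)
  qed
  finally show ?thesis .
qed

text \<open>Here and in \<open>scaffold0_split_vertex\<close>, \<open>u\<close> gives the weights on
  the part of the graph that is left alone. Thus a scaffold with updated weights near a vertex can
  be written with the same outer factor as the original one.\<close>

lemma scaffold0_insert:
  fixes w :: "'v \<times> 'v \<Rightarrow> ('x::finite) mat"
  assumes "finite Q" "(a, b) \<notin> Q" and u: "\<And>e. e \<in> Q \<Longrightarrow> w e = u e"
  shows "scaffold0 V (insert (a, b) Q) id w =
    (\<Sum>\<psi>\<in>PiE V (\<lambda>_. UNIV). (\<Prod>e\<in>Q. u e (\<psi> (fst e)) (\<psi> (snd e))) * w (a, b) (\<psi> a) (\<psi> b))"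
proof -
  have "(\<Prod>e\<in>Q. w e (\<psi> (fst e)) (\<psi> (snd e))) = (\<Prod>e\<in>Q. u e (\<psi> (fst e)) (\<psi> (snd e)))" for \<psi>
    by (intro prod.cong) (auto simp: u)
  then show ?thesis using assms by (simp add: scaffold0_def mult.commute)
qed

section \<open>Star-triangle exchanges inside a larger sum\<close>

lemma weighted_sum_linear:
  fixes \<rho> :: "'b \<Rightarrow> complex"
  shows "(\<Sum>\<psi>\<in>B. \<rho> \<psi> * (\<Sum>k\<in>K. c k * h k \<psi>)) = (\<Sum>k\<in>K. c k * (\<Sum>\<psi>\<in>B. \<rho> \<psi> * h k \<psi>))"
  by (simp add: sum_distrib_left sum.swap[of _ K B] mult.left_commute)

text \<open>\<open>f v\<close> collects all other factors that depend on \<open>v\<close>, so the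
  exchange may take place anywhere in a graph. The vertex \<open>v\<close> is kept: it becomes a
  leaf of the star, whose centre \<open>u\<close> is new. The order \<open>A\<close>,
  \<open>D\<close>, \<open>B\<close> is dictated by \<open>Delta\<close>, whose first and second
  matrices carry the edges \<open>xz\<close> and \<open>xy\<close>.\<close>

lemma sum_triangle_eq_sum_star:
  assumes "Delta A D B = (\<lambda>a. \<Sum>k\<in>K. s k * Upsilon (F k) (G k) (H k) a)"
  shows "D x y * (\<Sum>v\<in>UNIV. A x v * B y v * f v) =
    (\<Sum>k\<in>K. s k * (\<Sum>u\<in>UNIV. F k x u * G k y u * (\<Sum>v\<in>UNIV. H k v u * f v)))"
proof -
  have *: "(\<Sum>v\<in>UNIV. Upsilon (F k) (G k) (H k) (x, y, v) * f v) =
      (\<Sum>u\<in>UNIV. F k x u * G k y u * (\<Sum>v\<in>UNIV. H k v u * f v))" for k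
    unfolding Upsilon_def
    by (simp add: sum_distrib_left sum_distrib_right mult.assoc) (rule sum.swap)
  have "D x y * (\<Sum>v\<in>UNIV. A x v * B y v * f v) = (\<Sum>v\<in>UNIV. Delta A D B (x, y, v) * f v)"
    by (simp add: Delta_def sum_distrib_left mult_ac)
  also have "\<dots> = (\<Sum>k\<in>K. s k * (\<Sum>v\<in>UNIV. Upsilon (F k) (G k) (H k) (x, y, v) * f v))"
    unfolding assms by (simp add: sum_distrib_left sum_distrib_right mult.assoc sum.swap[of _ K UNIV])
  finally show ?thesis by (simp add: *)
qed

text \<open>The star has centre \<open>v\<close> and leaves \<open>u\<close>, \<open>z\<close>,
  \<open>t\<close>. Once it is a triangle, \<open>v\<close> is gone, \<open>u\<close> is joined
  directly to \<open>z\<close> and \<open>t\<close>, and the third side \<open>zt\<close> does not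
  involve \<open>u\<close> and comes out of the sum.\<close>

lemma sum_star_eq_sum_triangle:
  assumes "Upsilon H W Z = (\<lambda>a. \<Sum>k\<in>K. s k * Delta (F k) (G k) (D k) a)"
    and sym: "\<And>x y. H x y = H y x" "\<And>x y. W x y = W y x" "\<And>x y. Z x y = Z y x"
  shows "(\<Sum>u\<in>UNIV. A x u * B y u * (\<Sum>v\<in>UNIV. H v u * (W v z * Z v t))) =
    (\<Sum>k\<in>K. s k * (D k z t * (\<Sum>u\<in>UNIV. A x u * B y u * (G k u z * F k u t))))"
proof -
  have "(\<Sum>v\<in>UNIV. H v u * (W v z * Z v t)) = Upsilon H W Z (u, z, t)" for u
    by (simp add: Upsilon_def mult.assoc sym(1)[of u] sym(2)[of z] sym(3)[of t])
  then show ?thesis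
    unfolding assms(1) Delta_def by (simp add: sum_distrib_left mult_ac sum.swap[of _ K UNIV])
qed

text \<open>An abstract form of the pair of schemes, as the graph reduction sees it;
  \<open>\<A>\<close> will be the graph of \<open>\<kappa>\<close>. In both exchange assumptions the
  coefficients \<open>c\<close> are shared by the two sides. The index type is fixed because an
  assumption cannot quantify over types; it will hold triples of indices of idempotents or of
  relations.\<close>

locale star_triangle_pair =
  fixes \<A> :: "(('x::finite) mat \<times> ('y::finite) mat) set"
  assumes symmetric_left: "(M, M') \<in> \<A> \<Longrightarrow> M x y = M y x"
    and symmetric_right: "(M, M') \<in> \<A> \<Longrightarrow> M' x' y' = M' y' x'"
    and ones_mem: "(\<lambda>_ _. 1, \<lambda>_ _. 1) \<in> \<A>"
    and id_mem: "(id_mat, id_mat) \<in> \<A>"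
    and mmult_mem: "\<lbrakk>(L, L') \<in> \<A>; (M, M') \<in> \<A>\<rbrakk> \<Longrightarrow> (mmult L M, mmult L' M') \<in> \<A>"
    and row_sum: "(M, M') \<in> \<A> \<Longrightarrow>
      \<exists>m. (\<forall>y. (\<Sum>x\<in>UNIV. M x y) = m) \<and> (\<forall>y. (\<Sum>x\<in>UNIV. M' x y) = m)"
    and diagonal: "(M, M') \<in> \<A> \<Longrightarrow> \<exists>m. (\<forall>x. M x x = m) \<and> (\<forall>x. M' x x = m)"
    and card_eq: "CARD('x) = CARD('y)"
    and delta_wye: "\<lbrakk>(L, L') \<in> \<A>; (M, M') \<in> \<A>; (N, N') \<in> \<A>\<rbrakk> \<Longrightarrow>
      \<exists>(K :: (nat \<times> nat \<times> nat) set) c F G H F' G' H'.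
        (\<forall>k\<in>K. (F k, F' k) \<in> \<A> \<and> (G k, G' k) \<in> \<A> \<and> (H k, H' k) \<in> \<A>) \<and>
        Delta L M N = (\<lambda>a. \<Sum>k\<in>K. c k * Upsilon (F k) (G k) (H k) a) \<and>
        Delta L' M' N' = (\<lambda>a. \<Sum>k\<in>K. c k * Upsilon (F' k) (G' k) (H' k) a)"
    and wye_delta: "\<lbrakk>(L, L') \<in> \<A>; (M, M') \<in> \<A>; (N, N') \<in> \<A>\<rbrakk> \<Longrightarrow>
      \<exists>(K :: (nat \<times> nat \<times> nat) set) c F G H F' G' H'.
        (\<forall>k\<in>K. (F k, F' k) \<in> \<A> \<and> (G k, G' k) \<in> \<A> \<and> (H k, H' k) \<in> \<A>) \<and>
        Upsilon L M N = (\<lambda>a. \<Sum>k\<in>K. c k * Delta (F k) (G k) (H k) a) \<and>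
        Upsilon L' M' N' = (\<lambda>a. \<Sum>k\<in>K. c k * Delta (F' k) (G' k) (H' k) a)"
begin

text \<open>Edges are the vertex pairs themselves, with \<open>id\<close> as end map, so an edge set
  holds a given pair at most once. This is the origin of side conditions such as
  \<open>(a, b) \<notin> Q\<close> below: a new edge must not coincide with an old one.\<close>

definition transfers :: "'v set \<Rightarrow> ('v \<times> 'v) set \<Rightarrow> bool" where
  "transfers V P \<longleftrightarrow> (\<forall>w w'. (\<forall>e\<in>P. (w e, w' e) \<in> \<A>) \<longrightarrow>
     scaffold0 V P id w = scaffold0 V P id w')"

lemma transfersD:
  "transfers V P \<Longrightarrow> (\<And>e. e \<in> P \<Longrightarrow> (w e, w' e) \<in> \<A>) \<Longrightarrow> scaffold0 V P id w = scaffold0 V P id w'"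
  by (simp add: transfers_def)

lemma transfers_singleton: "transfers {v} {}"
  using card_eq by (simp add: transfers_def scaffold0_def card_PiE)

text \<open>Summing over \<open>v\<close> leaves the factor \<open>m\<close>, the column sum of its
  only weight, which does not depend on the value at \<open>a\<close> and is common to both
  schemes.\<close>

lemma transfers_pendant:
  assumes V: "finite V" "v \<in> V" and Q: "finite Q" "\<And>p q. (p, q) \<in> Q \<Longrightarrow> p \<noteq> v \<and> q \<noteq> v"
    and av: "a \<noteq> v" and base: "transfers (V - {v}) Q"
  shows "transfers V (insert (v, a) Q)"
  unfolding transfers_def
proof (intro allI impI)
  fix w :: "_ \<Rightarrow> 'x mat" and w' :: "_ \<Rightarrow> 'y mat"
  assume ww: "\<forall>e\<in>insert (v, a) Q. (w e, w' e) \<in> \<A>"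
  obtain m where m: "\<And>y. (\<Sum>x\<in>UNIV. w (v, a) x y) = m" "\<And>y. (\<Sum>x\<in>UNIV. w' (v, a) x y) = m"
    using row_sum[of "w (v, a)" "w' (v, a)"] ww by auto
  have *: "Q \<inter> {(v, a)} = {}" "insert (v, a) Q = Q \<union> {(v, a)}" using Q(2) by auto
  have "scaffold0 V (insert (v, a) Q) id w = m * scaffold0 (V - {v}) Q id w"
    unfolding *(2) by (subst scaffold0_split_vertex[OF V Q(1) _ *(1) Q(2)])
      (use av m in \<open>auto simp: scaffold0_def sum_distrib_left mult.commute\<close>)
  moreover have "scaffold0 V (insert (v, a) Q) id w' = m * scaffold0 (V - {v}) Q id w'"
    unfolding *(2) by (subst scaffold0_split_vertex[OF V Q(1) _ *(1) Q(2)])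
      (use av m in \<open>auto simp: scaffold0_def sum_distrib_left mult.commute\<close>)
  ultimately show "scaffold0 V (insert (v, a) Q) id w = scaffold0 V (insert (v, a) Q) id w'"
    using transfersD[OF base] ww by simp
qed

text \<open>Summing over \<open>v\<close> turns the two weights into their matrix product on a new
  edge \<open>(a, b)\<close>; symmetry of the first weight puts its arguments in the right
  order.\<close>

lemma transfers_series:
  assumes V: "finite V" "v \<in> V" and Q: "finite Q" "\<And>p q. (p, q) \<in> Q \<Longrightarrow> p \<noteq> v \<and> q \<noteq> v"
    and ab: "a \<noteq> v" "b \<noteq> v" "a \<noteq> b" "(a, b) \<notin> Q" and base: "transfers (V - {v}) (insert (a, b) Q)"
  shows "transfers V (Q \<union> {(v, a), (v, b)})"
  unfolding transfers_def
proof (intro allI impI)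
  fix w :: "_ \<Rightarrow> 'x mat" and w' :: "_ \<Rightarrow> 'y mat"
  assume ww: "\<forall>e\<in>Q \<union> {(v, a), (v, b)}. (w e, w' e) \<in> \<A>"
  let ?m = "mmult (w (v, a)) (w (v, b))" and ?m' = "mmult (w' (v, a)) (w' (v, b))"
  have mm: "(?m, ?m') \<in> \<A>" using ww by (intro mmult_mem) auto
  have sy: "w (v, a) x y = w (v, a) y x" "w' (v, a) x' y' = w' (v, a) y' x'" for x y x' y'
    using symmetric_left symmetric_right ww by blast+
  have *: "Q \<inter> {(v, a), (v, b)} = {}" using Q(2) by auto
  \<comment> \<open>The matrices here have an arbitrary index type, so that the identity serves in
    both schemes.\<close>
  have gen: "scaffold0 V (Q \<union> {(v, a), (v, b)}) id w
      = scaffold0 (V - {v}) (insert (a, b) Q) id (w((a, b) := mmult (w (v, a)) (w (v, b))))"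
    if "\<And>x y. w (v, a) x y = w (v, a) y x" for w :: "_ \<Rightarrow> ('z::finite) mat"
  proof -
    have u: "(w((a, b) := mmult (w (v, a)) (w (v, b)))) e = w e" if "e \<in> Q" for e
      using that ab by auto
    show ?thesis
      by (subst scaffold0_split_vertex[OF V Q(1) _ * Q(2) refl], simp, simp,
          subst scaffold0_insert[OF Q(1) ab(4) u], assumption)
        (use ab that in \<open>simp add: mmult_def\<close>)
  qed
  show "scaffold0 V (Q \<union> {(v, a), (v, b)}) id w = scaffold0 V (Q \<union> {(v, a), (v, b)}) id w'"
    unfolding gen[of w, OF sy(1)] gen[of w', OF sy(2)] by (rule transfersD[OF base]) (use ww mm in auto)
qed

text \<open>Replacing the triangle \<open>a, b, v\<close> by a star with centre \<open>u\<close> leaves \<open>v\<close> with the three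
  neighbours \<open>u\<close>, \<open>c\<close> and \<open>e\<close>; replacing this star by a triangle restores the original graph,
  with \<open>u\<close> in the place of \<open>v\<close>, except that the edge \<open>ab\<close> has moved to the opposite side.\<close>

lemma transfers_shift:
  assumes V: "finite V" "v \<in> V" and Q: "finite Q" "\<And>p q. (p, q) \<in> Q \<Longrightarrow> p \<noteq> v \<and> q \<noteq> v"
    and v: "v \<notin> {a, b, c, e}" and ab: "a \<noteq> b" "(a, b) \<notin> Q" and ce: "c \<noteq> e" "(e, c) \<notin> Q"
    and base: "transfers V (insert (e, c) Q \<union> {(a, v), (b, v), (v, c), (v, e)})"
  shows "transfers V (insert (a, b) Q \<union> {(a, v), (b, v), (v, c), (v, e)})"
  unfolding transfers_def
proof (intro allI impI)
  let ?L = "{(a, v), (b, v), (v, c), (v, e)}" and ?B = "PiE (V - {v}) (\<lambda>_. UNIV)"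
  fix w :: "_ \<Rightarrow> 'x mat" and w' :: "_ \<Rightarrow> 'y mat"
  assume ww: "\<forall>e\<in>insert (a, b) Q \<union> ?L. (w e, w' e) \<in> \<A>"
  define \<rho> where "\<rho> = (\<lambda>\<psi>. \<Prod>e\<in>Q. w e (\<psi> (fst e)) (\<psi> (snd e)))"
  define \<rho>' where "\<rho>' = (\<lambda>\<psi>. \<Prod>e\<in>Q. w' e (\<psi> (fst e)) (\<psi> (snd e)))"
  \<comment> \<open>Sums out \<open>v\<close> and separates the one edge \<open>(p, q)\<close> in
    which the source graph, with \<open>(a, b)\<close>, and the target graph, with
    \<open>(e, c)\<close>, differ.\<close>
  have gen: "scaffold0 V (insert (p, q) Q \<union> ?L) id w1 =
      (\<Sum>\<psi>\<in>?B. (\<Prod>e\<in>Q. w e (\<psi> (fst e)) (\<psi> (snd e))) *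
        (w1 (p, q) (\<psi> p) (\<psi> q) * (\<Sum>x\<in>UNIV. w1 (a, v) (\<psi> a) x * w1 (b, v) (\<psi> b) x *
          (w1 (v, c) x (\<psi> c) * w1 (v, e) x (\<psi> e)))))"
    if "(p, q) \<notin> Q" "p \<noteq> v" "q \<noteq> v" "\<And>e. e \<in> Q \<Longrightarrow> w1 e = w e"
    for w w1 :: "_ \<Rightarrow> ('z::finite) mat" and p q
  proof -
    have 1: "finite (insert (p, q) Q)" "insert (p, q) Q \<inter> ?L = {}"
      "\<And>p' q'. (p', q') \<in> insert (p, q) Q \<Longrightarrow> p' \<noteq> v \<and> q' \<noteq> v"
      using that Q by auto
    have 2: "(\<Prod>e\<in>insert (p, q) Q. w1 e (\<psi> (fst e)) (\<psi> (snd e))) =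
      (\<Prod>e\<in>Q. w e (\<psi> (fst e)) (\<psi> (snd e))) * w1 (p, q) (\<psi> p) (\<psi> q)" for \<psi>
    proof -
      have "(\<Prod>e\<in>Q. w1 e (\<psi> (fst e)) (\<psi> (snd e))) = (\<Prod>e\<in>Q. w e (\<psi> (fst e)) (\<psi> (snd e)))"
        by (intro prod.cong) (auto simp: that)
      then show ?thesis using that Q by simp
    qed
    have 3: "(\<Prod>e\<in>?L. w1 e ((\<psi>(v := x)) (fst e)) ((\<psi>(v := x)) (snd e))) =
      w1 (a, v) (\<psi> a) x * w1 (b, v) (\<psi> b) x * (w1 (v, c) x (\<psi> c) * w1 (v, e) x (\<psi> e))" for \<psi> x
      using v ab(1) ce(1) by (auto simp: mult.assoc)
    show ?thesis
      by (subst scaffold0_split_vertex[OF V 1(1) _ 1(2,3) refl]) (simp_all only: 2 3 mult.assoc finite.intros)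
  qed
  \<comment> \<open>Any sum of the shape left by the two exchanges is a scaffold of the target
    graph, where \<open>base\<close> applies; the summation variable \<open>u\<close> plays the part
    of \<open>v\<close>.\<close>
  have target: "(\<Sum>\<psi>\<in>?B. \<rho> \<psi> * (D (\<psi> c) (\<psi> e) *
        (\<Sum>u\<in>UNIV. F (\<psi> a) u * G (\<psi> b) u * (K u (\<psi> c) * M u (\<psi> e))))) =
      (\<Sum>\<psi>\<in>?B. \<rho>' \<psi> * (D' (\<psi> c) (\<psi> e) *
        (\<Sum>u\<in>UNIV. F' (\<psi> a) u * G' (\<psi> b) u * (K' u (\<psi> c) * M' u (\<psi> e)))))"
    (is "?l = ?r") if "(D, D') \<in> \<A>" "(F, F') \<in> \<A>" "(G, G') \<in> \<A>" "(K, K') \<in> \<A>" "(M, M') \<in> \<A>" for D D' F F' G G' K K' M M'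
  proof -
    \<comment> \<open>The exchange yields \<open>D\<close> with the arguments \<open>c\<close>,
      \<open>e\<close>, while the new edge is oriented as \<open>(e, c)\<close> to fit the next
      diagonal of the grid. Symmetry of \<open>D\<close> removes the transposition.\<close>
    let ?w = "w((e, c) := (\<lambda>x y. D y x), (a, v) := F, (b, v) := G, (v, c) := K, (v, e) := M)"
    let ?w' = "w'((e, c) := (\<lambda>x y. D' y x), (a, v) := F', (b, v) := G', (v, c) := K', (v, e) := M')"
    have D: "(\<lambda>x y. D y x) = D" "(\<lambda>x y. D' y x) = D'"
      using symmetric_left[OF that(1)] symmetric_right[OF that(1)] by blast+
    have nv: "a \<noteq> v" "b \<noteq> v" "c \<noteq> v" "e \<noteq> v" using v by auto
    have neq: "(e, c) \<notin> Q" "e \<noteq> v" "c \<noteq> v" and u: "\<And>e. e \<in> Q \<Longrightarrow> ?w e = w e" "\<And>e. e \<in> Q \<Longrightarrow> ?w' e = w' e"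
      using v ce Q(2) by auto
    have "?l = scaffold0 V (insert (e, c) Q \<union> ?L) id ?w"
      by (subst gen[of e c ?w w, OF neq u(1)]) (use nv ab(1) ce(1) in \<open>auto simp: \<rho>_def\<close>)
    also have "\<dots> = scaffold0 V (insert (e, c) Q \<union> ?L) id ?w'"
      by (rule transfersD[OF base]) (use that ww D in auto)
    also have "\<dots> = ?r"
      by (subst gen[of e c ?w' w', OF neq u(2)]) (use nv ab(1) ce(1) in \<open>auto simp: \<rho>'_def\<close>)
    finally show ?thesis .
  qed
  obtain K :: "(nat \<times> nat \<times> nat) set" and s F G H F' G' H' where
    FGH: "\<forall>k\<in>K. (F k, F' k) \<in> \<A> \<and> (G k, G' k) \<in> \<A> \<and> (H k, H' k) \<in> \<A>" and
    dX: "Delta (w (a, v)) (w (a, b)) (w (b, v)) = (\<lambda>a. \<Sum>k\<in>K. s k * Upsilon (F k) (G k) (H k) a)" and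
    dY: "Delta (w' (a, v)) (w' (a, b)) (w' (b, v)) = (\<lambda>a. \<Sum>k\<in>K. s k * Upsilon (F' k) (G' k) (H' k) a)"
    using delta_wye[of "w (a, v)" "w' (a, v)" "w (a, b)" "w' (a, b)" "w (b, v)" "w' (b, v)"] ww by auto
  \<comment> \<open>The second exchange depends on \<open>k\<close>, because the leg
    \<open>H k\<close> of the first star is one leg of the star at \<open>v\<close>.\<close>
  have mid: "(\<Sum>\<psi>\<in>?B. \<rho> \<psi> * (\<Sum>u\<in>UNIV. F k (\<psi> a) u * G k (\<psi> b) u *
        (\<Sum>x\<in>UNIV. H k x u * (w (v, c) x (\<psi> c) * w (v, e) x (\<psi> e))))) =
      (\<Sum>\<psi>\<in>?B. \<rho>' \<psi> * (\<Sum>u\<in>UNIV. F' k (\<psi> a) u * G' k (\<psi> b) u *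
        (\<Sum>x\<in>UNIV. H' k x u * (w' (v, c) x (\<psi> c) * w' (v, e) x (\<psi> e)))))"
    if k: "k \<in> K" for k
  proof -
    have mem: "(F k, F' k) \<in> \<A>" "(G k, G' k) \<in> \<A>" "(H k, H' k) \<in> \<A>"
      "(w (v, c), w' (v, c)) \<in> \<A>" "(w (v, e), w' (v, e)) \<in> \<A>" using FGH k ww by auto
    obtain K1 :: "(nat \<times> nat \<times> nat) set" and s1 F1 G1 H1 F1' G1' H1' where
      mem1: "\<forall>k\<in>K1. (F1 k, F1' k) \<in> \<A> \<and> (G1 k, G1' k) \<in> \<A> \<and> (H1 k, H1' k) \<in> \<A>" and
      uX: "Upsilon (H k) (w (v, c)) (w (v, e)) = (\<lambda>a. \<Sum>k\<in>K1. s1 k * Delta (F1 k) (G1 k) (H1 k) a)" and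
      uY: "Upsilon (H' k) (w' (v, c)) (w' (v, e)) = (\<lambda>a. \<Sum>k\<in>K1. s1 k * Delta (F1' k) (G1' k) (H1' k) a)"
      using wye_delta[OF mem(3-5)] by (elim exE conjE) (rule that)
    note X = sum_star_eq_sum_triangle[OF uX symmetric_left[OF mem(3)] symmetric_left[OF mem(4)] symmetric_left[OF mem(5)]]
    note Y = sum_star_eq_sum_triangle[OF uY symmetric_right[OF mem(3)] symmetric_right[OF mem(4)] symmetric_right[OF mem(5)]]
    show ?thesis
      unfolding X Y
      by (rule trans[OF weighted_sum_linear], rule trans[OF _ weighted_sum_linear[symmetric]], intro sum.cong refl arg_cong2[where f = times] target) (use mem mem1 in auto)
  qed
  have neq: "(a, b) \<notin> Q" "a \<noteq> v" "b \<noteq> v" using v ab by auto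
  show "scaffold0 V (insert (a, b) Q \<union> ?L) id w = scaffold0 V (insert (a, b) Q \<union> ?L) id w'"
    unfolding gen[of a b w w, OF neq refl] gen[of a b w' w', OF neq refl]
      sum_triangle_eq_sum_star[OF dX] sum_triangle_eq_sum_star[OF dY]
    by (rule trans[OF weighted_sum_linear], rule trans[OF _ weighted_sum_linear[symmetric]], intro sum.cong refl arg_cong2[where f = times] mid[unfolded \<rho>_def \<rho>'_def])
qed

text \<open>The case of \<open>v\<close> on the boundary of the grid, where the new edge \<open>uv\<close> merges with \<open>vc\<close> in series.\<close>

lemma transfers_absorb:
  assumes V: "finite V" "v \<in> V" and Q: "finite Q" "\<And>p q. (p, q) \<in> Q \<Longrightarrow> p \<noteq> v \<and> q \<noteq> v"
    and v: "v \<notin> {a, b, c}" and ab: "a \<noteq> b" "(a, b) \<notin> Q"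
    and base: "transfers V (Q \<union> {(a, v), (b, v), (v, c)})"
  shows "transfers V (insert (a, b) Q \<union> {(a, v), (b, v), (v, c)})"
  unfolding transfers_def
proof (intro allI impI)
  let ?L = "{(a, v), (b, v), (v, c)}" and ?B = "PiE (V - {v}) (\<lambda>_. UNIV)"
  fix w :: "_ \<Rightarrow> 'x mat" and w' :: "_ \<Rightarrow> 'y mat"
  assume ww: "\<forall>e\<in>insert (a, b) Q \<union> ?L. (w e, w' e) \<in> \<A>"
  define \<rho> where "\<rho> = (\<lambda>\<psi>. \<Prod>e\<in>Q. w e (\<psi> (fst e)) (\<psi> (snd e)))"
  define \<rho>' where "\<rho>' = (\<lambda>\<psi>. \<Prod>e\<in>Q. w' e (\<psi> (fst e)) (\<psi> (snd e)))"
  have 1: "finite (insert (a, b) Q)" "insert (a, b) Q \<inter> ?L = {}" "Q \<inter> ?L = {}"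
    "\<And>p' q'. (p', q') \<in> insert (a, b) Q \<Longrightarrow> p' \<noteq> v \<and> q' \<noteq> v"
    using v Q by auto
  have 2: "(\<Prod>e\<in>?L. w e ((\<psi>(v := x)) (fst e)) ((\<psi>(v := x)) (snd e))) =
    w (a, v) (\<psi> a) x * w (b, v) (\<psi> b) x * w (v, c) x (\<psi> c)" for \<psi> x and w :: "_ \<Rightarrow> ('z::finite) mat"
    using v ab(1) by (auto simp: mult.assoc)
  have 3: "(\<Prod>e\<in>insert (a, b) Q. w e (\<psi> (fst e)) (\<psi> (snd e))) =
      (\<Prod>e\<in>Q. w e (\<psi> (fst e)) (\<psi> (snd e))) * w (a, b) (\<psi> a) (\<psi> b)" for \<psi> and w :: "_ \<Rightarrow> ('z::finite) mat"
    using Q ab by simp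
  have full: "scaffold0 V (insert (a, b) Q \<union> ?L) id w =
      (\<Sum>\<psi>\<in>?B. (\<Prod>e\<in>Q. w e (\<psi> (fst e)) (\<psi> (snd e))) *
        (w (a, b) (\<psi> a) (\<psi> b) * (\<Sum>x\<in>UNIV. w (a, v) (\<psi> a) x * w (b, v) (\<psi> b) x * w (v, c) x (\<psi> c))))"
    for w :: "_ \<Rightarrow> ('z::finite) mat"
    by (subst scaffold0_split_vertex[OF V 1(1) _ 1(2,4) refl])
      (simp_all only: 2 3 mult.assoc finite.intros)
  have target: "(\<Sum>\<psi>\<in>?B. \<rho> \<psi> * (\<Sum>u\<in>UNIV. F (\<psi> a) u * G (\<psi> b) u * K u (\<psi> c))) =
      (\<Sum>\<psi>\<in>?B. \<rho>' \<psi> * (\<Sum>u\<in>UNIV. F' (\<psi> a) u * G' (\<psi> b) u * K' u (\<psi> c)))"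
    (is "?l = ?r") if "(F, F') \<in> \<A>" "(G, G') \<in> \<A>" "(K, K') \<in> \<A>" for F F' G G' K K'
  proof -
    let ?w = "w((a, v) := F, (b, v) := G, (v, c) := K)"
    let ?w' = "w'((a, v) := F', (b, v) := G', (v, c) := K')"
    have u: "\<And>e. e \<in> Q \<Longrightarrow> ?w e = w e" "\<And>e. e \<in> Q \<Longrightarrow> ?w' e = w' e"
      using v Q(2) by auto
    have nv: "a \<noteq> v" "b \<noteq> v" "c \<noteq> v" using v by auto
    have fL: "finite ?L" by simp
    have "?l = scaffold0 V (Q \<union> ?L) id ?w"
      by (subst scaffold0_split_vertex[OF V Q(1) fL 1(3) Q(2) u(1)])
        (simp_all only: 2, simp_all add: nv nv[symmetric] ab(1) \<rho>_def)
    also have "\<dots> = scaffold0 V (Q \<union> ?L) id ?w'"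
      by (rule transfersD[OF base]) (use that ww in auto)
    also have "\<dots> = ?r"
      by (subst scaffold0_split_vertex[OF V Q(1) fL 1(3) Q(2) u(2)])
        (simp_all only: 2, simp_all add: nv nv[symmetric] ab(1) \<rho>'_def)
    finally show ?thesis .
  qed
  obtain K :: "(nat \<times> nat \<times> nat) set" and s F G H F' G' H' where
    FGH: "\<forall>k\<in>K. (F k, F' k) \<in> \<A> \<and> (G k, G' k) \<in> \<A> \<and> (H k, H' k) \<in> \<A>" and
    dX: "Delta (w (a, v)) (w (a, b)) (w (b, v)) = (\<lambda>a. \<Sum>k\<in>K. s k * Upsilon (F k) (G k) (H k) a)" and
    dY: "Delta (w' (a, v)) (w' (a, b)) (w' (b, v)) = (\<lambda>a. \<Sum>k\<in>K. s k * Upsilon (F' k) (G' k) (H' k) a)"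
    using delta_wye[of "w (a, v)" "w' (a, v)" "w (a, b)" "w' (a, b)" "w (b, v)" "w' (b, v)"] ww by auto
  have mid: "(\<Sum>\<psi>\<in>?B. \<rho> \<psi> * (\<Sum>u\<in>UNIV. F k (\<psi> a) u * G k (\<psi> b) u *
        (\<Sum>x\<in>UNIV. H k x u * w (v, c) x (\<psi> c)))) =
      (\<Sum>\<psi>\<in>?B. \<rho>' \<psi> * (\<Sum>u\<in>UNIV. F' k (\<psi> a) u * G' k (\<psi> b) u *
        (\<Sum>x\<in>UNIV. H' k x u * w' (v, c) x (\<psi> c))))"
    if k: "k \<in> K" for k
  proof -
    have mem: "(F k, F' k) \<in> \<A>" "(G k, G' k) \<in> \<A>" "(H k, H' k) \<in> \<A>"
      "(w (v, c), w' (v, c)) \<in> \<A>" using FGH k ww by auto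
    have "(\<Sum>x\<in>UNIV. H k x u * w (v, c) x y) = mmult (H k) (w (v, c)) u y" for u y
      by (simp add: mmult_def symmetric_left[OF mem(3), of u])
    moreover have "(\<Sum>x\<in>UNIV. H' k x u * w' (v, c) x y) = mmult (H' k) (w' (v, c)) u y" for u y
      by (simp add: mmult_def symmetric_right[OF mem(3), of u])
    ultimately show ?thesis
      using target[OF mem(1,2) mmult_mem[OF mem(3,4)]] by simp
  qed
  show "scaffold0 V (insert (a, b) Q \<union> ?L) id w = scaffold0 V (insert (a, b) Q \<union> ?L) id w'"
    unfolding full sum_triangle_eq_sum_star[OF dX] sum_triangle_eq_sum_star[OF dY]
    by (rule trans[OF weighted_sum_linear], rule trans[OF _ weighted_sum_linear[symmetric]], intro sum.cong refl arg_cong2[where f = times] mid[unfolded \<rho>_def \<rho>'_def])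
qed

end

section \<open>Reduction of square grids\<close>

definition grid_edges :: "(int \<times> int) set \<Rightarrow> ((int \<times> int) \<times> int \<times> int) set" where
  "grid_edges U = {(p, q). p \<in> U \<and> q \<in> U \<and> (q = (fst p + 1, snd p) \<or> q = (fst p, snd p + 1))}"

text \<open>The extra vertex \<open>(n + 1, n)\<close> saves a case distinction: it makes
  every diagonal chain end at a vertex that has exactly one neighbour ahead.\<close>
definition grid_region :: "int \<Rightarrow> int \<Rightarrow> int \<Rightarrow> int \<Rightarrow> (int \<times> int) set" where
  "grid_region l n r k = {(i, j). l \<le> j \<and> j \<le> n \<and> (r < i \<or> i = r \<and> k \<le> j) \<and> (i \<le> n \<or> i = n + 1 \<and> j = n)}"

lemma finite_grid_region [simp]: "finite (grid_region l n r k)"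
  by (rule finite_subset[of _ "{r..n+1} \<times> {l..n}"]) (auto simp: grid_region_def)

lemma finite_grid_edges [simp]: "finite U \<Longrightarrow> finite (grid_edges U)"
  by (rule finite_subset[of _ "U \<times> U"]) (auto simp: grid_edges_def)

lemma grid_edges_at_vertex:
  "grid_edges U = {(p, q) \<in> grid_edges U. p \<noteq> (i, j) \<and> q \<noteq> (i, j)} \<union>
    {((i - 1, j), (i, j)), ((i, j - 1), (i, j)), ((i, j), (i + 1, j)), ((i, j), (i, j + 1))} \<inter> U \<times> U"
  by (auto simp: grid_edges_def)

lemma grid_edges_delete:
  "{(p, q) \<in> grid_edges U. p \<noteq> v \<and> q \<noteq> v} = grid_edges (U - {v})"
  by (auto simp: grid_edges_def)

section \<open>Removal of the grid vertices in lexicographic order\<close>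

context star_triangle_pair
begin

text \<open>The edge is the falling diagonal of the cell with lower left corner
  \<open>(i, j)\<close>; that corner may be missing, as it is for the first diagonal, at
  \<open>(r, k)\<close>. It is pushed across \<open>(i + 1, j + 1)\<close> into the next cell, so
  \<open>n - i\<close> decreases. In column \<open>n\<close> below the top row, and on the top row,
  the vertex \<open>(i + 1, j + 1)\<close> has a single neighbour ahead and absorbs the edge; for
  \<open>(n, n)\<close> this neighbour is the extra vertex.\<close>

lemma transfers_grid_diagonal:
  fixes l n r k :: int
  defines "U \<equiv> grid_region l n r (k + 1)"
  assumes base: "transfers U (grid_edges U)" and lk: "l \<le> k"
  shows "l \<le> j \<Longrightarrow> j < n \<Longrightarrow> i < n \<Longrightarrow> r < i \<or> i = r \<and> k \<le> j \<Longrightarrow>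
    transfers U (insert ((i, j + 1), (i + 1, j)) (grid_edges U))"
proof (induction "nat (n - i)" arbitrary: i j rule: less_induct)
  case less
  define Q where "Q = {(p, q) \<in> grid_edges U. p \<noteq> (i + 1, j + 1) \<and> q \<noteq> (i + 1, j + 1)}"
  have finU: "finite U" by (simp add: U_def)
  have Q: "finite Q" "\<And>p q. (p, q) \<in> Q \<Longrightarrow> p \<noteq> (i + 1, j + 1) \<and> q \<noteq> (i + 1, j + 1)"
    using finite_grid_edges[OF finU] by (auto simp: Q_def intro: finite_subset[rotated])
  have notQ: "((i, j + 1), (i + 1, j)) \<notin> Q" "((i + 1, j + 2), (i + 2, j + 1)) \<notin> Q"
    by (auto simp: Q_def grid_edges_def)
  have mem: "(i, j + 1) \<in> U" "(i + 1, j) \<in> U" "(i + 1, j + 1) \<in> U"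
    using less.prems lk by (auto simp: U_def grid_region_def)
  have split: "grid_edges U = Q \<union> {((i, j + 1), (i + 1, j + 1)), ((i + 1, j), (i + 1, j + 1)),
      ((i + 1, j + 1), (i + 2, j + 1)), ((i + 1, j + 1), (i + 1, j + 2))} \<inter> U \<times> U"
    unfolding Q_def by (subst grid_edges_at_vertex[of U "i + 1" "j + 1"]) (simp add: add.commute)
  show ?case
  proof (cases "j + 1 < n \<and> i + 1 < n")
    case True
    then have mem2: "(i + 2, j + 1) \<in> U" "(i + 1, j + 2) \<in> U"
      using less.prems by (auto simp: U_def grid_region_def)
    have eq: "grid_edges U = Q \<union> {((i, j + 1), (i + 1, j + 1)), ((i + 1, j), (i + 1, j + 1)),
      ((i + 1, j + 1), (i + 2, j + 1)), ((i + 1, j + 1), (i + 1, j + 2))}"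
      by (subst split) (use mem mem2 in auto)
    have "transfers U (insert ((i + 1, (j + 1) + 1), ((i + 1) + 1, j + 1)) (grid_edges U))"
      using True less.prems by (intro less.hyps) auto
    then have "transfers U (insert ((i + 1, j + 2), (i + 2, j + 1)) Q \<union> {((i, j + 1), (i + 1, j + 1)),
        ((i + 1, j), (i + 1, j + 1)), ((i + 1, j + 1), (i + 2, j + 1)), ((i + 1, j + 1), (i + 1, j + 2))})"
      unfolding eq by (simp add: add.commute insert_commute)
    then show ?thesis
      unfolding eq Un_insert_left[symmetric]
      by (intro transfers_shift[OF finU mem(3) Q]) (use notQ in auto)
  next
    case False
    show ?thesis
    proof (cases "j + 1 < n")
      case True
      with False less.prems have *: "(i + 2, j + 1) \<notin> U" "(i + 1, j + 2) \<in> U"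
        by (auto simp: U_def grid_region_def)
      have eq: "grid_edges U = Q \<union> {((i, j + 1), (i + 1, j + 1)), ((i + 1, j), (i + 1, j + 1)),
          ((i + 1, j + 1), (i + 1, j + 2))}"
        by (subst split) (use mem * in auto)
      show ?thesis
        using base unfolding eq Un_insert_left[symmetric]
        by (intro transfers_absorb[OF finU mem(3) Q]) (use notQ in auto)
    next
      case False
      with less.prems have *: "(i + 2, j + 1) \<in> U" "(i + 1, j + 2) \<notin> U"
        by (auto simp: U_def grid_region_def)
      have eq: "grid_edges U = Q \<union> {((i, j + 1), (i + 1, j + 1)), ((i + 1, j), (i + 1, j + 1)),
          ((i + 1, j + 1), (i + 2, j + 1))}"
        by (subst split) (use mem * in auto)
      show ?thesis
        using base unfolding eq Un_insert_left[symmetric]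
        by (intro transfers_absorb[OF finU mem(3) Q]) (use notQ in auto)
    qed
  qed
qed

text \<open>The lexicographically least vertex \<open>(r, k)\<close> has neighbours at most to the
  right and above. With both it is removed in series, creating the diagonal handled by
  \<open>transfers_grid_diagonal\<close>; on the top row or in column \<open>n\<close> only one is
  left and the vertex is pendant.\<close>

lemma transfers_grid_step:
  assumes base: "transfers (grid_region l n r (k + 1)) (grid_edges (grid_region l n r (k + 1)))"
    and bounds: "l \<le> k" "k \<le> n" "r \<le> n"
  shows "transfers (grid_region l n r k) (grid_edges (grid_region l n r k))"
proof -
  let ?U = "grid_region l n r k" and ?U' = "grid_region l n r (k + 1)"
  have del: "?U - {(r, k)} = ?U'" and mem: "(r, k) \<in> ?U"
    using bounds by (auto simp: grid_region_def)
  have split: "grid_edges ?U = grid_edges ?U' \<union>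
    {((r - 1, k), (r, k)), ((r, k - 1), (r, k)), ((r, k), (r + 1, k)), ((r, k), (r, k + 1))} \<inter> ?U \<times> ?U"
    unfolding del[symmetric] grid_edges_delete[symmetric] by (rule grid_edges_at_vertex)
  have avoid: "\<And>p q. (p, q) \<in> grid_edges ?U' \<Longrightarrow> p \<noteq> (r, k) \<and> q \<noteq> (r, k)"
    by (auto simp: grid_edges_def del[symmetric])
  have fin: "finite ?U" "finite (grid_edges ?U')" by auto
  have no: "(r - 1, k) \<notin> ?U" "(r, k - 1) \<notin> ?U" by (auto simp: grid_region_def)
  consider "r < n" "k < n" | "k = n" | "r = n" "k < n" using bounds by linarith
  then show ?thesis
  proof cases
    case 1
    have eq: "grid_edges ?U = grid_edges ?U' \<union> {((r, k), (r, k + 1)), ((r, k), (r + 1, k))}"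
      by (subst split) (use no 1 bounds in \<open>auto simp: grid_region_def\<close>)
    have "transfers ?U' (insert ((r, k + 1), (r + 1, k)) (grid_edges ?U'))"
      using 1 bounds by (intro transfers_grid_diagonal[OF base]) auto
    moreover have "((r, k + 1), (r + 1, k)) \<notin> grid_edges ?U'" by (auto simp: grid_edges_def)
    ultimately show ?thesis
      unfolding eq by (intro transfers_series[OF fin(1) mem fin(2) avoid]) (auto simp: del)
  next
    case 2
    have eq: "grid_edges ?U = insert ((r, k), (r + 1, k)) (grid_edges ?U')"
      by (subst split) (use no 2 bounds in \<open>auto simp: grid_region_def\<close>)
    show ?thesis
      unfolding eq by (intro transfers_pendant[OF fin(1) mem fin(2) avoid]) (auto simp: del base)
  next
    case 3
    have eq: "grid_edges ?U = insert ((r, k), (r, k + 1)) (grid_edges ?U')"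
      by (subst split) (use no 3 bounds in \<open>auto simp: grid_region_def\<close>)
    show ?thesis
      unfolding eq by (intro transfers_pendant[OF fin(1) mem fin(2) avoid]) (auto simp: del base)
  qed
qed

text \<open>Columns are emptied from left to right, each from bottom to top, and the induction runs
  backwards from the single vertex \<open>(n + 1, n)\<close>. The region with column
  \<open>r\<close> emptied (last argument \<open>n + 1\<close>) is the region starting with column
  \<open>r + 1\<close> (last argument \<open>l\<close>).\<close>

lemma transfers_grid:
  assumes "l \<le> n"
  shows "transfers (grid_region l n l l) (grid_edges (grid_region l n l l))"
proof -
  let ?T = "\<lambda>r k. transfers (grid_region l n r k) (grid_edges (grid_region l n r k))"
  have row: "?T r l" if "?T r (n + 1)" "r \<le> n" for r
  proof -
    have "?T r (n + 1 - int m)" if "int m \<le> n + 1 - l" for m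
      using that
    proof (induction m)
      case 0
      then show ?case using \<open>?T r (n + 1)\<close> by simp
    next
      case (Suc m)
      then show ?case using transfers_grid_step[of l n r "n + 1 - int (Suc m)"] \<open>r \<le> n\<close>
        by (simp add: algebra_simps)
    qed
    from this[of "nat (n + 1 - l)"] show ?thesis using assms by simp
  qed
  have "?T (n - int m) l" if "int m \<le> n - l" for m
    using that
  proof (induction m)
    case 0
    have "grid_region l n n (n + 1) = {(n + 1, n)}" using assms by (auto simp: grid_region_def)
    moreover have "grid_edges {(n + 1, n)} = {}" by (auto simp: grid_edges_def)
    ultimately have "?T n (n + 1)" using transfers_singleton by simp
    then show ?case using row by simp
  next
    case (Suc m)
    have "grid_region l n (n - int (Suc m)) (n + 1) = grid_region l n (n - int m) l"
      by (auto simp: grid_region_def)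
    then show ?case using row[of "n - int (Suc m)"] Suc by simp
  qed
  from this[of "nat (n - l)"] show ?thesis using assms by simp
qed

end

text \<open>The sets \<open>B v\<close> are the branch sets of a minor, and \<open>g\<close> picks a
  separate host edge for each edge of the graph, in either direction. Weight \<open>I\<close> inside
  a branch set forces every nonvanishing term to be constant there, weight \<open>J\<close>
  neutralizes the other host edges, and each vertex outside all branch sets is free and contributes
  a factor \<open>CARD('x)\<close>.\<close>

lemma scaffold0_minor:
  fixes w :: "'e \<Rightarrow> ('x::finite) mat" and B :: "'v \<Rightarrow> 'u set" and g :: "'e \<Rightarrow> 'u \<times> 'u"
  assumes fin: "finite V" "finite Ed" "finite U" "finite P"
    and sym: "\<And>e x y. e \<in> Ed \<Longrightarrow> w e x y = w e y x"
    and ends: "\<And>e. e \<in> Ed \<Longrightarrow> fst (ends e) \<in> V \<and> snd (ends e) \<in> V"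
    and B: "\<And>v. v \<in> V \<Longrightarrow> B v \<subseteq> U" "\<And>u v. u \<in> V \<Longrightarrow> v \<in> V \<Longrightarrow> u \<noteq> v \<Longrightarrow> B u \<inter> B v = {}"
    and rep: "\<And>v. v \<in> V \<Longrightarrow> rep v \<in> B v"
    and conn: "\<And>v q. v \<in> V \<Longrightarrow> q \<in> B v \<Longrightarrow>
      (rep v, q) \<in> {(p, q). p \<in> B v \<and> q \<in> B v \<and> ((p, q) \<in> P \<or> (q, p) \<in> P)}\<^sup>*"
    and g: "inj_on g Ed" "\<And>e. e \<in> Ed \<Longrightarrow> g e \<in> P"
      "\<And>e. e \<in> Ed \<Longrightarrow> fst (ends e) \<noteq> snd (ends e)"
      "\<And>e. e \<in> Ed \<Longrightarrow> g e \<in> B (fst (ends e)) \<times> B (snd (ends e)) \<union> B (snd (ends e)) \<times> B (fst (ends e))"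
  shows "scaffold0 U P id (\<lambda>e. if e \<in> g ` Ed then w (inv_into Ed g e)
        else if \<exists>v\<in>V. fst e \<in> B v \<and> snd e \<in> B v then id_mat else (\<lambda>_ _. 1)) =
      of_nat (CARD('x) ^ card (U - (\<Union>v\<in>V. B v))) * scaffold0 V Ed ends w"
proof -
  define W where "W = (\<lambda>e. if e \<in> g ` Ed then w (inv_into Ed g e)
        else if \<exists>v\<in>V. fst e \<in> B v \<and> snd e \<in> B v then id_mat else (\<lambda>_ _. 1))"
  define C where "C = {\<phi> \<in> PiE U (\<lambda>_. UNIV :: 'x set). \<forall>v\<in>V. \<forall>q\<in>B v. \<phi> q = \<phi> (rep v)}"
  let ?T = "\<lambda>\<phi>. \<Prod>e\<in>P. W e (\<phi> (fst e)) (\<phi> (snd e))"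
  have finPi: "finite (PiE U (\<lambda>_. UNIV :: 'x set))" using fin by (intro finite_PiE) auto
  have uniq: "u = v" if "u \<in> V" "v \<in> V" "q \<in> B u" "q \<in> B v" for u v q using B(2)[of u v] that by auto
  \<comment> \<open>No chosen edge \<open>g e\<close> lies inside a branch set, since
    \<open>e\<close> is not a loop and branch sets are disjoint.\<close>
  have Wid: "W (p, q) = id_mat" if "v \<in> V" "p \<in> B v" "q \<in> B v" for p q v
  proof -
    have "(p, q) \<notin> g ` Ed"
    proof
      assume "(p, q) \<in> g ` Ed"
      then obtain e where e: "e \<in> Ed" "g e = (p, q)" by auto
      have "fst (ends e) = snd (ends e)"
        using g(4)[OF e(1)] e ends[OF e(1)] that uniq by (metis Un_iff mem_Times_iff prod.sel)
      then show False using g(3) e by blast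
    qed
    then show ?thesis using that by (auto simp: W_def)
  qed
  have zero: "?T \<phi> = 0" if "\<phi> \<in> PiE U (\<lambda>_. UNIV) - C" for \<phi>
  proof -
    obtain v q where vq: "v \<in> V" "q \<in> B v" "\<phi> q \<noteq> \<phi> (rep v)" using \<open>\<phi> \<in> _\<close> by (auto simp: C_def)
    have "\<exists>p q. p \<in> B v \<and> q \<in> B v \<and> (p, q) \<in> P \<and> \<phi> p \<noteq> \<phi> q"
    proof (rule ccontr)
      assume "\<not> ?thesis"
      then have *: "\<phi> p = \<phi> q" if "p \<in> B v \<and> q \<in> B v \<and> ((p, q) \<in> P \<or> (q, p) \<in> P)" for p q
        using that by metis
      have "\<phi> q = \<phi> (rep v)" using conn[OF vq(1,2)]
        by (induction rule: rtrancl_induct) (use * in force)+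
      then show False using vq by simp
    qed
    then obtain p q where pq: "p \<in> B v" "q \<in> B v" "(p, q) \<in> P" "\<phi> p \<noteq> \<phi> q" by blast
    then have "W (p, q) (\<phi> (fst (p, q))) (\<phi> (snd (p, q))) = 0"
      using Wid[OF vq(1)] by (simp add: id_mat_def)
    then show ?thesis using pq(3) fin(4) by (intro prod_zero) blast+
  qed
  have const: "?T \<phi> = (\<Prod>e\<in>Ed. w e (\<phi> (rep (fst (ends e)))) (\<phi> (rep (snd (ends e)))))" if "\<phi> \<in> C" for \<phi>
  proof -
    have C: "\<phi> q = \<phi> (rep v)" if "v \<in> V" "q \<in> B v" for v q using \<open>\<phi> \<in> C\<close> that by (auto simp: C_def)
    have "?T \<phi> = (\<Prod>e\<in>g ` Ed. W e (\<phi> (fst e)) (\<phi> (snd e)))"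
    proof (rule prod.mono_neutral_right)
      show "\<forall>e\<in>P - g ` Ed. W e (\<phi> (fst e)) (\<phi> (snd e)) = 1"
      proof
        fix e assume e: "e \<in> P - g ` Ed"
        show "W e (\<phi> (fst e)) (\<phi> (snd e)) = 1"
        proof (cases "\<exists>v\<in>V. fst e \<in> B v \<and> snd e \<in> B v")
          case True
          then have "\<phi> (fst e) = \<phi> (snd e)" using C by metis
          then show ?thesis using e True by (simp add: W_def id_mat_def)
        next
          case False
          then show ?thesis using e unfolding W_def by (simp only: if_False Diff_iff)
        qed
      qed
    qed (use fin g(2) in auto)
    also have "\<dots> = (\<Prod>e\<in>Ed. W (g e) (\<phi> (fst (g e))) (\<phi> (snd (g e))))"
      by (subst prod.reindex[OF g(1)]) simp
    also have "\<dots> = (\<Prod>e\<in>Ed. w e (\<phi> (rep (fst (ends e)))) (\<phi> (rep (snd (ends e)))))"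
    proof (rule prod.cong[OF refl])
      fix e assume e: "e \<in> Ed"
      have "W (g e) = w e" using e g(1) by (simp add: W_def)
      moreover have "\<phi> (fst (g e)) = \<phi> (rep (fst (ends e))) \<and> \<phi> (snd (g e)) = \<phi> (rep (snd (ends e))) \<or>
        \<phi> (fst (g e)) = \<phi> (rep (snd (ends e))) \<and> \<phi> (snd (g e)) = \<phi> (rep (fst (ends e)))"
        using g(4)[OF e] ends[OF e] C by (metis Un_iff mem_Times_iff)
      ultimately show "W (g e) (\<phi> (fst (g e))) (\<phi> (snd (g e))) =
          w e (\<phi> (rep (fst (ends e)))) (\<phi> (rep (snd (ends e))))"
        using sym[OF e] by auto
    qed
    finally show ?thesis .
  qed
  define N where "N = card (U - (\<Union>v\<in>V. B v))"
  let ?r = "\<lambda>\<phi>. restrict (\<lambda>v. \<phi> (rep v)) V"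
  let ?S = "\<lambda>\<psi>. \<Prod>e\<in>Ed. w e (\<psi> (fst (ends e))) (\<psi> (snd (ends e)))"
  \<comment> \<open>A map in \<open>C\<close> with prescribed values at the representatives is
    determined on the branch sets and arbitrary elsewhere, so all fibres have the same size.\<close>
  have fibre: "card {\<phi> \<in> C. ?r \<phi> = \<psi>} = CARD('x) ^ N" if \<psi>: "\<psi> \<in> PiE V (\<lambda>_. UNIV)" for \<psi>
  proof -
    let ?F = "\<lambda>q. {x. \<forall>v\<in>V. q \<in> B v \<longrightarrow> x = \<psi> v}"
    have "{\<phi> \<in> C. ?r \<phi> = \<psi>} = PiE U ?F"
    proof (intro equalityI subsetI)
      fix \<phi> assume "\<phi> \<in> {\<phi> \<in> C. ?r \<phi> = \<psi>}"
      then have 1: "\<phi> \<in> C" and 2: "\<psi> = ?r \<phi>" by auto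
      have "\<phi> q = \<psi> v" if "v \<in> V" "q \<in> B v" for v q
        using 1 that unfolding 2 by (simp add: C_def)
      then show "\<phi> \<in> PiE U ?F" using 1 by (simp add: C_def PiE_iff)
    next
      fix \<phi> assume \<phi>: "\<phi> \<in> PiE U ?F"
      have *: "\<phi> q = \<psi> v" if "v \<in> V" "q \<in> B v" for v q
        using \<phi> that B(1)[OF that(1)] by (auto simp: PiE_iff)
      have "?r \<phi> = \<psi>" using * rep \<psi> by (intro ext) (auto simp: restrict_def PiE_iff extensional_def)
      then show "\<phi> \<in> {\<phi> \<in> C. ?r \<phi> = \<psi>}" using \<phi> * rep by (auto simp: C_def PiE_iff)
    qed
    moreover have "card (?F q) = (if q \<in> (\<Union>v\<in>V. B v) then 1 else CARD('x))" if "q \<in> U" for q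
    proof (cases "q \<in> (\<Union>v\<in>V. B v)")
      case True
      then obtain v where v: "v \<in> V" "q \<in> B v" by auto
      then have "?F q = {\<psi> v}" using uniq by auto
      then show ?thesis using True by simp
    next
      case False
      then have "?F q = UNIV" by auto
      then show ?thesis using False by simp
    qed
    ultimately have "card {\<phi> \<in> C. ?r \<phi> = \<psi>} = (\<Prod>q\<in>U. if q \<in> (\<Union>v\<in>V. B v) then 1 else CARD('x))"
      using fin by (simp add: card_PiE)
    also have "\<dots> = (\<Prod>q\<in>U - (\<Union>v\<in>V. B v). CARD('x))"
      using fin by (intro prod.mono_neutral_cong_right) auto
    finally show ?thesis by (simp add: N_def)
  qed
  have "scaffold0 U P id W = (\<Sum>\<phi>\<in>PiE U (\<lambda>_. UNIV). ?T \<phi>)" by (simp add: scaffold0_def)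
  also have "\<dots> = (\<Sum>\<phi>\<in>C. ?T \<phi>)"
    by (rule sum.mono_neutral_right[OF finPi]) (use zero in \<open>auto simp: C_def\<close>)
  also have "\<dots> = (\<Sum>\<phi>\<in>C. ?S (?r \<phi>))"
    by (intro sum.cong refl, subst const, assumption, intro prod.cong refl) (use ends in auto)
  also have "\<dots> = (\<Sum>\<psi>\<in>PiE V (\<lambda>_. UNIV). \<Sum>\<phi>\<in>{\<phi> \<in> C. ?r \<phi> = \<psi>}. ?S (?r \<phi>))"
    by (rule sum.group[symmetric]) (use fin finPi in \<open>auto simp: C_def intro!: finite_PiE\<close>)
  also have "\<dots> = (\<Sum>\<psi>\<in>PiE V (\<lambda>_. UNIV). of_nat (CARD('x) ^ N) * ?S \<psi>)"
  proof (rule sum.cong[OF refl])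
    fix \<psi> assume \<psi>: "\<psi> \<in> PiE V (\<lambda>_. UNIV :: 'x set)"
    have "(\<Sum>\<phi>\<in>{\<phi> \<in> C. ?r \<phi> = \<psi>}. ?S (?r \<phi>)) = (\<Sum>\<phi>\<in>{\<phi> \<in> C. ?r \<phi> = \<psi>}. ?S \<psi>)"
      by (rule sum.cong) auto
    then show "(\<Sum>\<phi>\<in>{\<phi> \<in> C. ?r \<phi> = \<psi>}. ?S (?r \<phi>)) = of_nat (CARD('x) ^ N) * ?S \<psi>"
      using fibre[OF \<psi>] by simp
  qed
  finally show ?thesis
    unfolding W_def N_def scaffold0_def by (simp add: sum_distrib_left)
qed

section \<open>Planar graphs as grid minors\<close>

definition grid_adjacent :: "int \<times> int \<Rightarrow> int \<times> int \<Rightarrow> bool" where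
  "grid_adjacent p q \<longleftrightarrow> (p, q) \<in> grid_edges UNIV \<or> (q, p) \<in> grid_edges UNIV"

definition linked :: "(int \<times> int) set \<Rightarrow> ((int \<times> int) \<times> int \<times> int) set" where
  "linked S = {(p, q). p \<in> S \<and> q \<in> S \<and> grid_adjacent p q}"

text \<open>Balls in the Chebyshev distance, hence squares.\<close>

definition grid_close :: "int \<Rightarrow> int \<times> int \<Rightarrow> int \<times> int \<Rightarrow> bool" where
  "grid_close k p q \<longleftrightarrow> \<bar>fst p - fst q\<bar> \<le> k \<and> \<bar>snd p - snd q\<bar> \<le> k"

lemma grid_close_sym: "grid_close k p q \<longleftrightarrow> grid_close k q p"
  by (auto simp: grid_close_def)

lemma grid_close_trans: "grid_close k p q \<Longrightarrow> grid_close m q r \<Longrightarrow> grid_close (k + m) p r"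
  by (auto simp: grid_close_def)

lemma grid_adjacent_close: "grid_adjacent p q \<Longrightarrow> grid_close 1 p q"
  by (auto simp: grid_adjacent_def grid_edges_def grid_close_def)

lemma linked_rtrancl_mono: "S \<subseteq> T \<Longrightarrow> (p, q) \<in> (linked S)\<^sup>* \<Longrightarrow> (p, q) \<in> (linked T)\<^sup>*"
  by (rule rtrancl_mono[THEN subsetD, rotated]) (auto simp: linked_def)

lemma linked_rtrancl_sym: "(p, q) \<in> (linked S)\<^sup>* \<Longrightarrow> (q, p) \<in> (linked S)\<^sup>*"
  by (rule symD[OF sym_rtrancl]) (auto simp: linked_def grid_adjacent_def sym_def)

lemma linked_square:
  "grid_close L (i, j) (i', j') \<Longrightarrow> ((i, j), (i', j')) \<in> (linked {q. grid_close L (i, j) q})\<^sup>*"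
proof (induction "nat (\<bar>i' - i\<bar> + \<bar>j' - j\<bar>)" arbitrary: i' j' rule: less_induct)
  case less
  let ?S = "{q. grid_close L (i, j) q}"
  have step: "((i, j), (i', j')) \<in> (linked ?S)\<^sup>*"
    if "nat (\<bar>i2 - i\<bar> + \<bar>j2 - j\<bar>) < nat (\<bar>i' - i\<bar> + \<bar>j' - j\<bar>)" "grid_close L (i, j) (i2, j2)"
      "grid_adjacent (i2, j2) (i', j')" for i2 j2
    using less.hyps[OF that(1,2)] that less.prems
    by (auto simp: linked_def intro: rtrancl_into_rtrancl)
  consider "i' > i" | "i' < i" | "j' > j" | "j' < j" | "i' = i" "j' = j" by linarith
  then show ?case
  proof cases
    case 1
    then show ?thesis using less.prems
      by (intro step[of "i' - 1" j']) (auto simp: grid_close_def grid_adjacent_def grid_edges_def)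
  next
    case 2
    then show ?thesis using less.prems
      by (intro step[of "i' + 1" j']) (auto simp: grid_close_def grid_adjacent_def grid_edges_def)
  next
    case 3
    then show ?thesis using less.prems
      by (intro step[of i' "j' - 1"]) (auto simp: grid_close_def grid_adjacent_def grid_edges_def)
  next
    case 4
    then show ?thesis using less.prems
      by (intro step[of i' "j' + 1"]) (auto simp: grid_close_def grid_adjacent_def grid_edges_def)
  qed simp
qed

lemma linked_close:
  assumes "grid_close 1 p q" "{r. grid_close 1 p r} \<subseteq> S"
  shows "(p, q) \<in> (linked S)\<^sup>*"
  using linked_rtrancl_mono[OF assms(2) linked_square[of 1 "fst p" "snd p" "fst q" "snd q", simplified, OF assms(1)]] .

text \<open>\<open>Q\<close> collects the points outside \<open>A\<close> seen before the path first
  meets \<open>B\<close>. Each is linked to \<open>A\<close> inside \<open>Q \<union> A\<close>: a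
  return of the path to \<open>A\<close> merely gives a new starting point. So \<open>Q\<close> can
  be joined to a branch set built on \<open>A\<close>, and the step from \<open>q\<close> to
  \<open>b\<close> realizes the edge.\<close>

lemma linked_first_crossing:
  assumes path: "(x, y) \<in> (linked W)\<^sup>*" and xy: "x \<in> A" "y \<in> B" and AB: "A \<inter> B = {}"
  shows "\<exists>Q q b. Q \<subseteq> W - A - B \<and> q \<in> Q \<union> A \<and> b \<in> B \<and> grid_adjacent q b \<and>
    (\<forall>z\<in>Q. \<exists>a\<in>A. (a, z) \<in> (linked (Q \<union> A))\<^sup>*)"
    (is "\<exists>Q q b. ?P Q q b")
proof -
  have "(\<exists>Q q b. ?P Q q b) \<or>
    (\<exists>Q. Q \<subseteq> W - A - B \<and> y \<in> Q \<union> A \<and> (\<forall>z\<in>Q. \<exists>a\<in>A. (a, z) \<in> (linked (Q \<union> A))\<^sup>*))"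
    using path
  proof (induction rule: rtrancl_induct)
    case base
    then show ?case using xy by (intro disjI2 exI[of _ "{}"]) auto
  next
    case (step y z)
    have yz: "grid_adjacent y z" "z \<in> W" using step.hyps by (auto simp: linked_def)
    from step.IH show ?case
    proof
      assume "\<exists>Q. Q \<subseteq> W - A - B \<and> y \<in> Q \<union> A \<and> (\<forall>z\<in>Q. \<exists>a\<in>A. (a, z) \<in> (linked (Q \<union> A))\<^sup>*)"
      then obtain Q where Q: "Q \<subseteq> W - A - B" "y \<in> Q \<union> A"
        and conn: "\<And>z. z \<in> Q \<Longrightarrow> \<exists>a\<in>A. (a, z) \<in> (linked (Q \<union> A))\<^sup>*" by blast
      consider "z \<in> A" | "z \<in> B" | "z \<notin> A" "z \<notin> B" by blast
      then show ?case
      proof cases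
        case 1
        then show ?thesis using Q conn by blast
      next
        case 2
        then have "?P Q y z" using Q conn yz by blast
        then show ?thesis by blast
      next
        case 3
        obtain a where a: "a \<in> A" "(a, y) \<in> (linked (Q \<union> A))\<^sup>*" using Q(2) conn by blast
        have mono: "(p, q) \<in> (linked (Q \<union> A))\<^sup>* \<Longrightarrow> (p, q) \<in> (linked (insert z Q \<union> A))\<^sup>*" for p q
          by (rule linked_rtrancl_mono[rotated]) auto
        have "(y, z) \<in> linked (insert z Q \<union> A)" using Q yz by (auto simp: linked_def)
        then have "(a, z) \<in> (linked (insert z Q \<union> A))\<^sup>*" using mono[OF a(2)] by (rule rtrancl_into_rtrancl[rotated])
        then have "\<forall>q\<in>insert z Q. \<exists>a\<in>A. (a, q) \<in> (linked (insert z Q \<union> A))\<^sup>*"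
          using a(1) conn mono by blast
        moreover have "insert z Q \<subseteq> W - A - B" using Q yz 3 by blast
        ultimately show ?thesis by blast
      qed
    qed blast
  qed
  then show ?thesis using xy AB by blast
qed

text \<open>\<open>S v\<close> is a patch around the vertex \<open>v\<close> and \<open>W e\<close>
  a tube along the edge \<open>e\<close>. The part of the tube before the patch of the second end is
  given to the branch set of the first end, and the step into that patch becomes \<open>g e\<close>.
  A tube may run in and out of the patches of its own ends, hence the appeal to a first
  crossing.\<close>

lemma grid_model_of_separated:
  fixes S :: "'v \<Rightarrow> (int \<times> int) set" and W :: "'e \<Rightarrow> (int \<times> int) set"
  assumes ends: "\<And>e. e \<in> Ed \<Longrightarrow> fst (ends e) \<in> V \<and> snd (ends e) \<in> V \<and> fst (ends e) \<noteq> snd (ends e)"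
    and rep: "\<And>v. v \<in> V \<Longrightarrow> rep v \<in> S v"
    and S_linked: "\<And>v q. v \<in> V \<Longrightarrow> q \<in> S v \<Longrightarrow> (rep v, q) \<in> (linked (S v))\<^sup>*"
    and S_disj: "\<And>u v. u \<in> V \<Longrightarrow> v \<in> V \<Longrightarrow> u \<noteq> v \<Longrightarrow> S u \<inter> S v = {}"
    and S_apart: "\<And>u v p q. u \<in> V \<Longrightarrow> v \<in> V \<Longrightarrow> u \<noteq> v \<Longrightarrow> p \<in> S u \<Longrightarrow> q \<in> S v \<Longrightarrow> \<not> grid_adjacent p q"
    and W_path: "\<And>e. e \<in> Ed \<Longrightarrow> \<exists>x\<in>S (fst (ends e)). \<exists>y\<in>S (snd (ends e)). (x, y) \<in> (linked (W e))\<^sup>*"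
    and W_S: "\<And>e v. e \<in> Ed \<Longrightarrow> v \<in> V \<Longrightarrow> v \<noteq> fst (ends e) \<Longrightarrow> v \<noteq> snd (ends e) \<Longrightarrow> W e \<inter> S v = {}"
    and W_disj: "\<And>e f. e \<in> Ed \<Longrightarrow> f \<in> Ed \<Longrightarrow> e \<noteq> f \<Longrightarrow> W e \<inter> W f = {}"
  shows "\<exists>B g. (\<forall>v\<in>V. rep v \<in> B v \<and> B v \<subseteq> S v \<union> (\<Union>e\<in>Ed. W e) \<and> (\<forall>q\<in>B v. (rep v, q) \<in> (linked (B v))\<^sup>*)) \<and>
    (\<forall>u\<in>V. \<forall>v\<in>V. u \<noteq> v \<longrightarrow> B u \<inter> B v = {}) \<and> inj_on g Ed \<and>
    (\<forall>e\<in>Ed. g e \<in> grid_edges UNIV \<and>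
      g e \<in> B (fst (ends e)) \<times> B (snd (ends e)) \<union> B (snd (ends e)) \<times> B (fst (ends e)))"
proof -
  let ?a = "\<lambda>e. fst (ends e)" and ?b = "\<lambda>e. snd (ends e)"
  have "\<forall>e\<in>Ed. \<exists>Q q b. Q \<subseteq> W e - S (?a e) - S (?b e) \<and> q \<in> Q \<union> S (?a e) \<and> b \<in> S (?b e) \<and> grid_adjacent q b \<and>
    (\<forall>z\<in>Q. \<exists>a\<in>S (?a e). (a, z) \<in> (linked (Q \<union> S (?a e)))\<^sup>*)"
  proof
    fix e assume e: "e \<in> Ed"
    obtain x y where xy: "x \<in> S (?a e)" "y \<in> S (?b e)" "(x, y) \<in> (linked (W e))\<^sup>*" using W_path[OF e] by blast
    show "\<exists>Q q b. Q \<subseteq> W e - S (?a e) - S (?b e) \<and> q \<in> Q \<union> S (?a e) \<and> b \<in> S (?b e) \<and> grid_adjacent q b \<and>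
      (\<forall>z\<in>Q. \<exists>a\<in>S (?a e). (a, z) \<in> (linked (Q \<union> S (?a e)))\<^sup>*)"
      using linked_first_crossing[OF xy(3,1,2)] S_disj ends[OF e] by blast
  qed
  then obtain Q q b where
    Q: "\<And>e. e \<in> Ed \<Longrightarrow> Q e \<subseteq> W e - S (?a e) - S (?b e)" and
    q: "\<And>e. e \<in> Ed \<Longrightarrow> q e \<in> Q e \<union> S (?a e)" and b: "\<And>e. e \<in> Ed \<Longrightarrow> b e \<in> S (?b e)" and
    adj: "\<And>e. e \<in> Ed \<Longrightarrow> grid_adjacent (q e) (b e)" and
    Q_linked: "\<And>e z. e \<in> Ed \<Longrightarrow> z \<in> Q e \<Longrightarrow> \<exists>a\<in>S (?a e). (a, z) \<in> (linked (Q e \<union> S (?a e)))\<^sup>*"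
    unfolding bchoice_iff by metis
  \<comment> \<open>Patches are not adjacent, so the chosen edge starts in the tube and not in the
    patch of the first end. As tubes are disjoint, this makes \<open>g\<close> injective, also on
    parallel edges.\<close>
  have qQ: "q e \<in> Q e" if "e \<in> Ed" for e
    using q[OF that] S_apart b[OF that] adj[OF that] ends[OF that] by blast
  have QS: "Q e \<inter> S v = {}" if "e \<in> Ed" "v \<in> V" for e v
    using Q[OF that(1)] W_S[OF that] by blast
  have QQ: "Q e \<inter> Q f = {}" if "e \<in> Ed" "f \<in> Ed" "e \<noteq> f" for e f
    using Q[OF that(1)] Q[OF that(2)] W_disj[OF that] by blast
  define B where "B = (\<lambda>v. S v \<union> (\<Union>e\<in>{e \<in> Ed. ?a e = v}. Q e))"
  \<comment> \<open>The set \<open>grid_edges\<close> contains each edge in one direction only, and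
    \<open>g\<close> follows that direction.\<close>
  define g where "g = (\<lambda>e. if (q e, b e) \<in> grid_edges UNIV then (q e, b e) else (b e, q e))"
  have qB: "q e \<in> B (?a e)" "b e \<in> B (?b e)" if "e \<in> Ed" for e
    using qQ[OF that] b[OF that] that by (auto simp: B_def)
  have SB: "S v \<subseteq> B v" for v by (auto simp: B_def)
  have B_linked: "(rep v, z) \<in> (linked (B v))\<^sup>*" if v: "v \<in> V" "z \<in> B v" for v z
  proof (cases "z \<in> S v")
    case True
    then show ?thesis using S_linked[OF v(1)] linked_rtrancl_mono[OF SB] by blast
  next
    case False
    then obtain e where e: "e \<in> Ed" "?a e = v" "z \<in> Q e" using v by (auto simp: B_def)
    obtain a where a: "a \<in> S v" "(a, z) \<in> (linked (Q e \<union> S v))\<^sup>*" using Q_linked[OF e(1,3)] e(2) by blast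
    have "Q e \<union> S v \<subseteq> B v" using e by (auto simp: B_def)
    then have "(a, z) \<in> (linked (B v))\<^sup>*" using a linked_rtrancl_mono by blast
    moreover have "(rep v, a) \<in> (linked (B v))\<^sup>*" using S_linked[OF v(1) a(1)] linked_rtrancl_mono[OF SB] by blast
    ultimately show ?thesis by simp
  qed
  have disjB: "B u \<inter> B v = {}" if "u \<in> V" "v \<in> V" "u \<noteq> v" for u v
    using S_disj[OF that] QS QQ that unfolding B_def by blast
  have injg: "inj_on g Ed"
  proof (rule inj_onI, rule ccontr)
    fix e f assume *: "e \<in> Ed" "f \<in> Ed" "g e = g f" "e \<noteq> f"
    then have "q e = q f \<or> q e = b f" by (auto simp: g_def split: if_splits)
    then show False using QQ[OF *(1,2,4)] qQ[OF *(1)] qQ[OF *(2)] QS[OF *(1), of "?b f"] b[OF *(2)] ends[OF *(2)] by auto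
  qed
  have gE: "g e \<in> grid_edges UNIV \<and> g e \<in> B (?a e) \<times> B (?b e) \<union> B (?b e) \<times> B (?a e)" if "e \<in> Ed" for e
    using qB[OF that] adj[OF that] by (auto simp: g_def grid_adjacent_def)
  have subB: "B v \<subseteq> S v \<union> (\<Union>e\<in>Ed. W e)" for v using Q unfolding B_def by blast
  have repB: "rep v \<in> B v" if "v \<in> V" for v using rep[OF that] SB by blast
  show ?thesis
    using gE by (intro exI[of _ B] exI[of _ g] conjI ballI impI injg) (simp_all add: B_linked disjB subB repB)
qed

section \<open>Rounding points and curves of the plane to the grid\<close>

definition grid_point :: "real \<Rightarrow> real^2 \<Rightarrow> int \<times> int" where
  "grid_point N z = (\<lfloor>N * z $ 1\<rfloor>, \<lfloor>N * z $ 2\<rfloor>)"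

lemma grid_point_close:
  assumes "N > 0" "N * dist z z' < of_int k"
  shows "grid_close k (grid_point N z) (grid_point N z')"
proof -
  have "\<bar>N * z $ i - N * z' $ i\<bar> < of_int k" for i
  proof -
    have "\<bar>N * z $ i - N * z' $ i\<bar> = N * \<bar>(z - z') $ i\<bar>"
      using assms(1) by (simp add: abs_mult flip: right_diff_distrib)
    also have "\<dots> \<le> N * dist z z'"
      using assms(1) component_le_norm_cart[of "z - z'" i] by (simp add: dist_norm)
    finally show ?thesis using assms(2) by linarith
  qed
  note this[of 1] this[of 2]
  then show ?thesis unfolding grid_close_def grid_point_def fst_conv snd_conv by linarith
qed

text \<open>Rounding costs at most 1 in each coordinate, and the Euclidean distance is at most the
  sum of the coordinate differences: hence \<open>k + 1\<close> and the factor 2.\<close>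

lemma dist_le_of_grid_close:
  assumes "N > 0" "grid_close k (grid_point N z) (grid_point N z')"
  shows "dist z z' \<le> 2 * (of_int k + 1) / N"
proof -
  have "\<bar>N * z $ 1 - N * z' $ 1\<bar> \<le> of_int k + 1" "\<bar>N * z $ 2 - N * z' $ 2\<bar> \<le> of_int k + 1"
    using assms(2) unfolding grid_close_def grid_point_def fst_conv snd_conv by linarith+
  then have "N * \<bar>(z - z') $ 1\<bar> \<le> of_int k + 1" "N * \<bar>(z - z') $ 2\<bar> \<le> of_int k + 1"
    using assms(1) by (simp_all add: abs_mult flip: right_diff_distrib)
  moreover have "norm (z - z') \<le> \<bar>(z - z') $ 1\<bar> + \<bar>(z - z') $ 2\<bar>"
    using norm_le_l1_cart[of "z - z'"] by (simp add: sum_2)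
  ultimately have "N * dist z z' \<le> 2 * (of_int k + 1)"
    using assms(1) mult_left_mono[of "norm (z - z')" _ N] by (fastforce simp: dist_norm distrib_left)
  then show ?thesis using assms(1) by (simp add: field_simps)
qed

text \<open>Parameters whose points are less than \<open>1 / (2 * N)\<close> apart have rounded
  points at Chebyshev distance at most 1. Being linked is thus an equivalence relation with open
  classes on the interval, which is connected.\<close>

lemma linked_grid_point_path:
  fixes s t :: real
  assumes N: "N > 0" and cont: "continuous_on {s..t} \<gamma>" and st: "s \<le> t"
  shows "(grid_point N (\<gamma> s), grid_point N (\<gamma> t)) \<in>
    (linked {q. \<exists>x\<in>{s..t}. grid_close 1 (grid_point N (\<gamma> x)) q})\<^sup>*"
    (is "_ \<in> (linked ?W)\<^sup>*")
proof (rule connected_equivalence_relation[of "{s..t}" s t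
    "\<lambda>x y. (grid_point N (\<gamma> x), grid_point N (\<gamma> y)) \<in> (linked ?W)\<^sup>*"])
  fix x assume x: "x \<in> {s..t}"
  let ?T = "{y \<in> {s..t}. dist (\<gamma> x) (\<gamma> y) < 1 / (2 * N)}"
  have "openin (top_of_set {s..t}) ({s..t} \<inter> \<gamma> -` ball (\<gamma> x) (1 / (2 * N)))"
    by (rule continuous_openin_preimage_gen[OF cont]) simp
  moreover have "{s..t} \<inter> \<gamma> -` ball (\<gamma> x) (1 / (2 * N)) = ?T" by auto
  moreover have "(grid_point N (\<gamma> x), grid_point N (\<gamma> y)) \<in> (linked ?W)\<^sup>*" if "y \<in> ?T" for y
  proof (rule linked_close)
    show "grid_close 1 (grid_point N (\<gamma> x)) (grid_point N (\<gamma> y))"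
      using that N by (intro grid_point_close) (auto simp: field_simps)
  qed (use x in auto)
  ultimately show "\<exists>T. openin (top_of_set {s..t}) T \<and> x \<in> T \<and>
      (\<forall>y\<in>T. (grid_point N (\<gamma> x), grid_point N (\<gamma> y)) \<in> (linked ?W)\<^sup>*)"
    using x N by (intro exI[of _ ?T]) simp
qed (use st in \<open>simp_all add: linked_rtrancl_sym\<close>)

lemma finite_family_separated:
  fixes S T :: "'i \<Rightarrow> 'a::heine_borel set"
  assumes "finite I" "\<And>i. i \<in> I \<Longrightarrow> compact (S i) \<and> closed (T i) \<and> S i \<inter> T i = {}"
  shows "\<exists>\<delta>>0. \<forall>i\<in>I. \<forall>x\<in>S i. \<forall>y\<in>T i. \<delta> \<le> dist x y"
  using assms
proof (induction rule: finite_induct)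
  case empty
  show ?case by (auto intro: exI[of _ 1])
next
  case (insert i I)
  obtain \<delta>1 where 1: "\<delta>1 > 0" "\<forall>i\<in>I. \<forall>x\<in>S i. \<forall>y\<in>T i. \<delta>1 \<le> dist x y" using insert by auto
  obtain \<delta>2 where 2: "\<delta>2 > 0" "\<forall>x\<in>S i. \<forall>y\<in>T i. \<delta>2 \<le> dist x y"
    using separate_compact_closed[of "S i" "T i"] insert.prems by auto
  show ?case using 1 2 by (intro exI[of _ "min \<delta>1 \<delta>2"]) (auto simp: min_le_iff_disj)
qed

text \<open>Arcs at a common vertex have distance 0, so each arc is cut off near its ends. The patch
  \<open>S v\<close> is a square large enough to contain the cut points at \<open>v\<close>, and the
  tube \<open>W e\<close> consists of the grid points close to the remaining arc. The choices are
  made in this order: the patch radius \<open>\<rho>\<close>, the cuts \<open>s\<close> and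
  \<open>t\<close>, the distance \<open>\<delta>3\<close> between the cut arcs, and last the grid
  scale \<open>N\<close>.\<close>

lemma planar_grid_model:
  fixes p :: "'v \<Rightarrow> real^2" and c :: "'e \<Rightarrow> real \<Rightarrow> real^2"
  assumes emb: "planar_embedding V Ed ends p c" and fin: "finite V" "finite Ed"
    and ends: "\<And>e. e \<in> Ed \<Longrightarrow> fst (ends e) \<in> V \<and> snd (ends e) \<in> V \<and> fst (ends e) \<noteq> snd (ends e)"
  shows "\<exists>m rep B g. (\<forall>v\<in>V. rep v \<in> B v \<and> B v \<subseteq> {-m..m} \<times> {-m..m} \<and> (\<forall>q\<in>B v. (rep v, q) \<in> (linked (B v))\<^sup>*)) \<and>
    (\<forall>u\<in>V. \<forall>v\<in>V. u \<noteq> v \<longrightarrow> B u \<inter> B v = {}) \<and> inj_on g Ed \<and>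
    (\<forall>e\<in>Ed. g e \<in> grid_edges UNIV \<and>
      g e \<in> B (fst (ends e)) \<times> B (snd (ends e)) \<union> B (snd (ends e)) \<times> B (fst (ends e)))"
proof -
  let ?a = "\<lambda>e. fst (ends e)" and ?b = "\<lambda>e. snd (ends e)"
  have inj: "inj_on p V" using emb by (simp add: planar_embedding_def)
  have edge: "c e 0 = p (?a e)" "c e 1 = p (?b e)" "arc (c e)"
      "path_image (c e) \<inter> p ` V \<subseteq> {p (?a e), p (?b e)}" if "e \<in> Ed" for e
    using emb that ends[OF that]
    unfolding planar_embedding_def pathstart_def pathfinish_def case_prod_unfold by metis+
  have cross: "path_image (c e) \<inter> path_image (c f) \<subseteq> p ` V" if "e \<in> Ed" "f \<in> Ed" "e \<noteq> f" for e f
    using emb that by (auto simp: planar_embedding_def)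
  have cont: "continuous_on {0..1} (c e)" and injc: "inj_on (c e) {0..1}" if "e \<in> Ed" for e
    using edge(3)[OF that] by (auto simp: arc_def path_def)
  have interior: "c e x \<notin> p ` V" if "e \<in> Ed" "0 < x" "x < 1" for e x
  proof
    assume "c e x \<in> p ` V"
    moreover have "c e x \<in> path_image (c e)" using that by (auto simp: path_image_def)
    ultimately have "c e x \<in> {p (?a e), p (?b e)}" using edge(4)[OF that(1)] by blast
    then have "c e x = c e 0 \<or> c e x = c e 1" using edge(1,2)[OF that(1)] by simp
    then show False using inj_onD[OF injc[OF that(1)], of x 0] inj_onD[OF injc[OF that(1)], of x 1] that by auto
  qed

  have "\<exists>\<delta>>0. \<forall>i\<in>{(u, v) \<in> V \<times> V. u \<noteq> v}. \<forall>x\<in>{p (fst i)}. \<forall>y\<in>{p (snd i)}. \<delta> \<le> dist x y"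
    using fin inj by (intro finite_family_separated) (auto simp: inj_on_def intro: finite_subset[of _ "V \<times> V"])
  then obtain \<delta>1 where \<delta>1: "\<delta>1 > 0" "\<And>u v. u \<in> V \<Longrightarrow> v \<in> V \<Longrightarrow> u \<noteq> v \<Longrightarrow> \<delta>1 \<le> dist (p u) (p v)"
    by auto
  have "\<exists>\<delta>>0. \<forall>i\<in>{(e, v) \<in> Ed \<times> V. v \<noteq> ?a e \<and> v \<noteq> ?b e}. \<forall>x\<in>path_image (c (fst i)). \<forall>y\<in>{p (snd i)}. \<delta> \<le> dist x y"
  proof (rule finite_family_separated)
    show "finite {(e, v) \<in> Ed \<times> V. v \<noteq> ?a e \<and> v \<noteq> ?b e}"
      using fin by (auto intro: finite_subset[of _ "Ed \<times> V"])
    fix i assume i: "i \<in> {(e, v) \<in> Ed \<times> V. v \<noteq> ?a e \<and> v \<noteq> ?b e}"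
    then obtain e v where ev: "i = (e, v)" "e \<in> Ed" "v \<in> V" "v \<noteq> ?a e" "v \<noteq> ?b e" by auto
    have "p v \<notin> path_image (c e)"
      using edge(4)[OF ev(2)] ev ends[OF ev(2)] inj by (auto simp: inj_on_def)
    then show "compact (path_image (c (fst i))) \<and> closed {p (snd i)} \<and> path_image (c (fst i)) \<inter> {p (snd i)} = {}"
      using edge(3)[OF ev(2)] ev by (auto intro: compact_path_image arc_imp_path)
  qed
  then obtain \<delta>2 where \<delta>2: "\<delta>2 > 0"
    "\<And>e v z. e \<in> Ed \<Longrightarrow> v \<in> V \<Longrightarrow> v \<noteq> ?a e \<Longrightarrow> v \<noteq> ?b e \<Longrightarrow> z \<in> path_image (c e) \<Longrightarrow> \<delta>2 \<le> dist z (p v)"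
    by auto
  \<comment> \<open>One tenth leaves room for two patches, the rounding errors and the factor 2 in
    \<open>dist_le_of_grid_close\<close>.\<close>
  define \<rho> where "\<rho> = min \<delta>1 \<delta>2 / 10"
  have \<rho>: "\<rho> > 0" "10 * \<rho> \<le> \<delta>1" "10 * \<rho> \<le> \<delta>2" using \<delta>1(1) \<delta>2(1) by (auto simp: \<rho>_def)

  \<comment> \<open>Cutting close to the ends keeps the cut points inside the patches; cutting at
    interior parameters keeps the remaining arc off the vertex points, the only places where two
    arcs can meet.\<close>
  have "\<forall>e\<in>Ed. \<exists>s t. 0 < s \<and> s < t \<and> t < 1 \<and> dist (c e s) (p (?a e)) < \<rho> / 2 \<and> dist (c e t) (p (?b e)) < \<rho> / 2"
  proof
    fix e assume e: "e \<in> Ed"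
    obtain d0 where d0: "d0 > 0" "\<And>x. x \<in> {0..1} \<Longrightarrow> dist x 0 < d0 \<Longrightarrow> dist (c e x) (c e 0) < \<rho> / 2"
      using cont[OF e] \<rho>(1) unfolding continuous_on_iff by (metis atLeastAtMost_iff half_gt_zero order_refl zero_le_one)
    obtain d1 where d1: "d1 > 0" "\<And>x. x \<in> {0..1} \<Longrightarrow> dist x 1 < d1 \<Longrightarrow> dist (c e x) (c e 1) < \<rho> / 2"
      using cont[OF e] \<rho>(1) unfolding continuous_on_iff by (metis atLeastAtMost_iff half_gt_zero order_refl zero_le_one)
    define s where "s = min (d0 / 2) (1 / 3)"
    define t where "t = max (1 - d1 / 2) (2 / 3)"
    have "0 < s" "s < t" "t < 1" "dist s 0 < d0" "dist t 1 < d1"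
      using d0(1) d1(1) by (auto simp: s_def t_def dist_real_def min_def max_def)
    moreover from this have "dist (c e s) (p (?a e)) < \<rho> / 2" "dist (c e t) (p (?b e)) < \<rho> / 2"
      using d0(2)[of s] d1(2)[of t] edge(1,2)[OF e] by auto
    ultimately show "\<exists>s t. 0 < s \<and> s < t \<and> t < 1 \<and> dist (c e s) (p (?a e)) < \<rho> / 2 \<and> dist (c e t) (p (?b e)) < \<rho> / 2"
      by blast
  qed
  then obtain s t where st: "\<And>e. e \<in> Ed \<Longrightarrow> 0 < s e \<and> s e < t e \<and> t e < 1"
    and st_near: "\<And>e. e \<in> Ed \<Longrightarrow> dist (c e (s e)) (p (?a e)) < \<rho> / 2 \<and> dist (c e (t e)) (p (?b e)) < \<rho> / 2"
    unfolding bchoice_iff by metis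
  have on_path: "c e x \<in> path_image (c e)" if "e \<in> Ed" "x \<in> {s e..t e}" for e x
    using that st[OF that(1)] by (auto simp: path_image_def)
  have cont': "continuous_on {s e..t e} (c e)" if "e \<in> Ed" for e
    using cont[OF that] st[OF that] by (auto elim: continuous_on_subset)

  have "\<exists>\<delta>>0. \<forall>i\<in>{(e, f) \<in> Ed \<times> Ed. e \<noteq> f}. \<forall>x\<in>c (fst i) ` {s (fst i)..t (fst i)}. \<forall>y\<in>c (snd i) ` {s (snd i)..t (snd i)}. \<delta> \<le> dist x y"
  proof (rule finite_family_separated)
    show "finite {(e, f) \<in> Ed \<times> Ed. e \<noteq> f}" using fin by (auto intro: finite_subset[of _ "Ed \<times> Ed"])
    fix i assume "i \<in> {(e, f) \<in> Ed \<times> Ed. e \<noteq> f}"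
    then obtain e f where ef: "i = (e, f)" "e \<in> Ed" "f \<in> Ed" "e \<noteq> f" by auto
    have "compact (c e ` {s e..t e})" "compact (c f ` {s f..t f})"
      using cont' ef by (auto intro: compact_continuous_image)
    moreover have "c e ` {s e..t e} \<inter> c f ` {s f..t f} = {}"
    proof (rule ccontr)
      assume "c e ` {s e..t e} \<inter> c f ` {s f..t f} \<noteq> {}"
      then obtain x y where xy: "x \<in> {s e..t e}" "y \<in> {s f..t f}" "c e x = c f y" by blast
      then have "c e x \<in> path_image (c e) \<inter> path_image (c f)"
        using on_path[OF ef(2) xy(1)] on_path[OF ef(3) xy(2)] by simp
      then have "c e x \<in> p ` V" using cross[OF ef(2-4)] by blast
      then show False using interior[OF ef(2), of x] st[OF ef(2)] xy by auto
    qed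
    ultimately show "compact (c (fst i) ` {s (fst i)..t (fst i)}) \<and> closed (c (snd i) ` {s (snd i)..t (snd i)}) \<and>
        c (fst i) ` {s (fst i)..t (fst i)} \<inter> c (snd i) ` {s (snd i)..t (snd i)} = {}"
      using ef by (auto intro: compact_imp_closed)
  qed
  then obtain \<delta>3 where \<delta>3: "\<delta>3 > 0" "\<And>e f x y. e \<in> Ed \<Longrightarrow> f \<in> Ed \<Longrightarrow> e \<noteq> f \<Longrightarrow>
      x \<in> {s e..t e} \<Longrightarrow> y \<in> {s f..t f} \<Longrightarrow> \<delta>3 \<le> dist (c e x) (c f y)"
    by fastforce

  \<comment> \<open>Makes both \<open>N * \<rho>\<close> and \<open>N * \<delta>3\<close> at least
    10, so that rounding errors are small against the patch radius \<open>R\<close> and the distance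
    between the cut arcs.\<close>
  define N where "N = 10 / min \<rho> \<delta>3"
  define R where "R = N * \<rho>"
  have N: "N > 0" "R \<ge> 10" "N * \<delta>3 \<ge> 10"
    using \<rho>(1) \<delta>3(1) by (auto simp: N_def R_def min_def field_simps)
  define L where "L = \<lfloor>R\<rfloor>"
  have L: "of_int L \<le> R" "R < of_int L + 1" by (auto simp: L_def)
  define rep where "rep = (\<lambda>v. grid_point N (p v))"
  define S where "S = (\<lambda>v. {q. grid_close L (rep v) q})"
  define W where "W = (\<lambda>e. {q. \<exists>x\<in>{s e..t e}. grid_close 1 (grid_point N (c e x)) q})"
  have far: "\<not> grid_close k (grid_point N z) (grid_point N z')" if "2 * (of_int k + 1) < N * dist z z'" for k z z'
    using dist_le_of_grid_close[OF N(1), of k z z'] that N(1) by (auto simp: field_simps)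
  \<comment> \<open>Distance \<open>2 * L + 1\<close> excludes adjacent points in different patches,
    and with them a common point.\<close>
  have far_vertices: "\<not> grid_close (2 * L + 1) (rep u) (rep v)" if "u \<in> V" "v \<in> V" "u \<noteq> v" for u v
  proof -
    have "10 * R \<le> N * dist (p u) (p v)"
      using \<delta>1(2)[OF that] \<rho>(2) N(1) mult_left_mono[of "10 * \<rho>" "dist (p u) (p v)" N] by (simp add: R_def)
    then have "2 * (of_int (2 * L + 1) + 1) < N * dist (p u) (p v)" using L N by simp
    then show ?thesis unfolding rep_def by (rule far)
  qed
  have far_edge: "\<not> grid_close (L + 1) (grid_point N (c e x)) (rep v)"
    if "e \<in> Ed" "v \<in> V" "v \<noteq> ?a e" "v \<noteq> ?b e" "x \<in> {s e..t e}" for e v x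
  proof -
    have "10 * R \<le> N * dist (c e x) (p v)"
      using mult_left_mono[of "10 * \<rho>" "dist (c e x) (p v)" N] \<delta>2(2)[OF that(1-4) on_path[OF that(1,5)]] \<rho>(3) N(1) by (simp add: R_def)
    then have "2 * (of_int (L + 1) + 1) < N * dist (c e x) (p v)" using L N by simp
    then show ?thesis unfolding rep_def by (rule far)
  qed
  have far_edges: "\<not> grid_close 2 (grid_point N (c e x)) (grid_point N (c f y))"
    if "e \<in> Ed" "f \<in> Ed" "e \<noteq> f" "x \<in> {s e..t e}" "y \<in> {s f..t f}" for e f x y
  proof -
    have "N * \<delta>3 \<le> N * dist (c e x) (c f y)"
      using \<delta>3(2)[OF that] N(1) by (intro mult_left_mono) linarith+
    then have "10 \<le> N * dist (c e x) (c f y)" using N(3) by linarith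
    then have "2 * (of_int 2 + 1) < N * dist (c e x) (c f y)" by simp
    then show ?thesis by (rule far)
  qed
  have "\<exists>B g. (\<forall>v\<in>V. rep v \<in> B v \<and> B v \<subseteq> S v \<union> (\<Union>e\<in>Ed. W e) \<and> (\<forall>q\<in>B v. (rep v, q) \<in> (linked (B v))\<^sup>*)) \<and>
    (\<forall>u\<in>V. \<forall>v\<in>V. u \<noteq> v \<longrightarrow> B u \<inter> B v = {}) \<and> inj_on g Ed \<and>
    (\<forall>e\<in>Ed. g e \<in> grid_edges UNIV \<and>
      g e \<in> B (fst (ends e)) \<times> B (snd (ends e)) \<union> B (snd (ends e)) \<times> B (fst (ends e)))"
  proof (rule grid_model_of_separated[OF ends])
    show "rep v \<in> S v" for v using L N by (auto simp: S_def grid_close_def)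
    show "(rep v, q) \<in> (linked (S v))\<^sup>*" if "q \<in> S v" for v q
      using linked_square[of L "fst (rep v)" "snd (rep v)" "fst q" "snd q"] that by (simp add: S_def)
    show "S u \<inter> S v = {}" if "u \<in> V" "v \<in> V" "u \<noteq> v" for u v
    proof (rule ccontr)
      assume "S u \<inter> S v \<noteq> {}"
      then obtain q where "grid_close L (rep u) q" "grid_close L q (rep v)"
        by (auto simp: S_def grid_close_sym[of L "rep v"])
      then show False using grid_close_trans[of L "rep u" q L "rep v"] far_vertices[OF that]
        by (auto simp: grid_close_def)
    qed
    show "\<not> grid_adjacent q q'" if "u \<in> V" "v \<in> V" "u \<noteq> v" "q \<in> S u" "q' \<in> S v" for u v q q'
    proof
      assume "grid_adjacent q q'"
      then have "grid_close (L + 1 + L) (rep u) (rep v)"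
        using that(4,5) grid_adjacent_close grid_close_trans grid_close_sym unfolding S_def mem_Collect_eq by blast
      then show False using far_vertices[OF that(1-3)] by (simp add: add.commute)
    qed
    show "\<exists>x\<in>S (?a e). \<exists>y\<in>S (?b e). (x, y) \<in> (linked (W e))\<^sup>*" if "e \<in> Ed" for e
    proof (intro bexI)
      show "(grid_point N (c e (s e)), grid_point N (c e (t e))) \<in> (linked (W e))\<^sup>*"
        unfolding W_def using linked_grid_point_path[OF N(1) cont'[OF that]] st[OF that] by simp
      \<comment> \<open>In grid units \<open>\<rho> / 2\<close> is \<open>R / 2\<close>, which is
        below \<open>L > R - 1\<close> because \<open>R \<ge> 10\<close>.\<close>
      have "N * dist (p (?a e)) (c e (s e)) < of_int L" "N * dist (p (?b e)) (c e (t e)) < of_int L"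
      proof -
        have "N * dist (p (?a e)) (c e (s e)) < R / 2" "N * dist (p (?b e)) (c e (t e)) < R / 2"
          using st_near[OF that] N(1) unfolding R_def times_divide_eq_right[symmetric]
          by (simp_all add: dist_commute)
        then show "N * dist (p (?a e)) (c e (s e)) < of_int L" "N * dist (p (?b e)) (c e (t e)) < of_int L"
          using L N by linarith+
      qed
      then show "grid_point N (c e (s e)) \<in> S (?a e)" "grid_point N (c e (t e)) \<in> S (?b e)"
        using grid_point_close[OF N(1)] by (auto simp: S_def rep_def)
    qed
    show "W e \<inter> S v = {}" if "e \<in> Ed" "v \<in> V" "v \<noteq> ?a e" "v \<noteq> ?b e" for e v
    proof (rule ccontr)
      assume "W e \<inter> S v \<noteq> {}"
      then obtain q x where "x \<in> {s e..t e}" "grid_close 1 (grid_point N (c e x)) q" "grid_close L q (rep v)"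
        unfolding S_def W_def grid_close_sym[of L "rep v"] by blast
      then show False using grid_close_trans far_edge[OF that, of x] by (metis add.commute)
    qed
    show "W e \<inter> W f = {}" if "e \<in> Ed" "f \<in> Ed" "e \<noteq> f" for e f
    proof (rule ccontr)
      assume "W e \<inter> W f \<noteq> {}"
      then obtain q x y where "x \<in> {s e..t e}" "y \<in> {s f..t f}" "grid_close 1 (grid_point N (c e x)) q"
        "grid_close 1 q (grid_point N (c f y))"
        unfolding W_def using grid_close_sym[of 1 "grid_point N (c f _)"] by blast
      then show False using grid_close_trans[of 1 _ q 1] far_edges[OF that, of x y] by auto
    qed
  qed
  then obtain B g where Bg: "\<forall>v\<in>V. rep v \<in> B v \<and> B v \<subseteq> S v \<union> (\<Union>e\<in>Ed. W e) \<and> (\<forall>q\<in>B v. (rep v, q) \<in> (linked (B v))\<^sup>*)"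
    and rest: "(\<forall>u\<in>V. \<forall>v\<in>V. u \<noteq> v \<longrightarrow> B u \<inter> B v = {}) \<and> inj_on g Ed \<and>
    (\<forall>e\<in>Ed. g e \<in> grid_edges UNIV \<and>
      g e \<in> B (fst (ends e)) \<times> B (snd (ends e)) \<union> B (snd (ends e)) \<times> B (fst (ends e)))"
    by blast
  have "bounded (p ` V \<union> (\<Union>e\<in>Ed. path_image (c e)))"
    unfolding bounded_Un using fin edge(3)
    by (intro conjI bounded_UN ballI) (simp_all add: finite_imp_bounded bounded_path_image arc_imp_path)
  then obtain M where M: "\<And>z. z \<in> p ` V \<union> (\<Union>e\<in>Ed. path_image (c e)) \<Longrightarrow> norm z \<le> M"
    unfolding bounded_iff by blast
  define m where "m = \<lceil>N * M\<rceil> + L + 2"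
  have box: "q \<in> {-m..m} \<times> {-m..m}" if "grid_close k (grid_point N z) q" "norm z \<le> M" "k \<le> L + 1" for k z q
  proof -
    have "\<bar>N * z $ i\<bar> \<le> of_int \<lceil>N * M\<rceil>" for i
    proof -
      have "\<bar>N * z $ i\<bar> \<le> N * M"
        using N(1) component_le_norm_cart[of z i] that(2) by (auto simp: abs_mult intro!: mult_left_mono)
      then show ?thesis by linarith
    qed
    from this[of 1] this[of 2] have "\<bar>\<lfloor>N * z $ 1\<rfloor>\<bar> \<le> \<lceil>N * M\<rceil> + 1" "\<bar>\<lfloor>N * z $ 2\<rfloor>\<bar> \<le> \<lceil>N * M\<rceil> + 1"
      by linarith+
    then show ?thesis using that(1,3) by (cases q) (auto simp: grid_close_def grid_point_def m_def)
  qed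
  have "S v \<subseteq> {-m..m} \<times> {-m..m}" if "v \<in> V" for v
  proof
    fix q assume "q \<in> S v"
    then show "q \<in> {-m..m} \<times> {-m..m}" using M[of "p v"] that by (intro box[of L "p v"]) (simp_all add: S_def rep_def)
  qed
  moreover have "W e \<subseteq> {-m..m} \<times> {-m..m}" if "e \<in> Ed" for e
  proof
    fix q assume "q \<in> W e"
    then obtain x where x: "x \<in> {s e..t e}" "grid_close 1 (grid_point N (c e x)) q" by (auto simp: W_def)
    have "norm (c e x) \<le> M" using on_path[OF that x(1)] that by (intro M) blast
    moreover have "1 \<le> L + 1" using L N by linarith
    ultimately show "q \<in> {-m..m} \<times> {-m..m}" using box[OF x(2)] by blast
  qed
  ultimately have "B v \<subseteq> {-m..m} \<times> {-m..m}" if "v \<in> V" for v using Bg that by blast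
  then show ?thesis using Bg rest by (intro exI[of _ m] exI[of _ rep] exI[of _ B] exI[of _ g]) simp
qed

section \<open>From planar graphs to grids\<close>

context star_triangle_pair
begin

lemma planar_scaffold0_eq:
  fixes V :: "'v set" and Ed :: "'e set"
  assumes graph: "finite_graph V Ed ends" and planar: "planar_graph V Ed ends"
    and w: "\<And>e. e \<in> Ed \<Longrightarrow> (w e, w' e) \<in> \<A>"
  shows "scaffold0 V Ed ends w = scaffold0 V Ed ends w'"
proof -
  have fin: "finite V" "finite Ed" and ends: "\<And>e. e \<in> Ed \<Longrightarrow> fst (ends e) \<in> V \<and> snd (ends e) \<in> V"
    using graph by (auto simp: finite_graph_def)
  \<comment> \<open>A loop sees only the diagonal of its weight, which is constant and equal in both
    schemes; the grid model is built for the remaining edges.\<close>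
  define Lo where "Lo = {e \<in> Ed. fst (ends e) = snd (ends e)}"
  define Ed0 where "Ed0 = Ed - Lo"
  have "\<exists>m. \<forall>e\<in>Lo. (\<forall>x. w e x x = m e) \<and> (\<forall>x. w' e x x = m e)"
    using diagonal[OF w] by (intro bchoice) (auto simp: Lo_def)
  then obtain m where m: "\<And>e x y. e \<in> Lo \<Longrightarrow> w e x x = m e \<and> w' e y y = m e" by blast
  have loops: "scaffold0 V Ed ends v = prod m Lo * scaffold0 V Ed0 ends v"
    if v: "\<And>e x. e \<in> Lo \<Longrightarrow> v e x x = m e" for v :: "'e \<Rightarrow> ('z::finite) mat"
  proof -
    have Ed: "Ed = Lo \<union> Ed0" by (auto simp: Lo_def Ed0_def)
    have "(\<Prod>e\<in>Ed. v e (\<phi> (fst (ends e))) (\<phi> (snd (ends e)))) =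
        prod m Lo * (\<Prod>e\<in>Ed0. v e (\<phi> (fst (ends e))) (\<phi> (snd (ends e))))" for \<phi>
    proof -
      have "(\<Prod>e\<in>Lo. v e (\<phi> (fst (ends e))) (\<phi> (snd (ends e)))) = prod m Lo"
        by (intro prod.cong refl) (use v in \<open>auto simp: Lo_def\<close>)
      then show ?thesis
        unfolding Ed by (subst prod.union_disjoint) (use fin in \<open>auto simp: Lo_def Ed0_def\<close>)
    qed
    then show ?thesis by (simp add: scaffold0_def sum_distrib_left)
  qed
  obtain p c where "planar_embedding V Ed ends p c" using planar by (auto simp: planar_graph_def)
  then have emb: "planar_embedding V Ed0 ends p c" by (auto simp: planar_embedding_def Ed0_def)
  have fin0: "finite Ed0" using fin by (simp add: Ed0_def)
  have ends0: "fst (ends e) \<in> V \<and> snd (ends e) \<in> V \<and> fst (ends e) \<noteq> snd (ends e)" if "e \<in> Ed0" for e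
    using ends that by (auto simp: Ed0_def Lo_def)
  from planar_grid_model[OF emb fin(1) fin0 ends0] obtain b rep B g where
    B: "\<And>v. v \<in> V \<Longrightarrow> rep v \<in> B v \<and> B v \<subseteq> {-b..b} \<times> {-b..b} \<and> (\<forall>q\<in>B v. (rep v, q) \<in> (linked (B v))\<^sup>*)"
    and disj: "\<And>u v. u \<in> V \<Longrightarrow> v \<in> V \<Longrightarrow> u \<noteq> v \<Longrightarrow> B u \<inter> B v = {}" and inj: "inj_on g Ed0"
    and g: "\<And>e. e \<in> Ed0 \<Longrightarrow> g e \<in> grid_edges UNIV \<and>
      g e \<in> B (fst (ends e)) \<times> B (snd (ends e)) \<union> B (snd (ends e)) \<times> B (fst (ends e))" by metis
  \<comment> \<open>The maximum secures \<open>- n \<le> n\<close>, as \<open>transfers_grid\<close>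
    requires.\<close>
  define n where "n = max b 0"
  define U where "U = grid_region (- n) n (- n) (- n)"
  have finU: "finite U" "finite (grid_edges U)" by (simp_all add: U_def)
  have BU: "B v \<subseteq> U" if "v \<in> V" for v
  proof -
    have "{-b..b} \<times> {-b..b} \<subseteq> U" by (auto simp: U_def grid_region_def n_def)
    then show ?thesis using B[OF that] by blast
  qed
  have edges_U: "(x, y) \<in> grid_edges U" if "(x, y) \<in> grid_edges UNIV" "x \<in> U" "y \<in> U" for x y
    using that by (auto simp: grid_edges_def)
  have conn: "(rep v, q) \<in> {(x, y). x \<in> B v \<and> y \<in> B v \<and> ((x, y) \<in> grid_edges U \<or> (y, x) \<in> grid_edges U)}\<^sup>*"
    if v: "v \<in> V" "q \<in> B v" for v q
  proof -
    have "linked (B v) \<subseteq> {(x, y). x \<in> B v \<and> y \<in> B v \<and> ((x, y) \<in> grid_edges U \<or> (y, x) \<in> grid_edges U)}"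
      unfolding linked_def grid_adjacent_def using BU[OF v(1)] edges_U by blast
    from rtrancl_mono[OF this] show ?thesis using B[OF v(1)] v(2) by blast
  qed
  have gU: "g e \<in> grid_edges U" if "e \<in> Ed0" for e
  proof -
    obtain x y where xy: "g e = (x, y)" by (cases "g e")
    have "B (fst (ends e)) \<subseteq> U" "B (snd (ends e)) \<subseteq> U" using ends0[OF that] BU by simp_all
    then have "x \<in> U" "y \<in> U" using g[OF that] unfolding xy by auto
    then show ?thesis using g[OF that] edges_U[of x y] unfolding xy by simp
  qed
  let ?W = "\<lambda>v e. if e \<in> g ` Ed0 then v (inv_into Ed0 g e)
        else if \<exists>v\<in>V. fst e \<in> B v \<and> snd e \<in> B v then id_mat else (\<lambda>_ _. 1)"
  have minor: "scaffold0 U (grid_edges U) id (?W v) =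
      of_nat (CARD('z) ^ card (U - (\<Union>v\<in>V. B v))) * scaffold0 V Ed0 ends v"
    if v: "\<And>e x y. e \<in> Ed0 \<Longrightarrow> v e x y = v e y x" for v :: "'e \<Rightarrow> ('z::finite) mat"
  proof (rule scaffold0_minor[OF fin(1) fin0 finU v _ BU disj _ conn inj gU])
    show "fst (ends e) \<in> V \<and> snd (ends e) \<in> V" "fst (ends e) \<noteq> snd (ends e)" if "e \<in> Ed0" for e
      using ends0[OF that] by simp_all
    show "rep v \<in> B v" if "v \<in> V" for v using B[OF that] by simp
    show "g e \<in> B (fst (ends e)) \<times> B (snd (ends e)) \<union> B (snd (ends e)) \<times> B (fst (ends e))" if "e \<in> Ed0" for e
      using g[OF that] by simp
  qed
  have w0: "(w e, w' e) \<in> \<A>" if "e \<in> Ed0" for e using w that by (simp add: Ed0_def)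
  have minorX: "scaffold0 U (grid_edges U) id (?W w) =
      of_nat (CARD('x) ^ card (U - (\<Union>v\<in>V. B v))) * scaffold0 V Ed0 ends w"
    by (rule minor) (rule symmetric_left[OF w0])
  have minorY: "scaffold0 U (grid_edges U) id (?W w') =
      of_nat (CARD('y) ^ card (U - (\<Union>v\<in>V. B v))) * scaffold0 V Ed0 ends w'"
    by (rule minor) (rule symmetric_right[OF w0])
  have "scaffold0 U (grid_edges U) id (?W w) = scaffold0 U (grid_edges U) id (?W w')"
  proof (rule transfersD)
    show "transfers U (grid_edges U)" unfolding U_def by (rule transfers_grid) (simp add: n_def)
    show "(?W w e, ?W w' e) \<in> \<A>" for e
      using w inv_into_into[of e g Ed0] by (auto simp: id_mem ones_mem Ed0_def)
  qed
  \<comment> \<open>The factors from the free grid vertices are nonzero and agree, since the two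
    point sets have the same size.\<close>
  then have "scaffold0 V Ed0 ends w = scaffold0 V Ed0 ends w'"
    unfolding minorX minorY by (simp add: card_eq)
  then show ?thesis using loops[of w] loops[of w'] m by simp
qed

end

section \<open>Exactly triply regular schemes\<close>

definition lincomb :: "nat \<Rightarrow> (nat \<Rightarrow> complex) \<Rightarrow> (nat \<Rightarrow> 'x mat) \<Rightarrow> 'x mat" where
  "lincomb d a F = (\<lambda>x y. \<Sum>i\<le>d. a i * F i x y)"

abbreviation triples :: "nat \<Rightarrow> (nat \<times> nat \<times> nat) set" where
  "triples d \<equiv> {..d} \<times> {..d} \<times> {..d}"

definition Upsilon_family :: "(nat \<Rightarrow> ('x::finite) mat) \<Rightarrow> nat \<times> nat \<times> nat \<Rightarrow> 'x \<times> 'x \<times> 'x \<Rightarrow> complex" where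
  "Upsilon_family F = (\<lambda>(r, s, t). Upsilon (F r) (F s) (F t))"

definition Delta_family :: "(nat \<Rightarrow> 'x mat) \<Rightarrow> nat \<times> nat \<times> nat \<Rightarrow> 'x \<times> 'x \<times> 'x \<Rightarrow> complex" where
  "Delta_family F = (\<lambda>(r, s, t). Delta (F r) (F s) (F t))"

definition coeff3 :: "(nat \<Rightarrow> complex) \<Rightarrow> (nat \<Rightarrow> complex) \<Rightarrow> (nat \<Rightarrow> complex) \<Rightarrow> nat \<times> nat \<times> nat \<Rightarrow> complex" where
  "coeff3 a b c = (\<lambda>(r, s, t). a r * b s * c t)"

lemma sum_product3:
  fixes f :: "'a \<Rightarrow> complex"
  shows "(\<Sum>i\<in>A. f i) * (\<Sum>j\<in>B. g j) * (\<Sum>k\<in>C. h k) = (\<Sum>(i, j, k)\<in>A \<times> B \<times> C. f i * g j * h k)"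
proof -
  have "(\<Sum>(i, j, k)\<in>A \<times> B \<times> C. f i * g j * h k) = (\<Sum>i\<in>A. \<Sum>j\<in>B. \<Sum>k\<in>C. f i * g j * h k)"
    by (simp add: sum.cartesian_product')
  then show ?thesis
    by (simp add: sum_distrib_left[symmetric] sum_distrib_right[symmetric])
qed

lemma Upsilon_lincomb:
  "Upsilon (lincomb d a F) (lincomb d b F) (lincomb d c F) = (\<lambda>p. \<Sum>k\<in>triples d. coeff3 a b c k * Upsilon_family F k p)"
proof
  fix p :: "'a \<times> 'a \<times> 'a"
  obtain x y z where p: "p = (x, y, z)" by (cases p)
  have "Upsilon (lincomb d a F) (lincomb d b F) (lincomb d c F) p =
     (\<Sum>u\<in>UNIV. \<Sum>(i, j, k)\<in>triples d. (a i * F i x u) * (b j * F j y u) * (c k * F k z u))"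
    by (simp add: p Upsilon_def lincomb_def sum_product3)
  also have "\<dots> = (\<Sum>k\<in>triples d. coeff3 a b c k * Upsilon_family F k p)"
    by (subst sum.swap) (auto simp: p coeff3_def Upsilon_family_def Upsilon_def sum_distrib_left mult_ac intro!: sum.cong)
  finally show "Upsilon (lincomb d a F) (lincomb d b F) (lincomb d c F) p = (\<Sum>k\<in>triples d. coeff3 a b c k * Upsilon_family F k p)" .
qed

lemma Delta_lincomb:
  "Delta (lincomb d a F) (lincomb d b F) (lincomb d c F) = (\<lambda>p. \<Sum>k\<in>triples d. coeff3 a b c k * Delta_family F k p)"
proof
  fix p :: "'a \<times> 'a \<times> 'a"
  obtain x y z where p: "p = (x, y, z)" by (cases p)
  have "Delta (lincomb d a F) (lincomb d b F) (lincomb d c F) p =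
     (\<Sum>(i, j, k)\<in>triples d. (a i * F i x z) * (b j * F j x y) * (c k * F k y z))"
    by (simp add: p Delta_def lincomb_def sum_product3)
  also have "\<dots> = (\<Sum>k\<in>triples d. coeff3 a b c k * Delta_family F k p)"
    by (auto simp: p coeff3_def Delta_family_def Delta_def mult_ac intro!: sum.cong)
  finally show "Delta (lincomb d a F) (lincomb d b F) (lincomb d c F) p = (\<Sum>k\<in>triples d. coeff3 a b c k * Delta_family F k p)" .
qed

lemma cspan_family:
  assumes gen: "\<And>g. g \<in> S \<Longrightarrow> \<exists>a. g = (\<lambda>p. \<Sum>k\<in>K. a k * F k p)" and T: "T \<in> cspan S"
  shows "\<exists>a. T = (\<lambda>p. \<Sum>k\<in>K. a k * F k p)"
proof -
  obtain G c where G: "G \<subseteq> S" "T = (\<lambda>p. \<Sum>g\<in>G. c g * g p)" using T by (auto simp: cspan_def)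
  have "\<forall>g\<in>G. \<exists>a. g = (\<lambda>p. \<Sum>k\<in>K. a k * F k p)" using gen G(1) by blast
  then obtain a where a: "\<forall>g\<in>G. g = (\<lambda>p. \<Sum>k\<in>K. a g k * F k p)"
    by (rule bchoice[THEN exE])
  have "T = (\<lambda>p. \<Sum>k\<in>K. (\<Sum>g\<in>G. c g * a g k) * F k p)"
  proof
    fix p
    have "T p = (\<Sum>g\<in>G. c g * (\<Sum>k\<in>K. a g k * F k p))"
      unfolding G(2) using a by (intro sum.cong refl arg_cong2[where f = times]) metis
    also have "\<dots> = (\<Sum>k\<in>K. (\<Sum>g\<in>G. c g * a g k) * F k p)"
      by (simp add: sum_distrib_left sum_distrib_right mult.assoc sum.swap[of _ G K])
    finally show "T p = (\<Sum>k\<in>K. (\<Sum>g\<in>G. c g * a g k) * F k p)" .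
  qed
  then show ?thesis by (intro exI[of _ "\<lambda>k. \<Sum>g\<in>G. c g * a g k"])
qed

lemma cspan_superset: "g \<in> S \<Longrightarrow> g \<in> cspan S"
  unfolding cspan_def mem_Collect_eq by (intro exI[of _ "{g}"] exI[of _ "\<lambda>_. 1"]) auto

text \<open>Gaussian elimination: an equation with a nonzero coefficient serves to eliminate the
  unknown \<open>s\<close>, leaving one equation and one unknown less. This is the dimension count
  behind \<open>E_span\<close>.\<close>

lemma homogeneous_system_nontrivial:
  fixes f :: "'i \<Rightarrow> 'k \<Rightarrow> complex"
  assumes "finite K" "finite I" "card K < card I"
  shows "\<exists>c. (\<exists>i\<in>I. c i \<noteq> 0) \<and> (\<forall>k\<in>K. (\<Sum>i\<in>I. c i * f i k) = 0)"
  using assms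
proof (induction K arbitrary: I f rule: finite_induct)
  case empty
  then have "I \<noteq> {}" by auto
  then show ?case by (intro exI[of _ "\<lambda>_. 1"]) auto
next
  case (insert k K)
  show ?case
  proof (cases "\<forall>i\<in>I. f i k = 0")
    case True
    obtain c where "\<exists>i\<in>I. c i \<noteq> 0" "\<forall>k\<in>K. (\<Sum>i\<in>I. c i * f i k) = 0"
      using insert.IH[OF insert.prems(1), of f] insert.prems insert.hyps by auto
    then show ?thesis using True by (intro exI[of _ c]) auto
  next
    case False
    then obtain s where s: "s \<in> I" "f s k \<noteq> 0" by blast
    define g where "g = (\<lambda>i l. f i l - f i k / f s k * f s l)"
    have "card K < card (I - {s})" using insert.prems insert.hyps s by simp
    then obtain c where c: "\<exists>i\<in>I - {s}. c i \<noteq> 0" "\<And>l. l \<in> K \<Longrightarrow> (\<Sum>i\<in>I - {s}. c i * g i l) = 0"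
      using insert.IH[of "I - {s}" g] insert.prems by auto
    define c' where "c' = c(s := - (\<Sum>i\<in>I - {s}. c i * f i k) / f s k)"
    have expand: "(\<Sum>i\<in>I. c' i * f i l) = (\<Sum>i\<in>I - {s}. c i * g i l)" for l
    proof -
      have "(\<Sum>i\<in>I. c' i * f i l) = c' s * f s l + (\<Sum>i\<in>I - {s}. c' i * f i l)"
        using insert.prems s by (simp add: sum.remove)
      also have "(\<Sum>i\<in>I - {s}. c' i * f i l) = (\<Sum>i\<in>I - {s}. c i * f i l)"
        by (rule sum.cong) (auto simp: c'_def)
      also have "c' s * f s l + (\<Sum>i\<in>I - {s}. c i * f i l) = (\<Sum>i\<in>I - {s}. c i * g i l)"
        by (simp add: c'_def g_def right_diff_distrib sum_subtractf sum_distrib_right sum_divide_distrib sum_negf sum_distrib_left field_simps)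
      finally show ?thesis .
    qed
    have "g i k = 0" for i using s by (simp add: g_def)
    then have "\<forall>l\<in>insert k K. (\<Sum>i\<in>I. c' i * f i l) = 0" using c(2) by (auto simp: expand)
    moreover have "\<exists>i\<in>I. c' i \<noteq> 0" using c(1) by (auto simp: c'_def)
    ultimately show ?thesis by blast
  qed
qed

lemma lincomb_mmult:
  "mmult (lincomb d a F) (lincomb d b G) = (\<lambda>x z. \<Sum>i\<le>d. \<Sum>j\<le>d. a i * b j * mmult (F i) (G j) x z)"
proof (intro ext)
  fix x z
  have "mmult (lincomb d a F) (lincomb d b G) x z =
      (\<Sum>y\<in>UNIV. \<Sum>i\<le>d. \<Sum>j\<le>d. a i * b j * (F i x y * G j y z))"
    by (simp add: mmult_def lincomb_def sum_product mult_ac)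
  also have "\<dots> = (\<Sum>i\<le>d. \<Sum>y\<in>UNIV. \<Sum>j\<le>d. a i * b j * (F i x y * G j y z))" by (rule sum.swap)
  also have "\<dots> = (\<Sum>i\<le>d. \<Sum>j\<le>d. \<Sum>y\<in>UNIV. a i * b j * (F i x y * G j y z))"
    by (intro sum.cong refl sum.swap)
  finally show "mmult (lincomb d a F) (lincomb d b G) x z = (\<Sum>i\<le>d. \<Sum>j\<le>d. a i * b j * mmult (F i) (G j) x z)"
    by (simp add: mmult_def sum_distrib_left)
qed

text \<open>With primitive idempotents \<open>L\<close>, \<open>M\<close>, \<open>N\<close> this isolates one term of a linear combination of stars.\<close>
lemma sum_legs_Upsilon:
  "(\<Sum>(x', y', z')\<in>UNIV. L x x' * M y y' * N z z' * Upsilon F G H (x', y', z')) =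
    Upsilon (mmult L F) (mmult M G) (mmult N H) (x, y, z)"
proof -
  have "(\<Sum>(x', y', z')\<in>UNIV. L x x' * M y y' * N z z' * Upsilon F G H (x', y', z')) =
     (\<Sum>(x', y', z')\<in>UNIV \<times> UNIV \<times> UNIV. \<Sum>u\<in>UNIV. (L x x' * F x' u) * (M y y' * G y' u) * (N z z' * H z' u))"
    by (simp add: Upsilon_def sum_distrib_left mult_ac flip: UNIV_Times_UNIV)
  also have "\<dots> = (\<Sum>u\<in>UNIV. \<Sum>(x', y', z')\<in>UNIV \<times> UNIV \<times> UNIV. (L x x' * F x' u) * (M y y' * G y' u) * (N z z' * H z' u))"
    unfolding case_prod_unfold by (rule sum.swap)
  also have "\<dots> = Upsilon (mmult L F) (mmult M G) (mmult N H) (x, y, z)"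
    unfolding Upsilon_def mmult_def prod.case sum_product3 ..
  finally show ?thesis .
qed

section \<open>The algebra, stars and Delta-Wye parameters of a single scheme\<close>

locale etr_scheme =
  fixes d :: nat and R :: "nat \<Rightarrow> ('x::finite \<times> 'x) set" and E :: "nat \<Rightarrow> 'x mat"
  assumes scheme: "sym_assoc_scheme d R" and idem: "prim_idempotents d R E"
    and etr: "exactly_triply_regular d R"
begin

definition rel :: "'x \<Rightarrow> 'x \<Rightarrow> nat" where
  "rel x y = (THE i. i \<le> d \<and> (x, y) \<in> R i)"

lemma rel: "rel x y \<le> d \<and> (x, y) \<in> R (rel x y)"
proof -
  have "\<exists>!i. i \<le> d \<and> (x, y) \<in> R i" using scheme by (simp add: sym_assoc_scheme_def)
  then show ?thesis unfolding rel_def by (rule theI')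
qed

lemma rel_eq_iff: "i \<le> d \<Longrightarrow> (x, y) \<in> R i \<longleftrightarrow> rel x y = i"
proof -
  have "\<exists>!i. i \<le> d \<and> (x, y) \<in> R i" using scheme by (simp add: sym_assoc_scheme_def)
  moreover assume "i \<le> d"
  ultimately show ?thesis using rel[of x y] by blast
qed

lemma adj_eq: "i \<le> d \<Longrightarrow> adj_mat R i x y = (if rel x y = i then 1 else 0)"
  by (simp add: adj_mat_def rel_eq_iff)

lemma rel_sym: "rel x y = rel y x"
  using rel[of x y] scheme rel_eq_iff[of "rel x y" y x] by (auto simp: sym_assoc_scheme_def)

lemma rel_zero_iff: "rel x y = 0 \<longleftrightarrow> x = y"
  using rel_eq_iff[of 0 x y] scheme by (auto simp: sym_assoc_scheme_def)

lemma lincomb_adj: "lincomb d c (adj_mat R) = (\<lambda>x y. c (rel x y))"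
proof (intro ext)
  fix x y
  have "lincomb d c (adj_mat R) x y = (\<Sum>i\<le>d. if i = rel x y then c i else 0)"
    unfolding lincomb_def by (intro sum.cong) (auto simp: adj_eq)
  then show "lincomb d c (adj_mat R) x y = c (rel x y)" using rel by simp
qed

lemma bose_mesner_iff: "M \<in> bose_mesner d R \<longleftrightarrow> (\<exists>c. M = (\<lambda>x y. c (rel x y)))"
  by (simp add: bose_mesner_def lincomb_adj[symmetric] lincomb_def)

lemma E_mem: "r \<le> d \<Longrightarrow> E r \<in> bose_mesner d R"
  and E_sym: "r \<le> d \<Longrightarrow> E r x y = E r y x"
  and E_mult: "r \<le> d \<Longrightarrow> s \<le> d \<Longrightarrow> mmult (E r) (E s) = (if r = s then E r else zero_mat)"
  and E_sum: "lincomb d (\<lambda>_. 1) E = id_mat"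
  and E_indep: "lincomb d c E = zero_mat \<Longrightarrow> r \<le> d \<Longrightarrow> c r = 0"
  using idem by (auto simp: prim_idempotents_def lincomb_def)

lemma E_rel: "r \<le> d \<Longrightarrow> \<exists>e. E r = (\<lambda>x y. e (rel x y))"
  using E_mem[of r] by (simp only: bose_mesner_iff)

lemma E_coeff_unique:
  assumes "lincomb d a E = lincomb d b E" "r \<le> d"
  shows "a r = b r"
proof -
  have "lincomb d (\<lambda>i. a i - b i) E = zero_mat"
    using assms(1) by (auto simp: lincomb_def zero_mat_def fun_eq_iff left_diff_distrib sum_subtractf)
  from E_indep[OF this assms(2)] show ?thesis by simp
qed

text \<open>Matrices of the algebra are functions on the \<open>d + 1\<close> relations, so
  \<open>E 0\<close>, ..., \<open>E d\<close> and \<open>M\<close> are dependent; independence of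
  the idempotents makes the coefficient of \<open>M\<close> nonzero.\<close>

lemma E_span:
  assumes "M \<in> bose_mesner d R"
  shows "\<exists>a. M = lincomb d a E"
proof -
  obtain m where m: "M = (\<lambda>x y. m (rel x y))" using assms by (auto simp: bose_mesner_iff)
  from E_rel obtain e where e: "\<And>r. r \<le> d \<Longrightarrow> E r = (\<lambda>x y. e r (rel x y))" by metis
  define f where "f = (\<lambda>i. if i \<le> d then e i else m)"
  obtain c where c: "\<exists>i\<in>{..Suc d}. c i \<noteq> 0" "\<And>k. k \<le> d \<Longrightarrow> (\<Sum>i\<le>Suc d. c i * f i k) = 0"
    using homogeneous_system_nontrivial[of "{..d}" "{..Suc d}" f] by auto
  have zero: "lincomb d c E x y + c (Suc d) * M x y = 0" for x y
  proof -
    have "lincomb d c E x y = (\<Sum>i\<le>d. c i * f i (rel x y))"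
      unfolding lincomb_def by (intro sum.cong) (auto simp: e f_def)
    then show ?thesis using c(2)[of "rel x y"] rel by (simp add: m f_def)
  qed
  have "c (Suc d) \<noteq> 0"
  proof
    assume 0: "c (Suc d) = 0"
    then have "lincomb d c E = zero_mat" using zero by (auto simp: zero_mat_def)
    then have "c i = 0" if "i \<le> Suc d" for i using that 0 E_indep le_SucE by blast
    then show False using c(1) by auto
  qed
  then have "M = lincomb d (\<lambda>i. - c i / c (Suc d)) E"
  proof (intro ext)
    fix x y
    have "M x y = - lincomb d c E x y / c (Suc d)"
      using zero[of x y] \<open>c (Suc d) \<noteq> 0\<close> by (simp add: field_simps eq_neg_iff_add_eq_0)
    then show "M x y = lincomb d (\<lambda>i. - c i / c (Suc d)) E x y"
      by (simp add: lincomb_def sum_divide_distrib sum_negf)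
  qed
  then show ?thesis by blast
qed

lemma lincomb_E_mmult: "mmult (lincomb d a E) (lincomb d b E) = lincomb d (\<lambda>r. a r * b r) E"
proof (intro ext)
  fix x z
  have "mmult (lincomb d a E) (lincomb d b E) x z = (\<Sum>i\<le>d. \<Sum>j\<le>d. if j = i then a i * b i * E i x z else 0)"
    unfolding lincomb_mmult by (intro sum.cong refl) (auto simp: E_mult zero_mat_def)
  then show "mmult (lincomb d a E) (lincomb d b E) x z = lincomb d (\<lambda>r. a r * b r) E x z"
    by (simp add: lincomb_def)
qed

lemma lincomb_single: "r \<le> d \<Longrightarrow> lincomb d (\<lambda>i. if i = r then 1 else 0) F = F r"
  by (auto simp: lincomb_def if_distrib[of "\<lambda>c. c * _"] fun_eq_iff cong: if_cong)

lemma E_nonzero: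
  assumes "r \<le> d"
  shows "\<exists>x y. E r x y \<noteq> 0"
proof (rule ccontr)
  assume "\<not> ?thesis"
  then have "lincomb d (\<lambda>i. if i = r then 1 else 0) E = zero_mat"
    using lincomb_single[OF assms, of E] by (auto simp: zero_mat_def)
  from E_indep[OF this assms] show False by simp
qed

text \<open>The conjugates \<open>C s\<close> are again orthogonal idempotents of the algebra. The
  diagonal of \<open>E s\<close> times \<open>C s\<close> consists of sums of squared absolute
  values, so the coefficient of \<open>E s\<close> in \<open>C s\<close> is not 0, hence 1 by
  idempotence. Orthogonality of \<open>C r\<close> and \<open>C s\<close> then excludes
  \<open>E s\<close> from \<open>C r\<close>.\<close>

lemma E_cnj:
  assumes r: "r \<le> d"
  shows "cnj (E r x y) = E r x y"
proof -
  define C where "C = (\<lambda>s x y. cnj (E s x y))"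
  have "\<exists>a. C s = lincomb d a E" if "s \<le> d" for s
  proof (rule E_span)
    from E_rel[OF that] obtain e where "E s = (\<lambda>x y. e (rel x y))" ..
    then show "C s \<in> bose_mesner d R"
      unfolding bose_mesner_iff by (intro exI[of _ "\<lambda>i. cnj (e i)"]) (simp add: C_def)
  qed
  then obtain a where a: "\<And>s. s \<le> d \<Longrightarrow> C s = lincomb d (a s) E" by metis
  have CC: "mmult (C s) (C t) = (\<lambda>x y. cnj (mmult (E s) (E t) x y))" for s t
    by (simp add: mmult_def C_def)
  have nz: "a s s \<noteq> 0" if s: "s \<le> d" for s
  proof
    assume 0: "a s s = 0"
    have "mmult (E s) (C s) = lincomb d (\<lambda>r. (if r = s then 1 else 0) * a s r) E"
      by (simp only: a[OF s] lincomb_E_mmult[symmetric] lincomb_single[OF s])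
    also have "\<dots> = zero_mat"
      using 0 by (auto simp: lincomb_def zero_mat_def fun_eq_iff intro!: sum.neutral)
    finally have "mmult (E s) (C s) x x = 0" for x by (simp add: zero_mat_def)
    moreover have "mmult (E s) (C s) x x = (\<Sum>y\<in>UNIV. E s x y * cnj (E s x y))" for x
      unfolding mmult_def C_def by (intro sum.cong refl) (metis E_sym[OF s])
    ultimately have "(\<Sum>y\<in>UNIV. E s x y * cnj (E s x y)) = 0" for x by simp
    then have "complex_of_real (\<Sum>y\<in>UNIV. (cmod (E s x y))\<^sup>2) = 0" for x
      by (simp only: of_real_sum complex_norm_square)
    then have "(\<Sum>y\<in>UNIV. (cmod (E s x y))\<^sup>2) = 0" for x by (simp only: of_real_eq_0_iff)
    then have "E s x y = 0" for x y by (simp add: sum_nonneg_eq_0_iff)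
    then show False using E_nonzero[OF s] by blast
  qed
  have "lincomb d (\<lambda>t. a r t * a r t) E = lincomb d (a r) E"
    unfolding lincomb_E_mmult[symmetric] a[OF r, symmetric] CC by (simp add: E_mult[OF r r] C_def)
  then have "a r r * a r r = a r r" using E_coeff_unique[OF _ r] by blast
  then have one: "a r r = 1" using nz[OF r] by simp
  have "a r s = 0" if s: "s \<le> d" "s \<noteq> r" for s
  proof -
    have "lincomb d (\<lambda>t. a r t * a s t) E = zero_mat"
      unfolding lincomb_E_mmult[symmetric] a[OF r, symmetric] a[OF s(1), symmetric] CC
      using s(2) by (simp add: E_mult[OF r s(1)] zero_mat_def)
    from E_indep[OF this s(1)] show ?thesis using nz[OF s(1)] by simp
  qed
  then have "lincomb d (a r) E = lincomb d (\<lambda>i. if i = r then 1 else 0) E"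
    using one unfolding lincomb_def by (intro ext sum.cong) auto
  then have "C r = E r" using a[OF r] lincomb_single[OF r] by simp
  then show ?thesis by (simp add: C_def fun_eq_iff)
qed

abbreviation star :: "nat \<times> nat \<times> nat \<Rightarrow> 'x \<times> 'x \<times> 'x \<Rightarrow> complex" where
  "star \<equiv> Upsilon_family E"

text \<open>Contracting the legs with \<open>E r\<close>, \<open>E s\<close>, \<open>E t\<close>
  kills every star except the one with these indices, which it reproduces; evaluation at a point
  where that star does not vanish yields its coefficient.\<close>

lemma star_coeff:
  assumes eq: "(\<lambda>p. \<Sum>k\<in>triples d. a k * star k p) = (\<lambda>p. \<Sum>k\<in>triples d. b k * star k p)"
    and k: "k \<in> triples d" and nz: "star k \<noteq> (\<lambda>_. 0)"
  shows "a k = b k"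
proof -
  obtain r s t where k_eq: "k = (r, s, t)" by (cases k)
  then have rst: "r \<le> d" "s \<le> d" "t \<le> d" using k by auto
  obtain x y z where xyz: "star k (x, y, z) \<noteq> 0" using nz by (metis prod_cases3)
  define contr where "contr = (\<lambda>T. \<Sum>(x', y', z')\<in>UNIV. E r x x' * E s y y' * E t z z' * T (x', y', z'))"
  have proj: "contr (star j) = (if j = k then star k (x, y, z) else 0)" if "j \<in> triples d" for j
  proof -
    obtain r' s' t' where j: "j = (r', s', t')" by (cases j)
    then have "r' \<le> d" "s' \<le> d" "t' \<le> d" using that by auto
    then show ?thesis unfolding contr_def j k_eq Upsilon_family_def prod.case sum_legs_Upsilon
      by (auto simp: E_mult rst Upsilon_def zero_mat_def)
  qed
  have "contr (\<lambda>p. \<Sum>j\<in>triples d. c j * star j p) = c k * star k (x, y, z)" for c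
  proof -
    have "contr (\<lambda>p. \<Sum>j\<in>triples d. c j * star j p) = (\<Sum>j\<in>triples d. c j * contr (star j))"
      unfolding contr_def case_prod_unfold
      by (simp add: sum_distrib_left mult.left_commute sum.swap[of _ "triples d" UNIV])
    also have "\<dots> = (\<Sum>j\<in>triples d. if j = k then c k * star k (x, y, z) else 0)"
      by (intro sum.cong refl) (auto simp: proj)
    finally show ?thesis using k by simp
  qed
  from this[of a] this[of b] show ?thesis using xyz eq by simp
qed

text \<open>Stars are real, and by idempotence one copy of the star absorbs the legs of the other.
  What remains is the trace of \<open>E r \<circ> E s\<close> (Schur product) times
  \<open>E t\<close>, that is, \<open>k t\<close> times the trace of \<open>E t\<close>, and the
  latter trace is the squared norm of \<open>E t\<close>.\<close>

lemma star_norm: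
  assumes rst: "r \<le> d" "s \<le> d" "t \<le> d" and k: "schur (E r) (E s) = lincomb d k E"
  shows "complex_of_real (\<Sum>p\<in>UNIV. (cmod (star (r, s, t) p))\<^sup>2) =
    k t * complex_of_real (\<Sum>x\<in>UNIV. \<Sum>y\<in>UNIV. (cmod (E t x y))\<^sup>2)"
proof -
  have real: "cnj (star (r, s, t) p) = star (r, s, t) p" for p
    by (cases p) (simp add: Upsilon_family_def Upsilon_def E_cnj rst)
  have tr: "mmult (E r) (E r) = E r" if "r \<le> d" for r using E_mult[OF that that] by simp
  have "complex_of_real (\<Sum>p\<in>UNIV. (cmod (star (r, s, t) p))\<^sup>2) = (\<Sum>p\<in>UNIV. star (r, s, t) p * star (r, s, t) p)"
    by (simp only: of_real_sum complex_norm_square real)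
  also have "\<dots> = (\<Sum>(x, y, z)\<in>UNIV. (\<Sum>u\<in>UNIV. E r x u * E s y u * E t z u) * star (r, s, t) (x, y, z))"
    by (intro sum.cong refl) (auto simp: Upsilon_family_def Upsilon_def)
  also have "\<dots> = (\<Sum>u\<in>UNIV. \<Sum>(x, y, z)\<in>UNIV. E r u x * E s u y * E t u z * star (r, s, t) (x, y, z))"
    unfolding case_prod_unfold sum_distrib_right
    by (subst sum.swap) (simp add: E_sym[OF rst(1), of _ "fst _"] E_sym[OF rst(2), of _ "fst _"] E_sym[OF rst(3), of _ "snd _"])
  also have "\<dots> = (\<Sum>u\<in>UNIV. Upsilon (E r) (E s) (E t) (u, u, u))"
    by (simp only: Upsilon_family_def prod.case sum_legs_Upsilon tr rst)
  also have "\<dots> = (\<Sum>u\<in>UNIV. \<Sum>v\<in>UNIV. lincomb d k E u v * E t u v)"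
    by (simp add: Upsilon_def k[symmetric] schur_def)
  also have "\<dots> = (\<Sum>u\<in>UNIV. mmult (lincomb d k E) (lincomb d (\<lambda>i. if i = t then 1 else 0) E) u u)"
    unfolding lincomb_single[OF rst(3)] mmult_def using E_sym[OF rst(3)] by (intro sum.cong refl) metis
  also have "\<dots> = (\<Sum>u\<in>UNIV. k t * E t u u)"
    unfolding lincomb_E_mmult using rst(3)
    by (simp add: lincomb_def if_distrib[of "\<lambda>c. c * _"] if_distrib[of "\<lambda>c. _ * c"] cong: if_cong)
  also have "\<dots> = (\<Sum>u\<in>UNIV. k t * (\<Sum>v\<in>UNIV. E t u v * cnj (E t u v)))"
    using fun_cong[OF fun_cong[OF tr[OF rst(3)]]] E_sym[OF rst(3)] E_cnj[OF rst(3)]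
    by (intro sum.cong refl arg_cong2[where f = times]) (simp add: mmult_def)
  finally show ?thesis by (simp add: sum_distrib_left flip: complex_norm_square)
qed

text \<open>By \<open>star_norm\<close> the Krein parameter is \<open>CARD('x)\<close> times the
  quotient of the squared norms of the star and of \<open>E t\<close>: real, nonnegative, and zero
  exactly if the star vanishes. This turns the index condition in \<open>dw_sigma\<close> into one
  about tensors.\<close>

lemma cpos_krein_iff:
  assumes rst: "r \<le> d" "s \<le> d" "t \<le> d"
  shows "cpos (krein d E r s t) \<longleftrightarrow> star (r, s, t) \<noteq> (\<lambda>_. 0)"
proof -
  have "schur (E r) (E s) \<in> bose_mesner d R"
  proof -
    from E_rel[OF rst(1)] E_rel[OF rst(2)] obtain e f
      where "E r = (\<lambda>x y. e (rel x y))" "E s = (\<lambda>x y. f (rel x y))" by (elim exE)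
    then show ?thesis unfolding bose_mesner_iff by (intro exI[of _ "\<lambda>i. e i * f i"]) (simp add: schur_def)
  qed
  then obtain k where k: "schur (E r) (E s) = lincomb d k E" using E_span by blast
  define n where "n = complex_of_nat CARD('x)"
  have n: "n \<noteq> 0" by (simp add: n_def)
  \<comment> \<open>Zero beyond \<open>d\<close>, as the definite description in
    \<open>krein\<close> demands.\<close>
  let ?q = "\<lambda>i. if i \<le> d then n * k i else 0"
  have "krein d E r s t = ?q t"
    unfolding krein_def n_def[symmetric]
  proof (rule arg_cong[where f = "\<lambda>q. q t"], rule the_equality)
    have "(\<lambda>x y. 1 / n * (\<Sum>i\<le>d. ?q i * E i x y)) = lincomb d k E"
      using n unfolding lincomb_def sum_distrib_left by (intro ext sum.cong) auto
    then show "(\<forall>i>d. ?q i = 0) \<and> schur (E r) (E s) = (\<lambda>x y. 1 / n * (\<Sum>i\<le>d. ?q i * E i x y))"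
      using k by simp
  next
    fix q assume q: "(\<forall>i>d. q i = 0) \<and> schur (E r) (E s) = (\<lambda>x y. 1 / n * (\<Sum>i\<le>d. q i * E i x y))"
    then have "lincomb d (\<lambda>i. q i / n) E = lincomb d k E"
      by (simp add: k[symmetric]) (simp add: lincomb_def sum_divide_distrib)
    then have "q i / n = k i" if "i \<le> d" for i using E_coeff_unique that by blast
    then show "q = ?q" using q n by (intro ext) (auto simp: field_simps not_le)
  qed
  define m where "m = (\<Sum>x\<in>UNIV. \<Sum>y\<in>UNIV. (cmod (E t x y))\<^sup>2)"
  define l where "l = (\<Sum>p\<in>UNIV. (cmod (star (r, s, t) p))\<^sup>2)"
  have "m > 0"
  proof -
    obtain x y where "E t x y \<noteq> 0" using E_nonzero[OF rst(3)] by blast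
    then have "0 < (cmod (E t x y))\<^sup>2" by simp
    also have "\<dots> \<le> (\<Sum>y\<in>UNIV. (cmod (E t x y))\<^sup>2)" by (rule member_le_sum) auto
    also have "\<dots> \<le> m" unfolding m_def by (rule member_le_sum) (auto intro: sum_nonneg)
    finally show ?thesis .
  qed
  have "complex_of_real l = k t * complex_of_real m" unfolding l_def m_def by (rule star_norm[OF rst k])
  then have "k t = complex_of_real (l / m)" using \<open>m > 0\<close> by (simp add: field_simps)
  then have "krein d E r s t = complex_of_real (real CARD('x) * (l / m))"
    using \<open>krein d E r s t = ?q t\<close> rst by (simp add: n_def)
  then have "cpos (krein d E r s t) \<longleftrightarrow> l > 0"
    using \<open>m > 0\<close> by (simp add: cpos_def zero_less_mult_iff zero_less_divide_iff)
  also have "\<dots> \<longleftrightarrow> l \<noteq> 0" using sum_nonneg[of UNIV "\<lambda>p. (cmod (star (r, s, t) p))\<^sup>2"] by (auto simp: l_def)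
  also have "\<dots> \<longleftrightarrow> star (r, s, t) \<noteq> (\<lambda>_. 0)" by (auto simp: l_def sum_nonneg_eq_0_iff fun_eq_iff)
  finally show ?thesis .
qed

lemma Upsilon_alg_star:
  assumes "T \<in> Upsilon_alg d R"
  shows "\<exists>a. T = (\<lambda>p. \<Sum>k\<in>triples d. a k * star k p)"
  using _ assms unfolding Upsilon_alg_def
proof (rule cspan_family)
  fix g assume "g \<in> {Upsilon L M N | L M N. L \<in> bose_mesner d R \<and> M \<in> bose_mesner d R \<and> N \<in> bose_mesner d R}"
  then obtain L M N where LMN: "L \<in> bose_mesner d R" "M \<in> bose_mesner d R" "N \<in> bose_mesner d R"
    and g: "g = Upsilon L M N" by blast
  obtain a b c where "L = lincomb d a E" "M = lincomb d b E" "N = lincomb d c E"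
    using LMN[THEN E_span] by (elim exE)
  then have "g = (\<lambda>p. \<Sum>k\<in>triples d. coeff3 a b c k * star k p)" using Upsilon_lincomb g by simp
  then show "\<exists>a. g = (\<lambda>p. \<Sum>k\<in>triples d. a k * star k p)" by (rule exI[of _ "coeff3 a b c"])
qed

lemma Delta_alg_triangle:
  assumes "T \<in> Delta_alg d R"
  shows "\<exists>a. T = (\<lambda>p. \<Sum>k\<in>triples d. a k * Delta_family (adj_mat R) k p)"
  using _ assms unfolding Delta_alg_def
proof (rule cspan_family)
  fix g assume "g \<in> {Delta L M N | L M N. L \<in> bose_mesner d R \<and> M \<in> bose_mesner d R \<and> N \<in> bose_mesner d R}"
  then obtain L M N where LMN: "L \<in> bose_mesner d R" "M \<in> bose_mesner d R" "N \<in> bose_mesner d R"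
    and g: "g = Delta L M N" by blast
  obtain a b c where "L = lincomb d a (adj_mat R)" "M = lincomb d b (adj_mat R)" "N = lincomb d c (adj_mat R)"
    using LMN unfolding bose_mesner_def lincomb_def by blast
  then have "g = (\<lambda>p. \<Sum>k\<in>triples d. coeff3 a b c k * Delta_family (adj_mat R) k p)" using Delta_lincomb g by simp
  then show "\<exists>a. g = (\<lambda>p. \<Sum>k\<in>triples d. a k * Delta_family (adj_mat R) k p)" by (rule exI[of _ "coeff3 a b c"])
qed

lemma adj_mem: "i \<le> d \<Longrightarrow> adj_mat R i \<in> bose_mesner d R"
  unfolding bose_mesner_iff by (intro exI[of _ "\<lambda>j. if j = i then 1 else 0"]) (simp add: adj_eq fun_eq_iff)

lemma Delta_family_mem: "k \<in> triples d \<Longrightarrow> Delta_family (adj_mat R) k \<in> Delta_alg d R"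
  unfolding Delta_alg_def Delta_family_def by (intro cspan_superset) (auto intro: adj_mem)

lemma star_mem: "k \<in> triples d \<Longrightarrow> star k \<in> Upsilon_alg d R"
  unfolding Upsilon_alg_def Upsilon_family_def by (intro cspan_superset) (auto intro: E_mem)

definition sigma :: "nat \<times> nat \<times> nat \<Rightarrow> nat \<times> nat \<times> nat \<Rightarrow> complex" where
  "sigma = (\<lambda>(i, j, k) (r, s, t). dw_sigma d R E i j k r s t)"

text \<open>Shows that the description in \<open>dw_sigma\<close> is proper: exact triple regularity
  gives existence, \<open>star_coeff\<close> uniqueness. The sum may run over all triples, since the
  stars left out in \<open>dw_sigma\<close> vanish.\<close>

lemma sigma:
  assumes q: "q \<in> triples d"
  shows "Delta_family (adj_mat R) q = (\<lambda>p. \<Sum>k\<in>triples d. sigma q k * star k p)"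
    and "k \<in> triples d \<Longrightarrow> star k = (\<lambda>_. 0) \<Longrightarrow> sigma q k = 0"
proof -
  obtain i j l where q_eq: "q = (i, j, l)" by (cases q)
  define Z where "Z = {(r, s, t). r \<le> d \<and> s \<le> d \<and> t \<le> d \<and> cpos (krein d E r s t)}"
  have Z: "k \<in> Z \<longleftrightarrow> k \<in> triples d \<and> star k \<noteq> (\<lambda>_. 0)" for k
    by (cases k) (auto simp: Z_def cpos_krein_iff)
  have sumZ: "(\<Sum>k\<in>Z. a k * star k p) = (\<Sum>k\<in>triples d. a k * star k p)" for a p
    by (rule sum.mono_neutral_left) (auto simp: Z)
  define P where "P = (\<lambda>\<sigma>. (\<forall>r s t. \<not> (r \<le> d \<and> s \<le> d \<and> t \<le> d \<and> cpos (krein d E r s t)) \<longrightarrow> \<sigma> r s t = 0) \<and>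
     Delta (adj_mat R i) (adj_mat R j) (adj_mat R l) =
       (\<lambda>a. \<Sum>(r, s, t)\<in>{(r, s, t). r \<le> d \<and> s \<le> d \<and> t \<le> d \<and> cpos (krein d E r s t)}.
              \<sigma> r s t * Upsilon (E r) (E s) (E t) a))"
  have P_iff: "P \<sigma> \<longleftrightarrow> (\<forall>k. k \<notin> Z \<longrightarrow> (case k of (r, s, t) \<Rightarrow> \<sigma> r s t) = 0) \<and>
      Delta_family (adj_mat R) q = (\<lambda>p. \<Sum>k\<in>triples d. (case k of (r, s, t) \<Rightarrow> \<sigma> r s t) * star k p)" for \<sigma>
    unfolding P_def Z_def[symmetric] sumZ[symmetric]
    by (simp add: q_eq Delta_family_def Upsilon_family_def case_prod_unfold) (auto simp: Z_def)
  have "Delta_family (adj_mat R) q \<in> Upsilon_alg d R" using Delta_family_mem[OF q] etr by (auto simp: exactly_triply_regular_def)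
  from Upsilon_alg_star[OF this] obtain a where a: "Delta_family (adj_mat R) q = (\<lambda>p. \<Sum>k\<in>triples d. a k * star k p)" ..
  define \<sigma> where "\<sigma> = (\<lambda>r s t. if (r, s, t) \<in> Z then a (r, s, t) else 0)"
  have \<sigma>_eq: "(case k of (r, s, t) \<Rightarrow> \<sigma> r s t) = (if k \<in> Z then a k else 0)" for k
    by (cases k) (simp add: \<sigma>_def)
  have "P \<sigma>"
    unfolding P_iff \<sigma>_eq a by (auto simp: Z intro!: ext sum.cong)
  moreover have "\<tau> = \<sigma>" if "P \<tau>" for \<tau>
  proof -
    have "(case k of (r, s, t) \<Rightarrow> \<tau> r s t) = (case k of (r, s, t) \<Rightarrow> \<sigma> r s t)" for k
    proof (cases "k \<in> Z")
      case True
      then show ?thesis using star_coeff[of "\<lambda>(r, s, t). \<tau> r s t" "\<lambda>(r, s, t). \<sigma> r s t" k] \<open>P \<tau>\<close> \<open>P \<sigma>\<close>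
        by (simp add: P_iff Z)
    next
      case False
      then show ?thesis using \<open>P \<tau>\<close> \<open>P \<sigma>\<close> by (cases k) (simp add: P_iff)
    qed
    then have "\<tau> r s t = \<sigma> r s t" for r s t by (metis case_prod_conv)
    then show ?thesis by blast
  qed
  ultimately have "P (THE \<sigma>. P \<sigma>)" by (rule theI)
  then have "P (dw_sigma d R E i j l)" unfolding dw_sigma_def P_def .
  moreover have "(case k of (r, s, t) \<Rightarrow> dw_sigma d R E i j l r s t) = sigma q k" for k
    by (simp add: sigma_def q_eq)
  ultimately have "\<forall>k. k \<notin> Z \<longrightarrow> sigma q k = 0"
    "Delta_family (adj_mat R) q = (\<lambda>p. \<Sum>k\<in>triples d. sigma q k * star k p)" unfolding P_iff by simp_all
  then show "Delta_family (adj_mat R) q = (\<lambda>p. \<Sum>k\<in>triples d. sigma q k * star k p)"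
    "k \<in> triples d \<Longrightarrow> star k = (\<lambda>_. 0) \<Longrightarrow> sigma q k = 0" using Z by blast+
qed

lemma adj_zero: "adj_mat R 0 = id_mat"
  by (simp add: adj_eq rel_zero_iff id_mat_def fun_eq_iff)

lemma adj_sum: "lincomb d (\<lambda>_. 1) (adj_mat R) = (\<lambda>_ _. 1)"
  by (simp add: lincomb_adj)

text \<open>The star of three identity matrices is the diagonal triangle, so the Delta-Wye parameters
  determine which Krein parameters vanish.\<close>
lemma sigma_zero:
  assumes "k \<in> triples d"
  shows "star k \<noteq> (\<lambda>_. 0) \<longleftrightarrow> sigma (0, 0, 0) k = 1"
proof -
  have "Upsilon (id_mat :: 'x mat) id_mat id_mat = Delta id_mat id_mat id_mat"
    by (auto simp: Upsilon_def Delta_def id_mat_def fun_eq_iff if_distrib[of "\<lambda>c. c * _"] cong: if_cong)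
  then have "(\<lambda>p. \<Sum>k\<in>triples d. coeff3 (\<lambda>_. 1) (\<lambda>_. 1) (\<lambda>_. 1) k * star k p) =
      (\<lambda>p. \<Sum>k\<in>triples d. sigma (0, 0, 0) k * star k p)"
    unfolding Upsilon_lincomb[symmetric] E_sum using sigma(1)[of "(0, 0, 0)"] by (simp add: Delta_family_def adj_zero)
  from star_coeff[OF this assms] sigma(2)[of "(0, 0, 0)" k] assms show ?thesis
    by (auto simp: coeff3_def split: prod.splits)
qed

text \<open>Similarly \<open>\<Upsilon>(A\<^sub>i, I, I) = \<Sum>\<^sub>j \<Delta>(A\<^sub>j, A\<^sub>i, I)\<close> recovers the eigenvalues of \<open>A\<^sub>i\<close>.\<close>
lemma eigenvalue_sigma:
  assumes "i \<le> d" "adj_mat R i = lincomb d a E" "(r, s, t) \<in> triples d" "star (r, s, t) \<noteq> (\<lambda>_. 0)"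
  shows "a r = (\<Sum>j\<le>d. sigma (j, i, 0) (r, s, t))"
proof -
  have "Upsilon (adj_mat R i) id_mat id_mat = Delta (\<lambda>_ _. 1) (adj_mat R i) id_mat"
    by (auto simp: Upsilon_def Delta_def id_mat_def fun_eq_iff if_distrib[of "\<lambda>c. _ * c"] cong: if_cong)
  also have "\<dots> = (\<lambda>p. \<Sum>j\<le>d. Delta_family (adj_mat R) (j, i, 0) p)"
    by (auto simp: Delta_def Delta_family_def adj_zero fun_eq_iff adj_sum[symmetric] lincomb_def sum_distrib_right)
  also have "\<dots> = (\<lambda>p. \<Sum>k\<in>triples d. (\<Sum>j\<le>d. sigma (j, i, 0) k) * star k p)"
    using assms(1) by (simp add: sigma(1) sum_distrib_right sum.swap[of _ "{..d}" "triples d"])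
  finally have "(\<lambda>p. \<Sum>k\<in>triples d. coeff3 a (\<lambda>_. 1) (\<lambda>_. 1) k * star k p) =
      (\<lambda>p. \<Sum>k\<in>triples d. (\<Sum>j\<le>d. sigma (j, i, 0) k) * star k p)"
    unfolding Upsilon_lincomb[symmetric] E_sum assms(2)[symmetric] .
  from star_coeff[OF this assms(3,4)] show ?thesis by (simp add: coeff3_def)
qed

text \<open>The stars with first index \<open>r\<close> add up to
  \<open>Upsilon (E r) id_mat id_mat\<close>, whose entry at \<open>(x, y, y)\<close> is
  \<open>E r x y\<close>. Thus \<open>eigenvalue_sigma\<close> reaches every index
  \<open>r\<close>.\<close>

lemma star_nonzero:
  assumes r: "r \<le> d"
  shows "\<exists>s\<le>d. \<exists>t\<le>d. star (r, s, t) \<noteq> (\<lambda>_. 0)"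
proof (rule ccontr)
  assume "\<not> ?thesis"
  then have *: "star (r, s, t) p = 0" if "s \<le> d" "t \<le> d" for s t p using that by auto
  let ?e = "\<lambda>i. if i = r then 1 else 0 :: complex"
  have "Upsilon (E r) id_mat id_mat = (\<lambda>p. \<Sum>k\<in>triples d. coeff3 ?e (\<lambda>_. 1) (\<lambda>_. 1) k * star k p)"
    unfolding Upsilon_lincomb[symmetric] E_sum lincomb_single[OF r] ..
  also have "\<dots> = (\<lambda>_. 0)"
    using * by (intro ext sum.neutral) (auto simp: coeff3_def)
  finally have "Upsilon (E r) id_mat id_mat (x, y, y) = 0" for x y by simp
  then have "E r x y = 0" for x y
    by (simp add: Upsilon_def id_mat_def if_distrib[of "\<lambda>c. _ * c"] cong: if_cong)
  then show False using E_nonzero[OF r] by blast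
qed

end

lemma lincomb_lincomb:
  assumes "\<forall>i\<le>d. F i = lincomb d (a i) G"
  shows "lincomb d c F = lincomb d (\<lambda>r. \<Sum>i\<le>d. c i * a i r) G"
proof (intro ext)
  fix x y
  have "lincomb d c F x y = (\<Sum>i\<le>d. c i * lincomb d (a i) G x y)"
    using assms by (simp add: lincomb_def)
  also have "\<dots> = (\<Sum>i\<le>d. \<Sum>r\<le>d. c i * a i r * G r x y)"
    by (simp add: lincomb_def sum_distrib_left mult.assoc)
  also have "\<dots> = (\<Sum>r\<le>d. \<Sum>i\<le>d. c i * a i r * G r x y)" by (rule sum.swap)
  finally show "lincomb d c F x y = lincomb d (\<lambda>r. \<Sum>i\<le>d. c i * a i r) G x y"
    by (simp add: lincomb_def sum_distrib_right)
qed

lemma sum_combine: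
  fixes s :: "'a \<Rightarrow> complex"
  shows "(\<Sum>q\<in>A. s q * (\<Sum>k\<in>B. t q k * h k)) = (\<Sum>k\<in>B. (\<Sum>q\<in>A. s q * t q k) * h k)"
  by (simp add: sum_distrib_left sum_distrib_right mult.assoc sum.swap[of _ A B])

section \<open>Transfer of the algebra between two schemes with equal parameters\<close>

locale dw_pair = X: etr_scheme d R E + Y: etr_scheme d S E'
  for d and R :: "nat \<Rightarrow> ('x::finite \<times> 'x) set" and E
    and S :: "nat \<Rightarrow> ('y::finite \<times> 'y) set" and E' +
  assumes same_sigma: "\<And>q k. q \<in> triples d \<Longrightarrow> k \<in> triples d \<Longrightarrow> X.sigma q k = Y.sigma q k"
begin

text \<open>The graph of \<open>\<kappa>\<close>, written in the bases of adjacency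
  matrices.\<close>

definition algebra_pairs :: "('x mat \<times> 'y mat) set" where
  "algebra_pairs = {(lincomb d c (adj_mat R), lincomb d c (adj_mat S)) | c. True}"

lemma star_nonzero_iff: "k \<in> triples d \<Longrightarrow> X.star k \<noteq> (\<lambda>_. 0) \<longleftrightarrow> Y.star k \<noteq> (\<lambda>_. 0)"
  using X.sigma_zero[of k] Y.sigma_zero[of k] same_sigma[of "(0, 0, 0)" k] by simp

text \<open>For each \<open>r\<close> some star with first index \<open>r\<close> is nonzero in both
  schemes, and there \<open>eigenvalue_sigma\<close> expresses both eigenvalues by the same
  parameters.\<close>

lemma adj_expansion:
  assumes i: "i \<le> d"
  shows "\<exists>a. adj_mat R i = lincomb d a E \<and> adj_mat S i = lincomb d a E'"
proof -
  obtain a b where a: "adj_mat R i = lincomb d a E" and b: "adj_mat S i = lincomb d b E'"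
    using X.E_span[OF X.adj_mem[OF i]] Y.E_span[OF Y.adj_mem[OF i]] by blast
  have "a r = b r" if r: "r \<le> d" for r
  proof -
    obtain s t where st: "(r, s, t) \<in> triples d" "X.star (r, s, t) \<noteq> (\<lambda>_. 0)"
      using X.star_nonzero[OF r] r by auto
    then have "Y.star (r, s, t) \<noteq> (\<lambda>_. 0)" using star_nonzero_iff by blast
    then have "b r = (\<Sum>j\<le>d. Y.sigma (j, i, 0) (r, s, t))" by (rule Y.eigenvalue_sigma[OF i b st(1)])
    also have "\<dots> = (\<Sum>j\<le>d. X.sigma (j, i, 0) (r, s, t))"
      using same_sigma st(1) i by (intro sum.cong) auto
    also have "\<dots> = a r" by (rule X.eigenvalue_sigma[OF i a st, symmetric])
    finally show ?thesis by simp
  qed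
  then have "lincomb d b E' = lincomb d a E'" by (auto simp: lincomb_def intro!: ext sum.cong)
  then show ?thesis using a b by auto
qed

text \<open>By \<open>adj_expansion\<close> the base change \<open>p\<close> is the same in both
  schemes, hence so is its inverse \<open>c\<close>, and \<open>\<kappa>\<close> sends
  \<open>E r\<close> to \<open>E' r\<close>. The adjacency form suits triangles; this form suits
  products and stars.\<close>

lemma algebra_pairs_E: "algebra_pairs = {(lincomb d a E, lincomb d a E') | a. True}"
proof -
  from adj_expansion obtain p where p: "\<forall>i\<le>d. adj_mat R i = lincomb d (p i) E"
    "\<forall>i\<le>d. adj_mat S i = lincomb d (p i) E'" by metis
  have "\<exists>c. E r = lincomb d c (adj_mat R)" if "r \<le> d" for r
    using X.E_rel[OF that] X.lincomb_adj by metis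
  then obtain c where c: "\<forall>r\<le>d. E r = lincomb d (c r) (adj_mat R)" by metis
  have c': "\<forall>r\<le>d. E' r = lincomb d (c r) (adj_mat S)"
  proof (intro allI impI)
    fix r assume r: "r \<le> d"
    have "lincomb d (\<lambda>i. if i = r then 1 else 0) E = lincomb d (\<lambda>s. \<Sum>i\<le>d. c r i * p i s) E"
      by (rule trans[OF X.lincomb_single[OF r, of E] trans[OF c[rule_format, OF r] lincomb_lincomb[OF p(1)]]])
    then have "(if s = r then 1 else 0) = (\<Sum>i\<le>d. c r i * p i s)" if "s \<le> d" for s
      using X.E_coeff_unique that by blast
    then have "lincomb d (\<lambda>i. if i = r then 1 else 0) E' = lincomb d (\<lambda>s. \<Sum>i\<le>d. c r i * p i s) E'"
      unfolding lincomb_def by (intro ext sum.cong) auto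
    then show "E' r = lincomb d (c r) (adj_mat S)" unfolding Y.lincomb_single[OF r] lincomb_lincomb[OF p(2), of "c r"] .
  qed
  show ?thesis
    unfolding algebra_pairs_def using lincomb_lincomb[OF p(1)] lincomb_lincomb[OF p(2)]
      lincomb_lincomb[OF c] lincomb_lincomb[OF c'] by (intro equalityI subsetI) blast+
qed

lemma algebra_pairs_mmult:
  assumes "(L, L') \<in> algebra_pairs" "(M, M') \<in> algebra_pairs"
  shows "(mmult L M, mmult L' M') \<in> algebra_pairs"
proof -
  from assms obtain a b where "L = lincomb d a E" "L' = lincomb d a E'" "M = lincomb d b E" "M' = lincomb d b E'"
    unfolding algebra_pairs_E by blast
  then show ?thesis unfolding algebra_pairs_E X.lincomb_E_mmult Y.lincomb_E_mmult by (simp add: X.lincomb_E_mmult Y.lincomb_E_mmult) blast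
qed

lemma ones_pair: "(\<lambda>_ _. 1, \<lambda>_ _. 1) \<in> algebra_pairs"
  unfolding algebra_pairs_def using X.adj_sum Y.adj_sum by (auto intro!: exI[of _ "\<lambda>_. 1"])

lemma algebra_pairs_symmetric:
  assumes "(M, M') \<in> algebra_pairs"
  shows "M x y = M y x" "M' x' y' = M' y' x'"
  using assms X.rel_sym Y.rel_sym unfolding algebra_pairs_def X.lincomb_adj Y.lincomb_adj by auto

lemma ones_coeff: "\<exists>b r. (\<lambda>_ _. 1) = lincomb d b E \<and> (\<lambda>_ _. 1) = lincomb d b E' \<and> r \<le> d \<and> b r \<noteq> 0"
proof -
  obtain b where b: "(\<lambda>_ _. 1) = lincomb d b E" "(\<lambda>_ _. 1) = lincomb d b E'"
    using ones_pair unfolding algebra_pairs_E by blast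
  have "\<exists>r\<le>d. b r \<noteq> 0"
  proof (rule ccontr)
    assume "\<not> ?thesis"
    then have "lincomb d b E = (\<lambda>_ _. 0)" by (auto simp: lincomb_def)
    then show False using b(1) by (metis zero_neq_one)
  qed
  then show ?thesis using b by blast
qed

text \<open>The all-ones matrix \<open>J\<close> lies in the commutative algebra, so
  \<open>J M = M J\<close> and the sums are constant in each scheme. The constants \<open>m\<close>
  and \<open>m'\<close> agree by comparing the coefficients of \<open>E r\<close> and
  \<open>E' r\<close> in \<open>J M = m J\<close> and \<open>J M' = m' J\<close>, at an index where
  the coefficient \<open>b r\<close> of \<open>J\<close> is nonzero.\<close>

lemma algebra_pairs_row_sum:
  assumes M: "(M, M') \<in> algebra_pairs"
  shows "\<exists>m. (\<forall>y. (\<Sum>x\<in>UNIV. M x y) = m) \<and> (\<forall>y. (\<Sum>x\<in>UNIV. M' x y) = m)"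
proof -
  obtain b r where b: "(\<lambda>_ _. 1) = lincomb d b E" "(\<lambda>_ _. 1) = lincomb d b E'" and r: "r \<le> d" "b r \<noteq> 0"
    using ones_coeff by blast
  obtain a where a: "M = lincomb d a E" "M' = lincomb d a E'" using M unfolding algebra_pairs_E by blast
  have X1: "mmult M (\<lambda>_ _. 1) = mmult (\<lambda>_ _. 1) M" unfolding a b X.lincomb_E_mmult by (simp add: mult.commute)
  have Y1: "mmult M' (\<lambda>_ _. 1) = mmult (\<lambda>_ _. 1) M'" unfolding a b Y.lincomb_E_mmult by (simp add: mult.commute)
  define m where "m = (\<Sum>x\<in>UNIV. M x undefined)"
  define m' where "m' = (\<Sum>x\<in>UNIV. M' x undefined)"
  have m: "(\<Sum>x\<in>UNIV. M x y) = m" for y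
  proof -
    have "(\<Sum>x\<in>UNIV. M x y) = mmult M (\<lambda>_ _. 1) y undefined"
      using algebra_pairs_symmetric(1)[OF M] by (simp add: mmult_def)
    then show ?thesis unfolding X1 by (simp add: mmult_def m_def)
  qed
  have m': "(\<Sum>x\<in>UNIV. M' x y) = m'" for y
  proof -
    have "(\<Sum>x\<in>UNIV. M' x y) = mmult M' (\<lambda>_ _. 1) y undefined"
      using algebra_pairs_symmetric(2)[OF M] by (simp add: mmult_def)
    then show ?thesis unfolding Y1 by (simp add: mmult_def m'_def)
  qed
  have "mmult (\<lambda>_ _. 1) M = (\<lambda>x y. m * 1)" using m by (simp add: mmult_def)
  also have "\<dots> = lincomb d (\<lambda>r. m * b r) E"
    using b(1) by (simp add: lincomb_def mult.assoc fun_eq_iff flip: sum_distrib_left)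
  finally have "b r * a r = m * b r"
    unfolding a b X.lincomb_E_mmult using X.E_coeff_unique[OF _ r(1)] by blast
  moreover have "mmult (\<lambda>_ _. 1) M' = (\<lambda>x y. m' * 1)" using m' by (simp add: mmult_def)
  then have "mmult (\<lambda>_ _. 1) M' = lincomb d (\<lambda>r. m' * b r) E'"
    using b(2) by (simp add: lincomb_def mult.assoc fun_eq_iff flip: sum_distrib_left)
  then have "b r * a r = m' * b r"
    unfolding a b Y.lincomb_E_mmult using Y.E_coeff_unique[OF _ r(1)] by blast
  ultimately have "m = m'" using r(2) by simp
  then show ?thesis using m m' by blast
qed

text \<open>The column sums of the all-ones matrix count the points.\<close>

lemma card_pair: "CARD('x) = CARD('y)"
  using algebra_pairs_row_sum[OF ones_pair] by auto

lemma triangle_pair_to_stars: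
  assumes "q \<in> triples d"
  shows "Delta_family (adj_mat R) q = (\<lambda>p. \<Sum>k\<in>triples d. X.sigma q k * X.star k p)"
    "Delta_family (adj_mat S) q = (\<lambda>p. \<Sum>k\<in>triples d. X.sigma q k * Y.star k p)"
  using X.sigma(1)[OF assms] Y.sigma(1)[OF assms] same_sigma[OF assms] by auto

text \<open>The coefficients \<open>\<tau>\<close> are found in the first scheme. Expanding the
  triangles into stars again, with parameters common to both schemes, gives coefficients
  \<open>\<mu>\<close> which on the nonvanishing stars are 1 at \<open>k\<close> and 0 elsewhere.
  The same index triples have nonvanishing stars in the second scheme, so \<open>\<tau>\<close>
  works there too.\<close>

lemma star_pair_to_triangles:
  assumes k: "k \<in> triples d"
  shows "\<exists>\<tau>. X.star k = (\<lambda>p. \<Sum>q\<in>triples d. \<tau> q * Delta_family (adj_mat R) q p) \<and>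
     Y.star k = (\<lambda>p. \<Sum>q\<in>triples d. \<tau> q * Delta_family (adj_mat S) q p)"
proof -
  have "X.star k \<in> Delta_alg d R" using X.star_mem[OF k] X.etr by (auto simp: exactly_triply_regular_def)
  from X.Delta_alg_triangle[OF this] obtain \<tau>
    where \<tau>: "X.star k = (\<lambda>p. \<Sum>q\<in>triples d. \<tau> q * Delta_family (adj_mat R) q p)" ..
  define \<mu> where "\<mu> = (\<lambda>l. \<Sum>q\<in>triples d. \<tau> q * X.sigma q l)"
  have swap: "(\<Sum>q\<in>triples d. \<tau> q * (\<Sum>l\<in>triples d. X.sigma q l * st l)) = (\<Sum>l\<in>triples d. \<mu> l * st l)" for st
    unfolding \<mu>_def by (rule sum_combine)
  have single: "(\<Sum>l\<in>triples d. (if l = k then 1 else 0) * st l) = st k" for st :: "_ \<Rightarrow> complex"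
    using k by (simp add: if_distrib[of "\<lambda>c. c * _"] cong: if_cong)
  have "(\<lambda>p. \<Sum>l\<in>triples d. \<mu> l * X.star l p) = X.star k"
    unfolding swap[symmetric] by (subst \<tau>) (simp add: triangle_pair_to_stars(1))
  then have "\<mu> l = (if l = k then 1 else 0)" if "l \<in> triples d" "X.star l \<noteq> (\<lambda>_. 0)" for l
    using X.star_coeff[of \<mu> "\<lambda>l. if l = k then 1 else 0" l] that unfolding single by blast
  then have \<mu>: "\<mu> l * Y.star l p = (if l = k then 1 else 0) * Y.star l p" if "l \<in> triples d" for l p
    using star_nonzero_iff[OF that] that by (cases "Y.star l = (\<lambda>_. 0)") auto
  have "Y.star k = (\<lambda>p. \<Sum>q\<in>triples d. \<tau> q * Delta_family (adj_mat S) q p)"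
  proof
    fix p
    have "(\<Sum>q\<in>triples d. \<tau> q * Delta_family (adj_mat S) q p) = (\<Sum>l\<in>triples d. \<mu> l * Y.star l p)"
      unfolding swap[symmetric] by (simp add: triangle_pair_to_stars(2))
    also have "\<dots> = (\<Sum>l\<in>triples d. (if l = k then 1 else 0) * Y.star l p)"
      by (rule sum.cong[OF refl \<mu>])
    finally show "Y.star k p = (\<Sum>q\<in>triples d. \<tau> q * Delta_family (adj_mat S) q p)" unfolding single ..
  qed
  then show ?thesis using \<tau> by blast
qed

sublocale star_triangle_pair algebra_pairs
proof
  show "(\<lambda>_ _. 1, \<lambda>_ _. 1) \<in> algebra_pairs" by (rule ones_pair)
  show "(id_mat, id_mat) \<in> algebra_pairs"
    unfolding algebra_pairs_E using X.E_sum Y.E_sum by (auto intro!: exI[of _ "\<lambda>_. 1"])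
  show "CARD('x) = CARD('y)" by (rule card_pair)
next
  fix M M' x y assume M: "(M, M') \<in> algebra_pairs"
  show "M x y = M y x" using M by (rule algebra_pairs_symmetric)
next
  fix M M' x y assume M: "(M, M') \<in> algebra_pairs"
  show "M' x y = M' y x" using M by (rule algebra_pairs_symmetric)
next
  fix L L' M M' assume "(L, L') \<in> algebra_pairs" "(M, M') \<in> algebra_pairs"
  then show "(mmult L M, mmult L' M') \<in> algebra_pairs" by (rule algebra_pairs_mmult)
next
  fix M M' assume M: "(M, M') \<in> algebra_pairs"
  then show "\<exists>m. (\<forall>y. (\<Sum>x\<in>UNIV. M x y) = m) \<and> (\<forall>y. (\<Sum>x\<in>UNIV. M' x y) = m)"
    by (rule algebra_pairs_row_sum)
  from M obtain c where "M = (\<lambda>x y. c (X.rel x y))" "M' = (\<lambda>x y. c (Y.rel x y))"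
    unfolding algebra_pairs_def X.lincomb_adj Y.lincomb_adj by blast
  moreover have "X.rel x x = 0" "Y.rel y y = 0" for x y by (simp_all add: X.rel_zero_iff Y.rel_zero_iff)
  ultimately show "\<exists>m. (\<forall>x. M x x = m) \<and> (\<forall>x. M' x x = m)" by simp
next
  fix L L' M M' N N'
  assume mem: "(L, L') \<in> algebra_pairs" "(M, M') \<in> algebra_pairs" "(N, N') \<in> algebra_pairs"
  have E_pair: "(E r, E' r) \<in> algebra_pairs" if "r \<le> d" for r
    unfolding algebra_pairs_E using X.lincomb_single[OF that, of E] Y.lincomb_single[OF that, of E']
    by (auto intro!: exI[of _ "\<lambda>i. if i = r then 1 else 0"])
  have A_pair: "(adj_mat R r, adj_mat S r) \<in> algebra_pairs" if "r \<le> d" for r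
    unfolding algebra_pairs_def using X.lincomb_single[OF that, of "adj_mat R"] Y.lincomb_single[OF that, of "adj_mat S"]
    by (auto intro!: exI[of _ "\<lambda>i. if i = r then 1 else 0"])
  let ?fst = "\<lambda>F (k::nat \<times> nat \<times> nat). F (fst k)" and ?snd = "\<lambda>F k. F (fst (snd k))" and ?trd = "\<lambda>F k. F (snd (snd k))"
  obtain a b c where abc: "L = lincomb d a (adj_mat R)" "L' = lincomb d a (adj_mat S)"
    "M = lincomb d b (adj_mat R)" "M' = lincomb d b (adj_mat S)"
    "N = lincomb d c (adj_mat R)" "N' = lincomb d c (adj_mat S)"
    using mem unfolding algebra_pairs_def by blast
  define \<tau> where "\<tau> = (\<lambda>k. \<Sum>q\<in>triples d. coeff3 a b c q * X.sigma q k)"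
  have "Delta L M N = (\<lambda>p. \<Sum>k\<in>triples d. \<tau> k * X.star k p)" "Delta L' M' N' = (\<lambda>p. \<Sum>k\<in>triples d. \<tau> k * Y.star k p)"
    unfolding abc Delta_lincomb \<tau>_def sum_combine[symmetric] by (simp_all add: triangle_pair_to_stars)
  then show "\<exists>(K :: (nat \<times> nat \<times> nat) set) c F G H F' G' H'.
        (\<forall>k\<in>K. (F k, F' k) \<in> algebra_pairs \<and> (G k, G' k) \<in> algebra_pairs \<and> (H k, H' k) \<in> algebra_pairs) \<and>
        Delta L M N = (\<lambda>a. \<Sum>k\<in>K. c k * Upsilon (F k) (G k) (H k) a) \<and>
        Delta L' M' N' = (\<lambda>a. \<Sum>k\<in>K. c k * Upsilon (F' k) (G' k) (H' k) a)"
    by (intro exI[of _ "triples d"] exI[of _ \<tau>] exI[of _ "?fst E"] exI[of _ "?snd E"] exI[of _ "?trd E"]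
        exI[of _ "?fst E'"] exI[of _ "?snd E'"] exI[of _ "?trd E'"])
      (auto simp: Upsilon_family_def case_prod_unfold E_pair)
  obtain a' b' c' where abc': "L = lincomb d a' E" "L' = lincomb d a' E'"
    "M = lincomb d b' E" "M' = lincomb d b' E'" "N = lincomb d c' E" "N' = lincomb d c' E'"
    using mem unfolding algebra_pairs_E by blast
  have "\<forall>k\<in>triples d. \<exists>\<tau>. X.star k = (\<lambda>p. \<Sum>q\<in>triples d. \<tau> q * Delta_family (adj_mat R) q p) \<and>
     Y.star k = (\<lambda>p. \<Sum>q\<in>triples d. \<tau> q * Delta_family (adj_mat S) q p)" using star_pair_to_triangles by blast
  then obtain t where t: "\<forall>k\<in>triples d. X.star k = (\<lambda>p. \<Sum>q\<in>triples d. t k q * Delta_family (adj_mat R) q p) \<and>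
     Y.star k = (\<lambda>p. \<Sum>q\<in>triples d. t k q * Delta_family (adj_mat S) q p)" by (rule bchoice[THEN exE])
  define \<tau>' where "\<tau>' = (\<lambda>k. \<Sum>q\<in>triples d. coeff3 a' b' c' q * t q k)"
  have "Upsilon L M N = (\<lambda>p. \<Sum>k\<in>triples d. \<tau>' k * Delta_family (adj_mat R) k p)"
    "Upsilon L' M' N' = (\<lambda>p. \<Sum>k\<in>triples d. \<tau>' k * Delta_family (adj_mat S) k p)"
    unfolding abc' Upsilon_lincomb \<tau>'_def sum_combine[symmetric] using t
    by (auto intro!: ext sum.cong arg_cong2[where f = times])
  then show "\<exists>(K :: (nat \<times> nat \<times> nat) set) c F G H F' G' H'.
        (\<forall>k\<in>K. (F k, F' k) \<in> algebra_pairs \<and> (G k, G' k) \<in> algebra_pairs \<and> (H k, H' k) \<in> algebra_pairs) \<and>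
        Upsilon L M N = (\<lambda>a. \<Sum>k\<in>K. c k * Delta (F k) (G k) (H k) a) \<and>
        Upsilon L' M' N' = (\<lambda>a. \<Sum>k\<in>K. c k * Delta (F' k) (G' k) (H' k) a)"
    by (intro exI[of _ "triples d"] exI[of _ \<tau>'] exI[of _ "?fst (adj_mat R)"] exI[of _ "?snd (adj_mat R)"] exI[of _ "?trd (adj_mat R)"]
        exI[of _ "?fst (adj_mat S)"] exI[of _ "?snd (adj_mat S)"] exI[of _ "?trd (adj_mat S)"])
      (auto simp: Delta_family_def case_prod_unfold A_pair)
qed

end

theorem mainTheorem1:
  fixes d :: nat
    and R :: "nat \<Rightarrow> ('x::finite \<times> 'x) set" and S :: "nat \<Rightarrow> ('y::finite \<times> 'y) set"
    and E :: "nat \<Rightarrow> 'x mat" and E' :: "nat \<Rightarrow> 'y mat"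
    and \<kappa> :: "'x mat \<Rightarrow> 'y mat"
    and V :: "'v set" and Ed :: "'e set" and ends :: "'e \<Rightarrow> 'v \<times> 'v"
    and w :: "'e \<Rightarrow> 'x mat"
  assumes schemeX: "sym_assoc_scheme d R"
    and schemeY: "sym_assoc_scheme d S"
    and idemX: "prim_idempotents d R E"
    and idemY: "prim_idempotents d S E'"
    and etrX: "exactly_triply_regular d R"
    and etrY: "exactly_triply_regular d S"
    and same_dw: "\<forall>i\<le>d. \<forall>j\<le>d. \<forall>k\<le>d. \<forall>r\<le>d. \<forall>s\<le>d. \<forall>t\<le>d.
                   dw_sigma d R E i j k r s t = dw_sigma d S E' i j k r s t"
    and kappa_add: "\<forall>M\<in>bose_mesner d R. \<forall>N\<in>bose_mesner d R.
                      \<kappa> (\<lambda>x y. M x y + N x y) = (\<lambda>x y. \<kappa> M x y + \<kappa> N x y)"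
    and kappa_scale: "\<forall>c. \<forall>M\<in>bose_mesner d R. \<kappa> (\<lambda>x y. c * M x y) = (\<lambda>x y. c * \<kappa> M x y)"
    and kappa_A: "\<forall>i\<le>d. \<kappa> (adj_mat R i) = adj_mat S i"
    and graph: "finite_graph V Ed ends"
    and conn: "graph_connected V Ed ends"
    and planar: "planar_graph V Ed ends"
    and w_in: "\<forall>e\<in>Ed. w e \<in> bose_mesner d R"
  shows "scaffold0 V Ed ends w = scaffold0 V Ed ends (\<kappa> \<circ> w)"
proof -
  interpret X: etr_scheme d R E using schemeX idemX etrX by unfold_locales
  interpret Y: etr_scheme d S E' using schemeY idemY etrY by unfold_locales
  interpret dw_pair d R E S E'
    by unfold_locales (use same_dw in \<open>auto simp: X.sigma_def Y.sigma_def\<close>)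
  have kappa_lincomb: "\<kappa> (lincomb d c (adj_mat R)) = lincomb d c (adj_mat S)" for c
  proof -
    \<comment> \<open>Linearity of \<open>\<kappa>\<close> is given on the algebra only, so the
      induction also carries membership of the partial sums.\<close>
    have "\<kappa> (lincomb n c (adj_mat R)) = lincomb n c (adj_mat S) \<and> lincomb n c (adj_mat R) \<in> bose_mesner d R"
      if "n \<le> d" for n
      using that
    proof (induction n)
      case 0
      obtain f where f: "adj_mat R 0 = (\<lambda>x y. f (X.rel x y))"
        using X.adj_mem[of 0] by (auto simp: X.bose_mesner_iff)
      then have "(\<lambda>x y. c 0 * adj_mat R 0 x y) \<in> bose_mesner d R"
        unfolding X.bose_mesner_iff by (intro exI[of _ "\<lambda>i. c 0 * f i"]) simp
      moreover have "\<kappa> (\<lambda>x y. c 0 * adj_mat R 0 x y) = (\<lambda>x y. c 0 * adj_mat S 0 x y)"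
        using kappa_scale kappa_A X.adj_mem[of 0] by simp
      ultimately show ?case by (simp add: lincomb_def)
    next
      case (Suc n)
      then have IH: "\<kappa> (lincomb n c (adj_mat R)) = lincomb n c (adj_mat S)" "lincomb n c (adj_mat R) \<in> bose_mesner d R"
        by simp_all
      let ?T = "\<lambda>x y. c (Suc n) * adj_mat R (Suc n) x y"
      obtain f g where f: "adj_mat R (Suc n) = (\<lambda>x y. f (X.rel x y))" and g: "lincomb n c (adj_mat R) = (\<lambda>x y. g (X.rel x y))"
        using X.adj_mem[OF Suc.prems] IH(2) unfolding X.bose_mesner_iff by (elim exE)
      have T: "?T \<in> bose_mesner d R"
        unfolding X.bose_mesner_iff by (intro exI[of _ "\<lambda>i. c (Suc n) * f i"]) (simp add: f)
      have kT: "\<kappa> ?T = (\<lambda>x y. c (Suc n) * adj_mat S (Suc n) x y)"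
        using kappa_scale kappa_A X.adj_mem[OF Suc.prems] Suc.prems by simp
      have split: "lincomb (Suc n) c F = (\<lambda>x y. lincomb n c F x y + c (Suc n) * F (Suc n) x y)" for F :: "nat \<Rightarrow> 'z mat"
        by (simp add: lincomb_def)
      have "\<kappa> (lincomb (Suc n) c (adj_mat R)) = lincomb (Suc n) c (adj_mat S)"
        unfolding split using kappa_add IH T kT by simp
      moreover have "lincomb (Suc n) c (adj_mat R) \<in> bose_mesner d R"
        unfolding split X.bose_mesner_iff by (intro exI[of _ "\<lambda>i. g i + c (Suc n) * f i"]) (simp add: f g)
      ultimately show ?case by simp
    qed
    then show ?thesis by simp
  qed
  show ?thesis
  proof (rule planar_scaffold0_eq[OF graph planar])
    fix e assume "e \<in> Ed"
    then obtain c where "w e = lincomb d c (adj_mat R)"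
      using w_in unfolding bose_mesner_def lincomb_def by blast
    then show "(w e, (\<kappa> \<circ> w) e) \<in> algebra_pairs"
      unfolding algebra_pairs_def using kappa_lincomb by auto
  qed
qed

end
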